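(* Let $n\ge 1$ be an integer and let $l$ be a real number. Suppose $(u_0,u_1)\in (H^{l+1}(\mathbf{R}^n)\cap L^{1,1}(\mathbf{R}^n))\times(H^{l}(\mathbf{R}^n)\cap L^{1,1}(\mathbf{R}^n))$, and let $u\in X_2$ be the solution of the Cauchy problem $$u_{tt}-\Delta u_{tt}+\Delta^2u-\Delta u+u_t=0 \ \text{ in } (0,\infty)\times\mathbf{R}^n,\qquad u(0,x)=u_0(x),\quad u_t(0,x)=u_1(x).$$ Then, for all $t\ge 1$, $$\left\|\hat u(t,\xi)-(P_1+P_0)\,e^{-t|\xi|^2}\right\|_2\le\begin{cases} C I_0\, t^{-\frac{l+1}{2}}, & \text{if } n=4 \text{ and } l=2, \text{ or } n=5 \text{ and } 2\le l\le \frac52,\\ & \text{or } n\ge 6 \text{ and } \frac n2-1<l\le\frac n2,\\[1mm] C I_0\, t^{-\frac{n+2}{4}}, & \text{if } n\ge 4 \text{ and } \frac n2<l, \text{ or } n\in\{1,2,3\} \text{ and } 2\le l,\end{cases}$$ where $C>0$ is a constant independent of $t$ and of $u_0,u_1$.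
   Context: The Fourier transform (in $x$) is $\hat f(\xi)=\int_{\mathbf{R}^n}f(x)e^{-i\xi\cdot x}\,dx$. $\|\cdot\|_p$ is the $L^p(\mathbf{R}^n)$ norm; for functions of $(t,\xi)$, $\|\cdot\|_2$ is the $L^2$ norm in $\xi\in\mathbf{R}^n$. For real $l\ge 0$, $\|f\|_{H^l}=\left(\int_{\mathbf{R}^n}(1+|\xi|^2)^l|\hat f(\xi)|^2d\xi\right)^{1/2}$. $L^{1,1}(\mathbf{R}^n)$ is the set of $f\in L^1(\mathbf{R}^n)$ with $\|f\|_{1,1}:=\int_{\mathbf{R}^n}(1+|x|)|f(x)|dx<\infty$. The solution class is $X_2:=C^2([0,\infty);H^1(\mathbf{R}^n))\cap C^1([0,\infty);H^2(\mathbf{R}^n))\cap C([0,\infty);H^3(\mathbf{R}^n))$. It is known that for $(u_0,u_1)\in H^3(\mathbf{R}^n)\times H^2(\mathbf{R}^n)$ the Cauchy problem has a unique solution in $X_2$. Put $P_j:=\int_{\mathbf{R}^n}u_j(x)\,dx$ for $j=0,1$, and $I_0:=\|u_1\|_{H^l}+\|u_0\|_{H^{l+1}}+\|u_1\|_{1,1}+\|u_0\|_{1,1}$. *)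

theory Defs
  imports "HOL-Analysis.Analysis"
begin

text \<open>
  Elements of the function spaces on \<open>\<real>\<^sup>n\<close> are represented by Borel functions
  \<open>real ^ 'n \<Rightarrow> complex\<close>, not by classes modulo null sets (every class of Lebesgue measurable
  functions contains a Borel function). Two representatives are compared with \<open>AE\<close>, or by the
  norm of their difference.
\<close>

subsection \<open>Lebesgue spaces and the Fourier transform\<close>

definition L2_space :: "(real ^ 'n::finite \<Rightarrow> complex) set" where
  "L2_space = {f \<in> borel_measurable lborel. integrable lborel (\<lambda>x. (cmod (f x))\<^sup>2)}"

definition L2_norm :: "(real ^ 'n::finite \<Rightarrow> complex) \<Rightarrow> real" where
  "L2_norm f = sqrt (LINT x|lborel. (cmod (f x))\<^sup>2)"

definition L11_space :: "(real ^ 'n::finite \<Rightarrow> complex) set" where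
  "L11_space = {f. integrable lborel f \<and> integrable lborel (\<lambda>x. (1 + norm x) * cmod (f x))}"

definition L11_norm :: "(real ^ 'n::finite \<Rightarrow> complex) \<Rightarrow> real" where
  "L11_norm f = (LINT x|lborel. (1 + norm x) * cmod (f x))"

definition fourier_L1 :: "(real ^ 'n::finite \<Rightarrow> complex) \<Rightarrow> real ^ 'n \<Rightarrow> complex" where
  "fourier_L1 f \<xi> = (LINT x|lborel. f x * exp (- \<i> * complex_of_real (\<xi> \<bullet> x)))"

text \<open>
  The Fourier transform on \<open>L\<^sup>2\<close> is the \<open>L\<^sup>2\<close>-limit of the transforms of the truncations to
  balls, which are integrable. The square of the \<open>L\<^sup>2\<close>-distance is taken in \<^typ>\<open>ennreal\<close>,
  so that no finiteness is presupposed.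
\<close>

definition has_fourier_L2 ::
    "(real ^ 'n::finite \<Rightarrow> complex) \<Rightarrow> (real ^ 'n \<Rightarrow> complex) \<Rightarrow> bool" where
  "has_fourier_L2 f g \<longleftrightarrow> f \<in> L2_space \<and> g \<in> L2_space \<and>
     ((\<lambda>R. \<integral>\<^sup>+\<xi>. ennreal ((cmod (fourier_L1 (\<lambda>x. indicator (ball 0 R) x * f x) \<xi> - g \<xi>))\<^sup>2) \<partial>lborel)
        \<longlongrightarrow> 0) at_top"

text \<open>By Plancherel's theorem, such a \<open>g\<close> exists for every \<open>f\<close> in \<open>L\<^sup>2\<close>; it is unique up to a null set.\<close>

definition fourier :: "(real ^ 'n::finite \<Rightarrow> complex) \<Rightarrow> real ^ 'n \<Rightarrow> complex" where
  "fourier f = (SOME g. has_fourier_L2 f g)"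

subsection \<open>Sobolev spaces and functions of time with values in them\<close>

text \<open>For \<open>s \<ge> 0\<close>; elements of Sobolev spaces of negative order need not be functions.\<close>

definition H_space :: "real \<Rightarrow> (real ^ 'n::finite \<Rightarrow> complex) set" where
  "H_space s = {f. \<exists>g. has_fourier_L2 f g \<and>
     integrable lborel (\<lambda>\<xi>. (1 + (norm \<xi>)\<^sup>2) powr s * (cmod (g \<xi>))\<^sup>2)}"

definition H_norm :: "real \<Rightarrow> (real ^ 'n::finite \<Rightarrow> complex) \<Rightarrow> real" where
  "H_norm s f = sqrt (LINT \<xi>|lborel. (1 + (norm \<xi>)\<^sup>2) powr s * (cmod (fourier f \<xi>))\<^sup>2)"

definition H_continuous :: "real \<Rightarrow> (real \<Rightarrow> real ^ 'n::finite \<Rightarrow> complex) \<Rightarrow> bool" where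
  "H_continuous s u \<longleftrightarrow> (\<forall>t\<ge>0. u t \<in> H_space s) \<and>
     (\<forall>t\<ge>0. ((\<lambda>\<tau>. H_norm s (\<lambda>x. u \<tau> x - u t x)) \<longlongrightarrow> 0) (at t within {0..}))"

text \<open>\<open>v\<close> is the derivative of \<open>u : [0,\<infinity>) \<rightarrow> H\<^sup>s\<close> in the norm of \<open>H\<^sup>s\<close>, one-sided at \<open>0\<close>.\<close>

definition H_has_derivative ::
    "real \<Rightarrow> (real \<Rightarrow> real ^ 'n::finite \<Rightarrow> complex) \<Rightarrow> (real \<Rightarrow> real ^ 'n \<Rightarrow> complex) \<Rightarrow> bool" where
  "H_has_derivative s u v \<longleftrightarrow> (\<forall>t\<ge>0. u t \<in> H_space s \<and> v t \<in> H_space s) \<and>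
     (\<forall>t\<ge>0. ((\<lambda>\<tau>. H_norm s (\<lambda>x. (u \<tau> x - u t x) / complex_of_real (\<tau> - t) - v t x)) \<longlongrightarrow> 0)
        (at t within {0..}))"

fun Ck_H :: "nat \<Rightarrow> real \<Rightarrow> (real \<Rightarrow> real ^ 'n::finite \<Rightarrow> complex) \<Rightarrow> bool" where
  "Ck_H 0 s u \<longleftrightarrow> H_continuous s u"
| "Ck_H (Suc k) s u \<longleftrightarrow> H_continuous s u \<and> (\<exists>v. H_has_derivative s u v \<and> Ck_H k s v)"

definition X2_space :: "(real \<Rightarrow> real ^ 'n::finite \<Rightarrow> complex) set" where
  "X2_space = {u. Ck_H 2 1 u \<and> Ck_H 1 2 u \<and> Ck_H 0 3 u}"

subsection \<open>The Cauchy problem\<close>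

definition partial_deriv :: "'n::finite \<Rightarrow> (real ^ 'n \<Rightarrow> real) \<Rightarrow> real ^ 'n \<Rightarrow> real" where
  "partial_deriv i \<phi> x = frechet_derivative \<phi> (at x) (axis i 1)"

definition laplacian :: "(real ^ 'n::finite \<Rightarrow> real) \<Rightarrow> real ^ 'n \<Rightarrow> real" where
  "laplacian \<phi> x = (\<Sum>i\<in>UNIV. partial_deriv i (partial_deriv i \<phi>) x)"

text \<open>Real-valued \<open>C\<^sup>\<infinity>\<close> functions with compact support: all iterated partial derivatives are differentiable.\<close>

definition test_functions :: "(real ^ 'n::finite \<Rightarrow> real) set" where
  "test_functions = {\<phi>. (\<forall>is. fold partial_deriv is \<phi> differentiable_on UNIV) \<and>
     compact (closure {x. \<phi> x \<noteq> 0})}"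

definition distr_of ::
    "(real ^ 'n::finite \<Rightarrow> complex) \<Rightarrow> (real ^ 'n \<Rightarrow> real) \<Rightarrow> complex" where
  "distr_of f \<phi> = (LINT x|lborel. f x * complex_of_real (\<phi> x))"

definition distr_laplacian ::
    "((real ^ 'n::finite \<Rightarrow> real) \<Rightarrow> complex) \<Rightarrow> (real ^ 'n \<Rightarrow> real) \<Rightarrow> complex" where
  "distr_laplacian T \<phi> = T (laplacian \<phi>)"

text \<open>
  For \<open>u\<close> in \<open>X\<^sub>2\<close> the terms \<open>\<Delta>u\<^sub>t\<^sub>t\<close> and \<open>\<Delta>\<^sup>2u\<close> only lie in \<open>H\<^sup>-\<^sup>1\<close>; the equation
  is therefore understood for each \<open>t > 0\<close> in the sense of distributions in \<open>x\<close>. Here \<open>v\<close> and \<open>w\<close> are the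
  time derivatives \<open>u\<^sub>t\<close> and \<open>u\<^sub>t\<^sub>t\<close>.
\<close>

definition X2_solution ::
    "(real ^ 'n::finite \<Rightarrow> complex) \<Rightarrow> (real ^ 'n \<Rightarrow> complex) \<Rightarrow>
     (real \<Rightarrow> real ^ 'n \<Rightarrow> complex) \<Rightarrow> bool" where
  "X2_solution u\<^sub>0 u\<^sub>1 u \<longleftrightarrow> u \<in> X2_space \<and>
     (\<exists>v w. H_has_derivative 2 u v \<and> H_has_derivative 1 v w \<and>
        (\<forall>t>0. \<forall>\<phi>\<in>test_functions.
           distr_of (w t) \<phi> - distr_laplacian (distr_of (w t)) \<phi>
           + distr_laplacian (distr_laplacian (distr_of (u t))) \<phi>
           - distr_laplacian (distr_of (u t)) \<phi> + distr_of (v t) \<phi> = 0) \<and>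
        (AE x in lborel. u 0 x = u\<^sub>0 x) \<and> (AE x in lborel. v 0 x = u\<^sub>1 x))"

definition total_mass :: "(real ^ 'n::finite \<Rightarrow> complex) \<Rightarrow> complex" where
  "total_mass f = (LINT x|lborel. f x)"

definition data_norm ::
    "real \<Rightarrow> (real ^ 'n::finite \<Rightarrow> complex) \<Rightarrow> (real ^ 'n \<Rightarrow> complex) \<Rightarrow> real" where
  "data_norm l u\<^sub>0 u\<^sub>1 = H_norm l u\<^sub>1 + H_norm (l + 1) u\<^sub>0 + L11_norm u\<^sub>1 + L11_norm u\<^sub>0"

end

theory Submission
  imports Defs "HOL-Probability.Characteristic_Functions"
begin

text \<open>
  With \<open>a = \<bar>\<xi>\<bar>\<^sup>2\<close> the Fourier transform turns the equation into
  \<open>(1 + a) y'' + y' + a (1 + a) y = 0\<close> for every frequency \<open>\<xi>\<close>. Its characteristic roots have the sum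
  \<open>- 1 / (1 + a)\<close> and the product \<open>a\<close>.

  For small \<open>a\<close> the roots are real. One of them stays below \<open>- 1 / 2\<close>, the other one is
  \<open>- a + O(a\<^sup>2)\<close>, so that the solution is \<open>exp (- t a)\<close> times the sum of the transformed data, up to
  a relative error \<open>O(a + t a\<^sup>2)\<close> and an exponentially small term (\<open>low_frequency_bound\<close>). At the frequency \<open>\<xi>\<close>
  the transformed data differ from the masses by at most \<open>\<bar>\<xi>\<bar>\<close> times a first moment. Altogether the error is of the order
  \<open>\<bar>\<xi>\<bar> exp (- t a / 2)\<close>, which has the \<open>L\<^sup>2\<close>-norm \<open>O(t powr (- (n + 2) / 4))\<close>.

  For large \<open>a\<close> the roots are complex with real part \<open>- 1 / (2 (1 + a))\<close>: the damping degenerates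
  as the frequency grows, and decay has to be bought with regularity of the data
  (\<open>high_frequency_bound\<close>). The factor \<open>exp (- c t / (1 + a))\<close> is at most a
  constant times \<open>(t / (1 + a)) powr (- (l + 1))\<close>, and the powers of \<open>1 + a\<close> are the weights of the Sobolev norms.
  This gives the rate \<open>t powr (- (l + 1) / 2)\<close>. The slower one of the two rates is the second one
  if \<open>l \<le> n / 2\<close> and the first one if \<open>l \<ge> n / 2\<close>.

  It remains to derive the formula for the transformed solution from the weak formulation.
  Tested with all translates of a test function \<open>\<phi>\<close>, the equation says that a sum of correlations with \<open>\<phi>\<close> and
  its derivatives vanishes identically. Correlation becomes multiplication under the Fourier transform
  (\<open>fourier_pair_correlation\<close>), and the transform of zero is zero because of
  \<open>\<integral> \<bar>fourier f\<bar>\<^sup>2 \<le> (2 \<pi>)\<^sup>n \<integral> \<bar>f\<bar>\<^sup>2\<close> (\<open>sqnorm_fourier_L1_le\<close>). Bumps with small support have transforms without zeros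
  in large balls, so that \<open>\<phi>\<close> can be removed (\<open>weak_equation_fourier\<close>).

  The time derivatives exist in the norm of \<open>L\<^sup>2\<close> only, and no differential equation is available at a
  single frequency. If \<open>\<kappa>\<close> and \<open>\<kappa>'\<close> are the characteristic roots and \<open>V\<close> is the time derivative of \<open>U\<close>,
  then \<open>V - \<kappa>' U\<close> solves the first order equation with rate \<open>\<kappa>\<close>. After multiplication with the integrating factor, and on a
  ball of frequencies, its derivative in \<open>L\<^sup>2\<close> is zero. The \<open>L\<^sup>2\<close>-distance to its initial value is then a real function with
  derivative zero (\<open>L2_deriv_zero_constant\<close>), which yields \<open>X2_solution_fourier_formula\<close>.
\<close>

section \<open>The square norm with values in the extended reals\<close>

definition sqnorm :: "(real ^ 'n::finite \<Rightarrow> complex) \<Rightarrow> ennreal" where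
  "sqnorm f = (\<integral>\<^sup>+x. ennreal ((cmod (f x))\<^sup>2) \<partial>lborel)"

lemma L2_space_iff:
  "f \<in> L2_space \<longleftrightarrow> f \<in> borel_measurable borel \<and> sqnorm f < \<infinity>"
  unfolding L2_space_def sqnorm_def by (auto simp: integrable_iff_bounded)

lemma L2_space_measurable [measurable_dest]: "f \<in> L2_space \<Longrightarrow> f \<in> borel_measurable borel"
  by (simp add: L2_space_iff)

lemma L2_norm_nonneg [simp]: "L2_norm f \<ge> 0"
  by (simp add: L2_norm_def)

lemma sqnorm_eq_L2_norm: "f \<in> L2_space \<Longrightarrow> sqnorm f = ennreal ((L2_norm f)\<^sup>2)"
  unfolding sqnorm_def L2_norm_def
  by (subst nn_integral_eq_integral) (auto simp: L2_space_def)

lemma sqnorm_cong_AE: "AE x in lborel. f x = g x \<Longrightarrow> sqnorm f = sqnorm g"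
  unfolding sqnorm_def by (intro nn_integral_cong_AE) auto

lemma sqnorm_mult_bounded:
  assumes [measurable]: "f \<in> borel_measurable borel" and "\<And>x. cmod (m x) \<le> B"
  shows "sqnorm (\<lambda>x. m x * f x) \<le> ennreal (B\<^sup>2) * sqnorm f"
proof -
  have "sqnorm (\<lambda>x. m x * f x) \<le> (\<integral>\<^sup>+x. ennreal (B\<^sup>2) * ennreal ((cmod (f x))\<^sup>2) \<partial>lborel)"
    unfolding sqnorm_def
    by (intro nn_integral_mono)
       (auto simp: norm_mult power_mult_distrib ennreal_mult[symmetric] intro!: ennreal_leI mult_right_mono power_mono assms)
  also have "\<dots> = ennreal (B\<^sup>2) * sqnorm f"
    unfolding sqnorm_def by (rule nn_integral_cmult) measurable
  finally show ?thesis .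
qed

lemma sqnorm_cmult:
  assumes "f \<in> borel_measurable borel"
  shows "sqnorm (\<lambda>x. c * f x) \<le> ennreal ((cmod c)\<^sup>2) * sqnorm f"
  by (rule sqnorm_mult_bounded[OF assms]) simp

lemma cmod_add_square_le: "(cmod (a + b))\<^sup>2 \<le> 2 * (cmod a)\<^sup>2 + 2 * (cmod b)\<^sup>2"
proof -
  have "(cmod (a + b))\<^sup>2 \<le> (cmod a + cmod b)\<^sup>2"
    by (intro power_mono norm_triangle_ineq) simp
  also have "\<dots> \<le> 2 * (cmod a)\<^sup>2 + 2 * (cmod b)\<^sup>2"
    using sum_squares_ge_zero[of "cmod a - cmod b" 0] by (simp add: power2_eq_square algebra_simps)
  finally show ?thesis .
qed

lemma sqnorm_add_le:
  assumes [measurable]: "f \<in> borel_measurable borel" "g \<in> borel_measurable borel"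
  shows "sqnorm (\<lambda>x. f x + g x) \<le> 2 * sqnorm f + 2 * sqnorm g"
proof -
  have "sqnorm (\<lambda>x. f x + g x) \<le>
      (\<integral>\<^sup>+x. 2 * ennreal ((cmod (f x))\<^sup>2) + 2 * ennreal ((cmod (g x))\<^sup>2) \<partial>lborel)"
    unfolding sqnorm_def
  proof (intro nn_integral_mono)
    fix x
    have "ennreal ((cmod (f x + g x))\<^sup>2) \<le> ennreal (2 * (cmod (f x))\<^sup>2 + 2 * (cmod (g x))\<^sup>2)"
      by (intro ennreal_leI cmod_add_square_le)
    also have "\<dots> = 2 * ennreal ((cmod (f x))\<^sup>2) + 2 * ennreal ((cmod (g x))\<^sup>2)"
      by (simp add: ennreal_plus ennreal_mult)
    finally show "ennreal ((cmod (f x + g x))\<^sup>2) \<le> 2 * ennreal ((cmod (f x))\<^sup>2) + 2 * ennreal ((cmod (g x))\<^sup>2)" .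
  qed
  also have "\<dots> = 2 * sqnorm f + 2 * sqnorm g"
    unfolding sqnorm_def by (simp add: nn_integral_add nn_integral_cmult)
  finally show ?thesis .
qed

lemma sqnorm_eq_0_iff:
  assumes [measurable]: "f \<in> borel_measurable borel"
  shows "sqnorm f = 0 \<longleftrightarrow> (AE x in lborel. f x = 0)"
  unfolding sqnorm_def by (subst nn_integral_0_iff_AE) auto

lemma L2_space_bounded_mult:
  assumes "f \<in> L2_space" and [measurable]: "m \<in> borel_measurable borel" and "\<And>x. cmod (m x) \<le> B"
  shows "(\<lambda>x. m x * f x) \<in> L2_space"
proof -
  have "sqnorm (\<lambda>x. m x * f x) \<le> ennreal (B\<^sup>2) * sqnorm f"
    using assms by (intro sqnorm_mult_bounded) auto
  also have "\<dots> < \<infinity>"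
    using assms by (auto simp: L2_space_iff ennreal_mult_less_top)
  finally show ?thesis
    using assms(1) by (auto simp: L2_space_iff)
qed

lemma L2_space_cmult: "f \<in> L2_space \<Longrightarrow> (\<lambda>x. c * f x) \<in> L2_space"
  by (rule L2_space_bounded_mult[where B = "cmod c"]) auto

lemma L2_space_add:
  assumes "f \<in> L2_space" "g \<in> L2_space"
  shows "(\<lambda>x. f x + g x) \<in> L2_space"
proof -
  have "sqnorm (\<lambda>x. f x + g x) \<le> 2 * sqnorm f + 2 * sqnorm g"
    using assms by (intro sqnorm_add_le) (auto simp: L2_space_iff)
  also have "\<dots> < \<infinity>"
    using assms by (auto simp: L2_space_iff ennreal_mult_less_top)
  finally show ?thesis
    using assms by (auto simp: L2_space_iff)
qed

lemma L2_space_diff: "f \<in> L2_space \<Longrightarrow> g \<in> L2_space \<Longrightarrow> (\<lambda>x. f x - g x) \<in> L2_space"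
  using L2_space_add[OF _ L2_space_cmult[of g "-1"]] by simp

lemma L2_norm_triangle:
  assumes f: "f \<in> L2_space" and g: "g \<in> L2_space"
  shows "L2_norm (\<lambda>x. f x + g x) \<le> L2_norm f + L2_norm g"
proof -
  have [measurable]: "f \<in> borel_measurable borel" "g \<in> borel_measurable borel"
    using f g by (auto simp: L2_space_iff)
  define S where "S = (\<integral>\<^sup>+x. ennreal (cmod (f x)) * ennreal (cmod (g x)) \<partial>lborel)"
  have "S\<^sup>2 \<le> sqnorm f * sqnorm g"
    unfolding S_def sqnorm_def using Cauchy_Schwarz_nn_integral[of "\<lambda>x. ennreal (cmod (f x))" lborel "\<lambda>x. ennreal (cmod (g x))"]
    by (simp add: ennreal_power)
  also have "\<dots> = (ennreal (L2_norm f * L2_norm g))\<^sup>2"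
    using f g by (simp add: sqnorm_eq_L2_norm ennreal_mult ennreal_power[symmetric] power_mult_distrib)
  finally have S: "S \<le> ennreal (L2_norm f * L2_norm g)"
    by (cases S)
       (auto simp: ennreal_power power_mono_iff top_unique intro: power2_le_imp_le)
  have "sqnorm (\<lambda>x. f x + g x) \<le>
      (\<integral>\<^sup>+x. ennreal ((cmod (f x))\<^sup>2) + 2 * (ennreal (cmod (f x)) * ennreal (cmod (g x))) + ennreal ((cmod (g x))\<^sup>2) \<partial>lborel)"
    unfolding sqnorm_def
  proof (intro nn_integral_mono)
    fix x
    have "(cmod (f x + g x))\<^sup>2 \<le> (cmod (f x) + cmod (g x))\<^sup>2"
      by (intro power_mono norm_triangle_ineq) simp
    then have "ennreal ((cmod (f x + g x))\<^sup>2) \<le> ennreal ((cmod (f x))\<^sup>2 + 2 * (cmod (f x) * cmod (g x)) + (cmod (g x))\<^sup>2)"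
      by (intro ennreal_leI) (simp add: power2_eq_square algebra_simps)
    also have "\<dots> = ennreal ((cmod (f x))\<^sup>2) + 2 * (ennreal (cmod (f x)) * ennreal (cmod (g x))) + ennreal ((cmod (g x))\<^sup>2)"
      by (simp add: ennreal_plus ennreal_mult)
    finally show "ennreal ((cmod (f x + g x))\<^sup>2) \<le> \<dots>" .
  qed
  also have "\<dots> = sqnorm f + 2 * S + sqnorm g"
    unfolding sqnorm_def S_def by (simp add: nn_integral_add nn_integral_cmult)
  also have "\<dots> \<le> sqnorm f + 2 * ennreal (L2_norm f * L2_norm g) + sqnorm g"
    by (intro add_mono mult_left_mono S) auto
  also have "\<dots> = ennreal ((L2_norm f + L2_norm g)\<^sup>2)"
  proof -
    have "(L2_norm f + L2_norm g)\<^sup>2 = (L2_norm f)\<^sup>2 + 2 * (L2_norm f * L2_norm g) + (L2_norm g)\<^sup>2"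
      by (simp add: power2_eq_square algebra_simps)
    then show ?thesis
      using f g by (simp add: sqnorm_eq_L2_norm ennreal_plus ennreal_mult)
  qed
  finally have "(L2_norm (\<lambda>x. f x + g x))\<^sup>2 \<le> (L2_norm f + L2_norm g)\<^sup>2"
    using L2_space_add[OF f g] by (simp add: sqnorm_eq_L2_norm)
  then show ?thesis
    by (rule power2_le_imp_le) simp
qed

lemma L2_norm_minus: "L2_norm (\<lambda>x. - f x) = L2_norm f"
  by (simp add: L2_norm_def)

lemma L2_norm_reverse_triangle:
  assumes f: "f \<in> L2_space" and g: "g \<in> L2_space"
  shows "\<bar>L2_norm f - L2_norm g\<bar> \<le> L2_norm (\<lambda>x. f x - g x)"
proof -
  have "L2_norm f \<le> L2_norm (\<lambda>x. f x - g x) + L2_norm g"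
    using L2_norm_triangle[OF L2_space_diff[OF f g] g] by simp
  moreover have "L2_norm g \<le> L2_norm (\<lambda>x. g x - f x) + L2_norm f"
    using L2_norm_triangle[OF L2_space_diff[OF g f] f] by simp
  moreover have "L2_norm (\<lambda>x. g x - f x) = L2_norm (\<lambda>x. f x - g x)"
    using L2_norm_minus[of "\<lambda>x. f x - g x"] by simp
  ultimately show ?thesis by linarith
qed

section \<open>The Fourier transform on integrable and on square integrable functions\<close>

abbreviation wave :: "real ^ 'n::finite \<Rightarrow> real ^ 'n \<Rightarrow> complex" where
  "wave \<xi> x \<equiv> exp (- \<i> * complex_of_real (\<xi> \<bullet> x))"

lemma fourier_L1_integrable:
  assumes "integrable lborel f"
  shows "integrable lborel (\<lambda>x. f x * wave \<xi> x)"
  by (rule Bochner_Integration.integrable_bound[OF assms]) (use assms in \<open>auto simp: norm_mult\<close>)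

lemma fourier_L1_measurable [measurable]:
  assumes [measurable]: "f \<in> borel_measurable borel"
  shows "fourier_L1 f \<in> borel_measurable borel"
  unfolding fourier_L1_def[abs_def] by measurable

lemma fourier_L1_bound:
  "cmod (fourier_L1 f \<xi>) \<le> (LINT x|lborel. cmod (f x))"
  unfolding fourier_L1_def by (rule order_trans[OF integral_norm_bound]) (simp add: norm_mult)

lemma fourier_L1_linear:
  assumes f: "integrable lborel f" and g: "integrable lborel g"
  shows "fourier_L1 (\<lambda>x. c * f x + d * g x) \<xi> = c * fourier_L1 f \<xi> + d * fourier_L1 g \<xi>"
proof -
  have "fourier_L1 (\<lambda>x. c * f x + d * g x) \<xi> =
     (LINT x|lborel. c * (f x * wave \<xi> x) + d * (g x * wave \<xi> x))"
    unfolding fourier_L1_def by (simp add: algebra_simps)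
  also have "\<dots> = c * fourier_L1 f \<xi> + d * fourier_L1 g \<xi>"
    unfolding fourier_L1_def
    by (subst Bochner_Integration.integral_add)
       (use fourier_L1_integrable[OF f, of \<xi>] fourier_L1_integrable[OF g, of \<xi>] in auto)
  finally show ?thesis .
qed

lemma ball_in_borel [measurable]: "ball c r \<in> sets borel"
  by simp

text \<open>On a ball the bound \<open>\<bar>f\<bar> \<le> 1 + \<bar>f\<bar>\<^sup>2\<close> has a finite integral.\<close>

lemma L2_truncation_integrable:
  fixes f :: "real ^ 'n::finite \<Rightarrow> complex"
  assumes "f \<in> L2_space"
  shows "integrable lborel (\<lambda>x. indicator (ball 0 R) x * f x)"
proof (rule Bochner_Integration.integrable_bound)
  have "integrable lborel (indicator (ball 0 R) :: real ^ 'n \<Rightarrow> real)"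
    using emeasure_lborel_ball_finite[of 0 R] by (intro integrable_real_indicator) auto
  then show "integrable lborel (\<lambda>x. indicator (ball 0 R) x + (cmod (f x))\<^sup>2)"
    using assms by (intro Bochner_Integration.integrable_add) (auto simp: L2_space_def)
  show "AE x in lborel. norm (indicator (ball 0 R) x * f x) \<le> norm (indicator (ball 0 R) x + (cmod (f x))\<^sup>2)"
  proof (intro AE_I2)
    fix x
    have "0 \<le> (cmod (f x) - 1/2)\<^sup>2" by simp
    then show "norm (indicator (ball 0 R) x * f x) \<le> norm (indicator (ball 0 R) x + (cmod (f x))\<^sup>2)"
      by (auto simp: indicator_def power2_eq_square algebra_simps)
  qed
qed (use L2_space_measurable[OF assms] in measurable)

lemma has_fourier_L2_iff:
  "has_fourier_L2 f g \<longleftrightarrow> f \<in> L2_space \<and> g \<in> L2_space \<and>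
     ((\<lambda>R. sqnorm (\<lambda>\<xi>. fourier_L1 (\<lambda>x. indicator (ball 0 R) x * f x) \<xi> - g \<xi>)) \<longlongrightarrow> 0) at_top"
  unfolding has_fourier_L2_def sqnorm_def by simp

lemma sqnorm_linear_le:
  assumes [measurable]: "f \<in> borel_measurable borel" "g \<in> borel_measurable borel"
  shows "sqnorm (\<lambda>x. c * f x + d * g x) \<le> ennreal (2 * (cmod c)\<^sup>2) * sqnorm f + ennreal (2 * (cmod d)\<^sup>2) * sqnorm g"
proof -
  have "sqnorm (\<lambda>x. c * f x + d * g x) \<le> 2 * sqnorm (\<lambda>x. c * f x) + 2 * sqnorm (\<lambda>x. d * g x)"
    by (rule sqnorm_add_le) measurable
  also have "\<dots> \<le> 2 * (ennreal ((cmod c)\<^sup>2) * sqnorm f) + 2 * (ennreal ((cmod d)\<^sup>2) * sqnorm g)"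
    by (intro add_mono mult_left_mono sqnorm_cmult) auto
  finally show ?thesis
    by (simp add: ennreal_mult mult.assoc)
qed

lemma tendsto_sqnorm_dominated:
  assumes g: "((\<lambda>i. sqnorm (g i)) \<longlongrightarrow> 0) F" and c: "c < top"
    and le: "\<forall>\<^sub>F i in F. sqnorm (f i) \<le> c * sqnorm (g i)"
  shows "((\<lambda>i. sqnorm (f i)) \<longlongrightarrow> 0) F"
proof (rule tendsto_sandwich[OF _ le tendsto_const])
  show "((\<lambda>i. c * sqnorm (g i)) \<longlongrightarrow> 0) F"
    using ennreal_tendsto_cmult[OF c g] by simp
qed auto

lemma tendsto_sqnorm_linear:
  assumes f: "((\<lambda>i. sqnorm (f i)) \<longlongrightarrow> 0) F" and g: "((\<lambda>i. sqnorm (g i)) \<longlongrightarrow> 0) F"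
    and "\<And>i. f i \<in> borel_measurable borel" "\<And>i. g i \<in> borel_measurable borel"
  shows "((\<lambda>i. sqnorm (\<lambda>x. c * f i x + d * g i x)) \<longlongrightarrow> 0) F"
proof (rule tendsto_sandwich[OF _ _ tendsto_const])
  show "((\<lambda>i. ennreal (2 * (cmod c)\<^sup>2) * sqnorm (f i) + ennreal (2 * (cmod d)\<^sup>2) * sqnorm (g i)) \<longlongrightarrow> 0) F"
    using tendsto_add[OF ennreal_tendsto_cmult[OF _ f, of "ennreal (2 * (cmod c)\<^sup>2)"]
        ennreal_tendsto_cmult[OF _ g, of "ennreal (2 * (cmod d)\<^sup>2)"]] by simp
  show "\<forall>\<^sub>F i in F. sqnorm (\<lambda>x. c * f i x + d * g i x) \<le> ennreal (2 * (cmod c)\<^sup>2) * sqnorm (f i) + ennreal (2 * (cmod d)\<^sup>2) * sqnorm (g i)"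
    by (intro always_eventually allI sqnorm_linear_le assms)
qed auto

lemma has_fourier_L2_linear:
  assumes f: "has_fourier_L2 f g" and f': "has_fourier_L2 f' g'"
  shows "has_fourier_L2 (\<lambda>x. c * f x + d * f' x) (\<lambda>\<xi>. c * g \<xi> + d * g' \<xi>)"
proof -
  let ?T = "\<lambda>f R x. indicator (ball 0 R) x * f x"
  have L2: "f \<in> L2_space" "g \<in> L2_space" "f' \<in> L2_space" "g' \<in> L2_space"
    using f f' by (auto simp: has_fourier_L2_iff)
  note [measurable] = L2[THEN L2_space_measurable]
  have eq: "(\<lambda>\<xi>. fourier_L1 (?T (\<lambda>x. c * f x + d * f' x) R) \<xi> - (c * g \<xi> + d * g' \<xi>))
     = (\<lambda>\<xi>. c * (fourier_L1 (?T f R) \<xi> - g \<xi>) + d * (fourier_L1 (?T f' R) \<xi> - g' \<xi>))" for R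
  proof
    fix \<xi>
    have "?T (\<lambda>x. c * f x + d * f' x) R = (\<lambda>x. c * ?T f R x + d * ?T f' R x)"
      by (auto simp: algebra_simps)
    then show "fourier_L1 (?T (\<lambda>x. c * f x + d * f' x) R) \<xi> - (c * g \<xi> + d * g' \<xi>)
      = c * (fourier_L1 (?T f R) \<xi> - g \<xi>) + d * (fourier_L1 (?T f' R) \<xi> - g' \<xi>)"
      using fourier_L1_linear[OF L2_truncation_integrable[OF L2(1), of R] L2_truncation_integrable[OF L2(3), of R], of c d \<xi>]
      by (simp add: algebra_simps)
  qed
  have "((\<lambda>R. sqnorm (\<lambda>\<xi>. c * (fourier_L1 (?T f R) \<xi> - g \<xi>) + d * (fourier_L1 (?T f' R) \<xi> - g' \<xi>))) \<longlongrightarrow> 0) at_top"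
  proof (rule tendsto_sqnorm_linear)
    show "((\<lambda>R. sqnorm (\<lambda>\<xi>. fourier_L1 (?T f R) \<xi> - g \<xi>)) \<longlongrightarrow> 0) at_top"
      "((\<lambda>R. sqnorm (\<lambda>\<xi>. fourier_L1 (?T f' R) \<xi> - g' \<xi>)) \<longlongrightarrow> 0) at_top"
      using f f' by (auto simp: has_fourier_L2_iff)
  qed (use L2 in \<open>auto intro!: borel_measurable_diff fourier_L1_measurable borel_measurable_times\<close>)
  then show ?thesis
    unfolding has_fourier_L2_iff eq using L2 by (auto intro!: L2_space_add L2_space_cmult)
qed

lemma sqnorm_limit_unique:
  assumes f: "((\<lambda>i. sqnorm (\<lambda>x. f i x - g x)) \<longlongrightarrow> 0) F" and h: "((\<lambda>i. sqnorm (\<lambda>x. f i x - h x)) \<longlongrightarrow> 0) F"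
    and [measurable]: "\<And>i. f i \<in> borel_measurable borel" "g \<in> borel_measurable borel" "h \<in> borel_measurable borel"
    and F: "F \<noteq> bot"
  shows "AE x in lborel. g x = h x"
proof -
  have "((\<lambda>i. sqnorm (\<lambda>x. 1 * (f i x - h x) + (- 1) * (f i x - g x))) \<longlongrightarrow> 0) F"
    by (rule tendsto_sqnorm_linear[OF h f]) measurable
  then have "((\<lambda>i. sqnorm (\<lambda>x. g x - h x)) \<longlongrightarrow> 0) F"
    by simp
  then have "sqnorm (\<lambda>x. g x - h x) = 0"
    using F tendsto_const_iff by blast
  then show ?thesis
    by (subst (asm) sqnorm_eq_0_iff) auto
qed

lemma has_fourier_L2_unique:
  assumes "has_fourier_L2 f g" "has_fourier_L2 f h"
  shows "AE x in lborel. g x = h x"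
proof -
  have [measurable]: "f \<in> borel_measurable borel" "g \<in> borel_measurable borel" "h \<in> borel_measurable borel"
    using assms by (auto simp: has_fourier_L2_iff L2_space_iff)
  show ?thesis
    using assms unfolding has_fourier_L2_iff
    by (intro sqnorm_limit_unique[where F = at_top and g = g and h = h]) (auto intro!: fourier_L1_measurable borel_measurable_times)
qed

lemma has_fourier_L2_cong_AE:
  assumes f: "has_fourier_L2 f g" and eq: "AE x in lborel. f x = f' x" and [measurable]: "f' \<in> borel_measurable borel"
  shows "has_fourier_L2 f' g"
proof -
  have [measurable]: "f \<in> borel_measurable borel"
    using f by (auto simp: has_fourier_L2_iff L2_space_iff)
  have "fourier_L1 (\<lambda>x. indicator (ball 0 R) x * f x) = fourier_L1 (\<lambda>x. indicator (ball 0 R) x * f' x)" for R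
    unfolding fourier_L1_def[abs_def] by (intro ext integral_cong_AE) (measurable, use eq in auto)
  moreover have "sqnorm f = sqnorm f'"
    by (rule sqnorm_cong_AE[OF eq])
  ultimately show ?thesis
    using f by (auto simp: has_fourier_L2_iff L2_space_iff)
qed

lemma fourier_eqI:
  assumes "has_fourier_L2 f g"
  shows "has_fourier_L2 f (fourier f)" "AE \<xi> in lborel. fourier f \<xi> = g \<xi>"
proof -
  show "has_fourier_L2 f (fourier f)"
    unfolding fourier_def by (rule someI[of "has_fourier_L2 f", OF assms])
  then show "AE \<xi> in lborel. fourier f \<xi> = g \<xi>"
    using assms by (rule has_fourier_L2_unique)
qed

text \<open>
  By dominated convergence the transforms of the truncations converge pointwise as well, and Fatou's lemma shows
  that the pointwise limit has distance zero from the \<open>L\<^sup>2\<close>-limit.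
\<close>

lemma has_fourier_L2_eq_fourier_L1:
  fixes f g :: "real ^ 'n::finite \<Rightarrow> complex"
  assumes f: "has_fourier_L2 f g" and int: "integrable lborel f"
  shows "AE \<xi> in lborel. g \<xi> = fourier_L1 f \<xi>"
proof -
  have [measurable]: "f \<in> borel_measurable borel" "g \<in> borel_measurable borel"
    using f by (auto simp: has_fourier_L2_iff L2_space_iff)
  let ?F = "\<lambda>k::nat. fourier_L1 (\<lambda>x. indicator (ball 0 (real k)) x * f x)"
  have lim: "(\<lambda>k. ?F k \<xi>) \<longlonglongrightarrow> fourier_L1 f \<xi>" for \<xi>
    unfolding fourier_L1_def
  proof (rule integral_dominated_convergence)
    show "integrable lborel (\<lambda>x. cmod (f x))"
      using int by simp
    show "AE x in lborel. (\<lambda>k. indicator (ball 0 (real k)) x * f x * wave \<xi> x)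
             \<longlonglongrightarrow> f x * wave \<xi> x"
    proof (intro AE_I2 tendsto_eventually)
      fix x :: "real ^ 'n"
      obtain k0 :: nat where "norm x < k0" using reals_Archimedean2 by blast
      then show "\<forall>\<^sub>F k in sequentially. indicator (ball 0 (real k)) x * f x * wave \<xi> x = f x * wave \<xi> x"
        by (intro eventually_sequentiallyI[of k0]) (auto simp: indicator_def)
    qed
  qed (auto simp: norm_mult indicator_def)
  have L2: "(\<lambda>k. sqnorm (\<lambda>\<xi>. ?F k \<xi> - g \<xi>)) \<longlonglongrightarrow> 0"
    using f unfolding has_fourier_L2_iff by (auto intro: filterlim_compose[OF _ filterlim_real_sequentially])
  have "sqnorm (\<lambda>\<xi>. fourier_L1 f \<xi> - g \<xi>) = (\<integral>\<^sup>+\<xi>. liminf (\<lambda>k. ennreal ((cmod (?F k \<xi> - g \<xi>))\<^sup>2)) \<partial>lborel)"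
    unfolding sqnorm_def
  proof (intro nn_integral_cong)
    fix \<xi>
    have "(\<lambda>k. ennreal ((cmod (?F k \<xi> - g \<xi>))\<^sup>2)) \<longlonglongrightarrow> ennreal ((cmod (fourier_L1 f \<xi> - g \<xi>))\<^sup>2)"
      by (intro tendsto_intros lim)
    then show "ennreal ((cmod (fourier_L1 f \<xi> - g \<xi>))\<^sup>2) = liminf (\<lambda>k. ennreal ((cmod (?F k \<xi> - g \<xi>))\<^sup>2))"
      by (intro lim_imp_Liminf[symmetric] trivial_limit_sequentially)
  qed
  also have "\<dots> \<le> liminf (\<lambda>k. sqnorm (\<lambda>\<xi>. ?F k \<xi> - g \<xi>))"
    unfolding sqnorm_def by (rule nn_integral_liminf) measurable
  also have "\<dots> = 0"
    using L2 by (simp add: lim_imp_Liminf)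
  finally have "AE \<xi> in lborel. fourier_L1 f \<xi> - g \<xi> = 0"
    by (subst (asm) le_zero_eq, subst (asm) sqnorm_eq_0_iff) auto
  then show ?thesis by eventually_elim simp
qed

section \<open>Sobolev spaces on the Fourier side\<close>

lemma H_space_has_fourier:
  assumes "f \<in> H_space s"
  shows "has_fourier_L2 f (fourier f)"
  using assms fourier_eqI(1) by (auto simp: H_space_def)

lemma H_space_integrable:
  assumes "f \<in> H_space s"
  shows "integrable lborel (\<lambda>\<xi>. (1 + (norm \<xi>)\<^sup>2) powr s * (cmod (fourier f \<xi>))\<^sup>2)"
proof -
  obtain g where g: "has_fourier_L2 f g" "integrable lborel (\<lambda>\<xi>. (1 + (norm \<xi>)\<^sup>2) powr s * (cmod (g \<xi>))\<^sup>2)"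
    using assms by (auto simp: H_space_def)
  have [measurable]: "fourier f \<in> borel_measurable borel"
    using fourier_eqI(1)[OF g(1)] by (auto simp: has_fourier_L2_iff L2_space_iff)
  show ?thesis
    by (rule integrable_cong_AE_imp[OF g(2)]) (use fourier_eqI(2)[OF g(1)] in auto)
qed

lemma nn_integral_H_norm:
  assumes "f \<in> H_space s"
  shows "(\<integral>\<^sup>+\<xi>. ennreal ((1 + (norm \<xi>)\<^sup>2) powr s * (cmod (fourier f \<xi>))\<^sup>2) \<partial>lborel) = ennreal ((H_norm s f)\<^sup>2)"
  using H_space_integrable[OF assms] unfolding H_norm_def
  by (subst nn_integral_eq_integral) auto

lemma sqnorm_fourier_le_H_norm:
  assumes "f \<in> H_space s" "s \<ge> 0"
  shows "sqnorm (fourier f) \<le> ennreal ((H_norm s f)\<^sup>2)"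
proof -
  have "1 \<le> (1 + (norm \<xi>)\<^sup>2) powr s" for \<xi> :: "real ^ 'a"
    using assms(2) by (intro ge_one_powr_ge_zero) auto
  then have "1 * (cmod (fourier f \<xi>))\<^sup>2 \<le> (1 + (norm \<xi>)\<^sup>2) powr s * (cmod (fourier f \<xi>))\<^sup>2" for \<xi>
    by (intro mult_right_mono) auto
  then show ?thesis
    unfolding nn_integral_H_norm[OF assms(1), symmetric] sqnorm_def
    by (intro nn_integral_mono ennreal_leI) simp
qed

text \<open>
  The integral in \<^const>\<open>H_norm\<close> is \<open>0\<close> by convention if the integrand is not integrable, so a difference
  quotient must be known to lie in the space before the smallness of its norm has any content.
\<close>

lemma H_space_linear:
  assumes f: "f \<in> H_space s" and g: "g \<in> H_space s"
  shows "(\<lambda>x. c * f x + d * g x) \<in> H_space s"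
proof -
  have [measurable]: "fourier f \<in> borel_measurable borel" "fourier g \<in> borel_measurable borel"
    using H_space_has_fourier f g by (auto simp: has_fourier_L2_iff L2_space_iff)
  have "integrable lborel (\<lambda>\<xi>. (1 + (norm \<xi>)\<^sup>2) powr s * (cmod (c * fourier f \<xi> + d * fourier g \<xi>))\<^sup>2)"
  proof (rule Bochner_Integration.integrable_bound)
    show "integrable lborel (\<lambda>\<xi>. 2 * (cmod c)\<^sup>2 * ((1 + (norm \<xi>)\<^sup>2) powr s * (cmod (fourier f \<xi>))\<^sup>2)
        + 2 * (cmod d)\<^sup>2 * ((1 + (norm \<xi>)\<^sup>2) powr s * (cmod (fourier g \<xi>))\<^sup>2))"
      using H_space_integrable[OF f] H_space_integrable[OF g]
      by (intro Bochner_Integration.integrable_add integrable_mult_right) auto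
    show "AE \<xi> in lborel. norm ((1 + (norm \<xi>)\<^sup>2) powr s * (cmod (c * fourier f \<xi> + d * fourier g \<xi>))\<^sup>2)
       \<le> norm (2 * (cmod c)\<^sup>2 * ((1 + (norm \<xi>)\<^sup>2) powr s * (cmod (fourier f \<xi>))\<^sup>2)
        + 2 * (cmod d)\<^sup>2 * ((1 + (norm \<xi>)\<^sup>2) powr s * (cmod (fourier g \<xi>))\<^sup>2))"
    proof (intro AE_I2)
      fix \<xi> :: "real ^ 'a"
      have "(1 + (norm \<xi>)\<^sup>2) powr s * (cmod (c * fourier f \<xi> + d * fourier g \<xi>))\<^sup>2
         \<le> (1 + (norm \<xi>)\<^sup>2) powr s * (2 * (cmod (c * fourier f \<xi>))\<^sup>2 + 2 * (cmod (d * fourier g \<xi>))\<^sup>2)"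
        by (intro mult_left_mono cmod_add_square_le) simp
      then show "norm ((1 + (norm \<xi>)\<^sup>2) powr s * (cmod (c * fourier f \<xi> + d * fourier g \<xi>))\<^sup>2)
       \<le> norm (2 * (cmod c)\<^sup>2 * ((1 + (norm \<xi>)\<^sup>2) powr s * (cmod (fourier f \<xi>))\<^sup>2)
        + 2 * (cmod d)\<^sup>2 * ((1 + (norm \<xi>)\<^sup>2) powr s * (cmod (fourier g \<xi>))\<^sup>2))"
        by (simp add: norm_mult power_mult_distrib algebra_simps)
    qed
  qed measurable
  then show ?thesis
    using has_fourier_L2_linear[OF H_space_has_fourier[OF f] H_space_has_fourier[OF g]]
    unfolding H_space_def by blast
qed

lemma fourier_linear:
  assumes "f \<in> H_space s" "g \<in> H_space s'"
  shows "AE \<xi> in lborel. fourier (\<lambda>x. c * f x + d * g x) \<xi> = c * fourier f \<xi> + d * fourier g \<xi>"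
  by (rule fourier_eqI(2)[OF has_fourier_L2_linear[OF H_space_has_fourier[OF assms(1)] H_space_has_fourier[OF assms(2)]]])

section \<open>Integration over Euclidean space\<close>

lemma nn_integral_lborel_affine:
  fixes f :: "'a::euclidean_space \<Rightarrow> ennreal"
  assumes [measurable]: "f \<in> borel_measurable borel" and c: "c \<noteq> 0"
  shows "(\<integral>\<^sup>+x. f x \<partial>lborel) = ennreal (\<bar>c\<bar> ^ DIM('a)) * (\<integral>\<^sup>+x. f (t + c *\<^sub>R x) \<partial>lborel)"
  by (subst lborel_affine[OF c, of t])
     (simp add: nn_integral_density nn_integral_distr nn_integral_cmult)

lemma integral_lborel_reflect_shift:
  fixes f :: "'a::euclidean_space \<Rightarrow> complex"
  assumes [measurable]: "f \<in> borel_measurable borel"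
  shows "(LINT x|lborel. f (t - x)) = (LINT x|lborel. f x)"
proof -
  have "lborel = distr lborel borel (\<lambda>x::'a. t - x)"
    using lborel_affine[of "-1" t] by (simp add: density_1)
  then have "(LINT x|lborel. f x) = (LINT x|distr lborel borel (\<lambda>x::'a. t - x). f x)"
    by simp
  also have "\<dots> = (LINT x|lborel. f (t - x))"
    by (rule integral_distr) measurable
  finally show ?thesis by simp
qed

lemma integral_lborel_shift:
  fixes f :: "'a::euclidean_space \<Rightarrow> complex"
  assumes [measurable]: "f \<in> borel_measurable borel"
  shows "(LINT x|lborel. f (x + t)) = (LINT x|lborel. f x)"
proof -
  have "(LINT x|lborel. f x) = (LINT x|distr lborel borel (\<lambda>x. t + x). f x)"
    by (simp add: lborel_distr_plus)
  also have "\<dots> = (LINT x|lborel. f (t + x))"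
    by (rule integral_distr) measurable
  finally show ?thesis by (simp add: add.commute)
qed

lemma nn_integral_lborel_shift:
  fixes f :: "'a::euclidean_space \<Rightarrow> ennreal"
  assumes [measurable]: "f \<in> borel_measurable borel"
  shows "(\<integral>\<^sup>+x. f (x - t) \<partial>lborel) = (\<integral>\<^sup>+x. f x \<partial>lborel)"
    and "(\<integral>\<^sup>+x. f (t - x) \<partial>lborel) = (\<integral>\<^sup>+x. f x \<partial>lborel)"
  using nn_integral_lborel_affine[of f 1 "-t"] nn_integral_lborel_affine[of f "-1" t] by auto

lemma cmod_integral_le_nn_integral:
  "ennreal (cmod (LINT x|M. f x)) \<le> (\<integral>\<^sup>+x. ennreal (cmod (f x)) \<partial>M)"
proof (cases "integrable M f")
  case True
  then show ?thesis by (rule integral_norm_bound_ennreal)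
qed (simp add: not_integrable_integral_eq)

lemma integrable_lborel_pair:
  fixes F :: "real ^ 'n::finite \<Rightarrow> real ^ 'n \<Rightarrow> complex"
  assumes [measurable]: "(\<lambda>(x, y). F x y) \<in> borel_measurable (borel \<Otimes>\<^sub>M borel)"
    and fin: "(\<integral>\<^sup>+x. \<integral>\<^sup>+y. ennreal (cmod (F x y)) \<partial>lborel \<partial>lborel) < \<infinity>"
  shows "integrable (lborel \<Otimes>\<^sub>M lborel) (\<lambda>(x, y). F x y)"
proof (rule integrableI_bounded)
  show "(\<integral>\<^sup>+z. ennreal (cmod (case z of (x, y) \<Rightarrow> F x y)) \<partial>(lborel \<Otimes>\<^sub>M lborel)) < \<infinity>"
    using fin by (subst lborel.nn_integral_fst[symmetric]) auto
qed auto

lemma Fubini_lborel: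
  fixes F :: "real ^ 'n::finite \<Rightarrow> real ^ 'n \<Rightarrow> complex"
  assumes "(\<lambda>(x, y). F x y) \<in> borel_measurable (borel \<Otimes>\<^sub>M borel)"
    and "(\<integral>\<^sup>+x. \<integral>\<^sup>+y. ennreal (cmod (F x y)) \<partial>lborel \<partial>lborel) < \<infinity>"
  shows "(LINT x|lborel. LINT y|lborel. F x y) = (LINT y|lborel. LINT x|lborel. F x y)"
  using lborel_pair.Fubini_integral[OF integrable_lborel_pair[OF assms]] by simp

lemma nn_integral_limit_le:
  fixes f :: "nat \<Rightarrow> 'a \<Rightarrow> ennreal"
  assumes [measurable]: "\<And>k. f k \<in> borel_measurable M"
    and lim: "\<And>x. (\<lambda>k. f k x) \<longlonglongrightarrow> g x" and B: "\<And>k. (\<integral>\<^sup>+x. f k x \<partial>M) \<le> B"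
  shows "(\<integral>\<^sup>+x. g x \<partial>M) \<le> B"
proof -
  have "(\<integral>\<^sup>+x. g x \<partial>M) = (\<integral>\<^sup>+x. liminf (\<lambda>k. f k x) \<partial>M)"
    by (intro nn_integral_cong lim_imp_Liminf[symmetric] trivial_limit_sequentially lim)
  also have "\<dots> \<le> liminf (\<lambda>k. \<integral>\<^sup>+x. f k x \<partial>M)"
    by (rule nn_integral_liminf) measurable
  also have "\<dots> \<le> limsup (\<lambda>k. \<integral>\<^sup>+x. f k x \<partial>M)"
    by (rule Liminf_le_Limsup) simp
  also have "\<dots> \<le> B"
    by (rule Limsup_bounded) (simp add: B)
  finally show ?thesis .
qed

section \<open>Gaussians\<close>

lemma gauss_integrable_1d:
  fixes c :: real
  assumes c: "c > 0"
  shows "integrable lborel (\<lambda>x. exp (- c * x\<^sup>2))"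
proof -
  have "integrable lborel (\<lambda>x. sqrt (2 * pi * (1 / sqrt (2 * c))\<^sup>2) * normal_density 0 (1 / sqrt (2 * c)) x)"
    using c by (intro integrable_mult_right integrable_normal_density) auto
  moreover have "sqrt (2 * pi * (1 / sqrt (2 * c))\<^sup>2) * normal_density 0 (1 / sqrt (2 * c)) x = exp (- c * x\<^sup>2)" for x
    using c by (simp add: normal_density_def power_divide)
  ultimately show ?thesis by simp
qed

text \<open>A linear substitution in the characteristic function of the standard normal distribution.\<close>

lemma gauss_fourier_1d:
  fixes c t :: real
  assumes c: "c > 0"
  shows "(LINT x|lborel. complex_of_real (exp (- c * x\<^sup>2)) * exp (- \<i> * complex_of_real (t * x)))
    = complex_of_real (sqrt (pi / c) * exp (- t\<^sup>2 / (4 * c)))"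
proof -
  have std: "(LINT x|lborel. complex_of_real (exp (- x\<^sup>2 / 2)) * exp (\<i> * complex_of_real (s * x)))
     = complex_of_real (sqrt (2 * pi) * exp (- s\<^sup>2 / 2))" for s :: real
  proof -
    have "char std_normal_distribution s = (LINT x|lborel. std_normal_density x *\<^sub>R exp (\<i> * complex_of_real (s * x)))"
      unfolding char_def by (subst integral_density) (auto simp: normal_density_nonneg)
    also have "\<dots> = (LINT x|lborel. complex_of_real (1 / sqrt (2 * pi)) *
       (complex_of_real (exp (- x\<^sup>2 / 2)) * exp (\<i> * complex_of_real (s * x))))"
      by (simp add: std_normal_density_def scaleR_conv_of_real mult.assoc)
    also have "\<dots> = complex_of_real (1 / sqrt (2 * pi)) *
       (LINT x|lborel. complex_of_real (exp (- x\<^sup>2 / 2)) * exp (\<i> * complex_of_real (s * x)))"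
      by simp
    finally show ?thesis
      by (simp add: char_std_normal_distribution field_simps)
  qed
  define a where "a = sqrt (2 * c)"
  have a: "a > 0" "a\<^sup>2 = 2 * c" using c by (auto simp: a_def)
  have "complex_of_real (sqrt (2 * pi) * exp (- (- t / a)\<^sup>2 / 2)) =
     a *\<^sub>R (LINT x|lborel. complex_of_real (exp (- (a * x)\<^sup>2 / 2)) * exp (\<i> * complex_of_real (- t / a * (a * x))))"
    unfolding std[symmetric] using a
    by (subst lborel_integral_real_affine[of a _ 0]) auto
  also have "(LINT x|lborel. complex_of_real (exp (- (a * x)\<^sup>2 / 2)) * exp (\<i> * complex_of_real (- t / a * (a * x))))
    = (LINT x|lborel. complex_of_real (exp (- c * x\<^sup>2)) * exp (- \<i> * complex_of_real (t * x)))"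
    using a by (simp add: power_mult_distrib)
  finally have "(LINT x|lborel. complex_of_real (exp (- c * x\<^sup>2)) * exp (- \<i> * complex_of_real (t * x)))
    = complex_of_real (1 / a * (sqrt (2 * pi) * exp (- (t / a)\<^sup>2 / 2)))"
    using a by (simp add: scaleR_conv_of_real field_simps)
  moreover have "1 / a * sqrt (2 * pi) = sqrt (pi / c)"
    unfolding a_def using c by (simp add: real_sqrt_divide real_sqrt_mult)
  moreover have "- (t / a)\<^sup>2 / 2 = - t\<^sup>2 / (4 * c)"
    using a by (simp add: power_divide)
  ultimately show ?thesis by (simp only: mult.assoc[symmetric])
qed

lemma lborel_integral_prod_Basis:
  fixes f :: "'a::euclidean_space \<Rightarrow> real \<Rightarrow> complex"
  assumes int: "\<And>b. b \<in> Basis \<Longrightarrow> integrable lborel (f b)"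
  shows "integrable lborel (\<lambda>x::'a. \<Prod>b\<in>Basis. f b (x \<bullet> b))"
    and "(LINT x|lborel. (\<Prod>b\<in>Basis. f b ((x::'a) \<bullet> b))) = (\<Prod>b\<in>Basis. LINT x|lborel. f b x)"
proof -
  interpret product_sigma_finite "\<lambda>_::'a. lborel :: real measure"
    by standard
  have [measurable]: "f b \<in> borel_measurable borel" if "b \<in> Basis" for b
    using borel_measurable_integrable[OF int[OF that]] by simp
  have T: "(\<lambda>y. \<Sum>b\<in>Basis. y b *\<^sub>R b) \<in> (\<Pi>\<^sub>M b\<in>Basis. lborel) \<rightarrow>\<^sub>M (borel :: 'a measure)"
    by measurable
  have meas: "(\<lambda>x::'a. \<Prod>b\<in>Basis. f b (x \<bullet> b)) \<in> borel_measurable borel"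
    by measurable
  have eq: "(\<Prod>b\<in>Basis. f b ((\<Sum>b\<in>Basis. y b *\<^sub>R b) \<bullet> b)) = (\<Prod>b\<in>Basis. f b (y b))" for y
    by (intro prod.cong refl) simp
  have "integrable (\<Pi>\<^sub>M b\<in>Basis. lborel) (\<lambda>y. \<Prod>b\<in>Basis. f b (y b))"
    by (rule product_integrable_prod) (auto intro: int)
  then show "integrable lborel (\<lambda>x::'a. \<Prod>b\<in>Basis. f b (x \<bullet> b))"
    by (subst lborel_eq) (simp add: integrable_distr_eq[OF T meas] eq)
  have "(LINT x|lborel. (\<Prod>b\<in>Basis. f b ((x::'a) \<bullet> b))) = (LINT y|(\<Pi>\<^sub>M b\<in>Basis. lborel). (\<Prod>b\<in>Basis. f b (y b)))"
    by (subst lborel_eq) (simp add: integral_distr[OF T meas] eq)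
  also have "\<dots> = (\<Prod>b\<in>Basis. LINT x|lborel. f b x)"
    by (rule product_integral_prod) (auto intro: int)
  finally show "(LINT x|lborel. (\<Prod>b\<in>Basis. f b ((x::'a) \<bullet> b))) = (\<Prod>b\<in>Basis. LINT x|lborel. f b x)" .
qed

definition gauss :: "real \<Rightarrow> real ^ 'n::finite \<Rightarrow> complex" where
  "gauss c x = complex_of_real (exp (- c * (norm x)\<^sup>2))"

lemma gauss_measurable [measurable]: "gauss c \<in> borel_measurable borel"
  unfolding gauss_def[abs_def] by measurable

lemma gauss_prod: "gauss c x = (\<Prod>b\<in>Basis. complex_of_real (exp (- c * (x \<bullet> b)\<^sup>2)))"
proof -
  have "(norm x)\<^sup>2 = (\<Sum>b\<in>Basis. (x \<bullet> b)\<^sup>2)"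
    unfolding power2_norm_eq_inner by (subst euclidean_inner) (simp add: power2_eq_square)
  then show ?thesis
    unfolding gauss_def by (simp add: sum_distrib_left exp_sum flip: sum_negf)
qed

lemma gauss_integrable:
  assumes "c > 0"
  shows "integrable lborel (gauss c :: real ^ 'n::finite \<Rightarrow> complex)"
  unfolding gauss_prod[abs_def]
  using gauss_integrable_1d[OF assms] by (intro lborel_integral_prod_Basis(1)) simp

lemma fourier_L1_gauss:
  fixes \<xi> :: "real ^ 'n::finite"
  assumes c: "c > 0"
  shows "fourier_L1 (gauss c) \<xi> = complex_of_real (sqrt (pi / c) ^ CARD('n)) * gauss (1 / (4 * c)) \<xi>"
proof -
  have e: "wave \<xi> x = (\<Prod>b\<in>Basis. exp (- \<i> * complex_of_real ((\<xi> \<bullet> b) * (x \<bullet> b))))" for x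
    by (subst euclidean_inner) (simp add: sum_distrib_left exp_sum flip: sum_negf)
  have "fourier_L1 (gauss c) \<xi> =
     (LINT x|lborel. (\<Prod>b\<in>Basis. complex_of_real (exp (- c * (x \<bullet> b)\<^sup>2)) * exp (- \<i> * complex_of_real ((\<xi> \<bullet> b) * (x \<bullet> b)))))"
    unfolding fourier_L1_def gauss_prod e by (simp only: prod.distrib)
  also have "\<dots> = (\<Prod>b\<in>Basis. LINT x|lborel. complex_of_real (exp (- c * x\<^sup>2)) * exp (- \<i> * complex_of_real ((\<xi> \<bullet> b) * x)))"
  proof (rule lborel_integral_prod_Basis(2))
    fix b :: "real ^ 'n"
    show "integrable lborel (\<lambda>x. complex_of_real (exp (- c * x\<^sup>2)) * exp (- \<i> * complex_of_real ((\<xi> \<bullet> b) * x)))"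
      by (rule Bochner_Integration.integrable_bound[OF gauss_integrable_1d[OF c]]) (auto simp: norm_mult)
  qed
  also have "\<dots> = (\<Prod>b\<in>Basis. complex_of_real (sqrt (pi / c)) * complex_of_real (exp (- (1 / (4 * c)) * (\<xi> \<bullet> b)\<^sup>2)))"
    by (intro prod.cong refl, subst gauss_fourier_1d[OF c]) simp
  also have "\<dots> = complex_of_real (sqrt (pi / c) ^ CARD('n)) * gauss (1 / (4 * c)) \<xi>"
    unfolding gauss_prod by (simp add: prod.distrib)
  finally show ?thesis .
qed

lemma nn_integral_gauss:
  assumes c: "c > 0"
  shows "(\<integral>\<^sup>+x. ennreal (cmod (gauss c (x :: real ^ 'n::finite))) \<partial>lborel) = ennreal (sqrt (pi / c) ^ CARD('n))"
proof -
  have "fourier_L1 (gauss c) (0 :: real ^ 'n) = (LINT x|lborel. complex_of_real (exp (- c * (norm (x :: real ^ 'n))\<^sup>2)))"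
    unfolding fourier_L1_def gauss_def by simp
  then have "complex_of_real (LINT x|lborel. exp (- c * (norm (x :: real ^ 'n))\<^sup>2)) = complex_of_real (sqrt (pi / c) ^ CARD('n))"
    using fourier_L1_gauss[OF c, of "0 :: real ^ 'n"] by (simp add: gauss_def)
  then have I: "(LINT x|lborel. exp (- c * (norm (x :: real ^ 'n))\<^sup>2)) = sqrt (pi / c) ^ CARD('n)"
    by (simp only: of_real_eq_iff)
  have "integrable lborel (\<lambda>x :: real ^ 'n. cmod (gauss c x))"
    by (intro integrable_norm gauss_integrable c)
  then show ?thesis
    using I by (subst nn_integral_eq_integral) (auto simp: gauss_def)
qed

section \<open>Correlation with an integrable function\<close>

text \<open>
  Up to a reflection of \<open>\<phi>\<close> this is a convolution. In this form its values are the pairings of \<open>f\<close> with the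
  translates of \<open>\<phi>\<close>, which is how a distributional equation produces them.
\<close>

definition correlation :: "(real ^ 'n::finite \<Rightarrow> complex) \<Rightarrow> (real ^ 'n \<Rightarrow> complex) \<Rightarrow> real ^ 'n \<Rightarrow> complex" where
  "correlation f \<phi> y = (LINT x|lborel. f x * \<phi> (x - y))"

lemma correlation_measurable [measurable]:
  assumes [measurable]: "f \<in> borel_measurable borel" "\<phi> \<in> borel_measurable borel"
  shows "correlation f \<phi> \<in> borel_measurable borel"
  unfolding correlation_def[abs_def] by measurable

lemma cmod_correlation_le:
  "ennreal (cmod (correlation f \<phi> y)) \<le> (\<integral>\<^sup>+x. ennreal (cmod (f x)) * ennreal (cmod (\<phi> (x - y))) \<partial>lborel)"
  unfolding correlation_def using cmod_integral_le_nn_integral[of lborel "\<lambda>x. f x * \<phi> (x - y)"]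
  by (simp add: norm_mult ennreal_mult)

text \<open>Young's inequality: the Cauchy-Schwarz inequality for the measure with density \<open>\<bar>\<phi> (x - y)\<bar>\<close>, followed by Tonelli's theorem.\<close>

lemma sqnorm_correlation_le:
  assumes [measurable]: "f \<in> borel_measurable borel" "\<phi> \<in> borel_measurable borel"
  shows "sqnorm (correlation f \<phi>) \<le> (\<integral>\<^sup>+x. ennreal (cmod (\<phi> x)) \<partial>lborel)\<^sup>2 * sqnorm f"
proof -
  define N where "N = (\<integral>\<^sup>+x. ennreal (cmod (\<phi> x)) \<partial>lborel)"
  have "ennreal ((cmod (correlation f \<phi> y))\<^sup>2) \<le> N * (\<integral>\<^sup>+x. ennreal ((cmod (f x))\<^sup>2) * ennreal (cmod (\<phi> (x - y))) \<partial>lborel)" for y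
  proof -
    let ?s = "\<lambda>x. ennreal (sqrt (cmod (\<phi> (x - y))))"
    have s: "?s x * ?s x = ennreal (cmod (\<phi> (x - y)))" for x
      by (simp flip: ennreal_mult)
    have "ennreal ((cmod (correlation f \<phi> y))\<^sup>2) \<le> (\<integral>\<^sup>+x. (ennreal (cmod (f x)) * ?s x) * ?s x \<partial>lborel)\<^sup>2"
      using power_mono[OF cmod_correlation_le, of f \<phi> y 2] by (simp add: ennreal_power mult.assoc s)
    also have "\<dots> \<le> (\<integral>\<^sup>+x. (ennreal (cmod (f x)) * ?s x)\<^sup>2 \<partial>lborel) * (\<integral>\<^sup>+x. (?s x)\<^sup>2 \<partial>lborel)"
      by (rule Cauchy_Schwarz_nn_integral) measurable
    also have "(\<lambda>x. (ennreal (cmod (f x)) * ?s x)\<^sup>2) = (\<lambda>x. ennreal ((cmod (f x))\<^sup>2) * ennreal (cmod (\<phi> (x - y))))"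
      using s by (auto simp: power_mult_distrib ennreal_power power2_eq_square[of "?s _"] simp del: real_sqrt_pow2)
    also have "(\<lambda>x. (?s x)\<^sup>2) = (\<lambda>x. ennreal (cmod (\<phi> (x - y))))"
      using s by (auto simp: power2_eq_square)
    also have "(\<integral>\<^sup>+x. ennreal (cmod (\<phi> (x - y))) \<partial>lborel) = N"
      unfolding N_def by (rule nn_integral_lborel_shift(1)[of "\<lambda>x. ennreal (cmod (\<phi> x))"]) measurable
    finally show ?thesis by (simp add: mult.commute)
  qed
  then have "sqnorm (correlation f \<phi>) \<le> (\<integral>\<^sup>+y. N * (\<integral>\<^sup>+x. ennreal ((cmod (f x))\<^sup>2) * ennreal (cmod (\<phi> (x - y))) \<partial>lborel) \<partial>lborel)"
    unfolding sqnorm_def by (rule nn_integral_mono)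
  also have "\<dots> = N * (\<integral>\<^sup>+y. (\<integral>\<^sup>+x. ennreal ((cmod (f x))\<^sup>2) * ennreal (cmod (\<phi> (x - y))) \<partial>lborel) \<partial>lborel)"
    by (rule nn_integral_cmult) measurable
  also have "(\<integral>\<^sup>+y. (\<integral>\<^sup>+x. ennreal ((cmod (f x))\<^sup>2) * ennreal (cmod (\<phi> (x - y))) \<partial>lborel) \<partial>lborel)
    = (\<integral>\<^sup>+x. (\<integral>\<^sup>+y. ennreal ((cmod (f x))\<^sup>2) * ennreal (cmod (\<phi> (x - y))) \<partial>lborel) \<partial>lborel)"
    by (rule lborel_pair.Fubini'[symmetric]) measurable
  also have "\<dots> = (\<integral>\<^sup>+x. ennreal ((cmod (f x))\<^sup>2) * N \<partial>lborel)"
    unfolding N_def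
    by (intro nn_integral_cong, subst nn_integral_cmult)
       (auto simp: nn_integral_lborel_shift(2)[of "\<lambda>x. ennreal (cmod (\<phi> x))"])
  also have "\<dots> = sqnorm f * N"
    unfolding sqnorm_def by (rule nn_integral_multc) measurable
  finally show ?thesis
    unfolding N_def by (simp add: power2_eq_square ac_simps)
qed

lemma nn_integral_correlation_le:
  assumes [measurable]: "f \<in> borel_measurable borel" "\<phi> \<in> borel_measurable borel"
  shows "(\<integral>\<^sup>+x. \<integral>\<^sup>+y. ennreal (cmod (f x * \<phi> (x - y))) \<partial>lborel \<partial>lborel)
     = (\<integral>\<^sup>+x. ennreal (cmod (f x)) \<partial>lborel) * (\<integral>\<^sup>+x. ennreal (cmod (\<phi> x)) \<partial>lborel)"
proof -
  have "(\<integral>\<^sup>+y. ennreal (cmod (f x * \<phi> (x - y))) \<partial>lborel) = ennreal (cmod (f x)) * (\<integral>\<^sup>+x. ennreal (cmod (\<phi> x)) \<partial>lborel)" for x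
    unfolding norm_mult ennreal_mult[OF norm_ge_zero norm_ge_zero]
    by (subst nn_integral_cmult) (auto simp: nn_integral_lborel_shift(2)[of "\<lambda>x. ennreal (cmod (\<phi> x))"])
  then show ?thesis
    by (simp add: nn_integral_multc)
qed

lemma correlation_integrable:
  assumes f: "integrable lborel f" and \<phi>: "integrable lborel \<phi>"
  shows "integrable lborel (correlation f \<phi>)"
proof -
  have [measurable]: "f \<in> borel_measurable borel" "\<phi> \<in> borel_measurable borel"
    using f \<phi> by auto
  have "integrable (lborel \<Otimes>\<^sub>M lborel) (\<lambda>(x, y). f x * \<phi> (x - y))"
    using f \<phi> by (intro integrable_lborel_pair)
      (auto simp: nn_integral_correlation_le integrable_iff_bounded ennreal_mult_less_top)
  from lborel_pair.integrable_snd[OF this] show ?thesis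
    unfolding correlation_def[abs_def] by simp
qed

lemma fourier_L1_correlation:
  assumes f: "integrable lborel f" and \<phi>: "integrable lborel \<phi>"
  shows "fourier_L1 (correlation f \<phi>) \<xi> = fourier_L1 f \<xi> * fourier_L1 \<phi> (- \<xi>)"
proof -
  have [measurable]: "f \<in> borel_measurable borel" "\<phi> \<in> borel_measurable borel"
    using f \<phi> by auto
  let ?e = "\<lambda>x. wave \<xi> x"
  have "fourier_L1 (correlation f \<phi>) \<xi> = (LINT y|lborel. LINT x|lborel. f x * \<phi> (x - y) * ?e y)"
    unfolding fourier_L1_def correlation_def by simp
  also have "\<dots> = (LINT x|lborel. LINT y|lborel. f x * \<phi> (x - y) * ?e y)"
  proof (rule Fubini_lborel[symmetric])
    show "(\<integral>\<^sup>+x. \<integral>\<^sup>+y. ennreal (cmod (f x * \<phi> (x - y) * ?e y)) \<partial>lborel \<partial>lborel) < \<infinity>"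
      using f \<phi> nn_integral_correlation_le[of f \<phi>]
      by (auto simp: integrable_iff_bounded ennreal_mult_less_top norm_mult)
  qed measurable
  also have "\<dots> = (LINT x|lborel. (f x * ?e x) * fourier_L1 \<phi> (- \<xi>))"
  proof (rule Bochner_Integration.integral_cong[OF refl])
    fix x
    have "(LINT y|lborel. f x * \<phi> (x - y) * ?e y) = (LINT y|lborel. f x * \<phi> (x - (x - y)) * ?e (x - y))"
      by (rule integral_lborel_reflect_shift[symmetric]) measurable
    also have "\<dots> = (LINT y|lborel. (f x * ?e x) * (\<phi> y * wave (- \<xi>) y))"
      by (intro Bochner_Integration.integral_cong refl) (simp add: inner_diff_right algebra_simps flip: exp_add)
    also have "\<dots> = (f x * ?e x) * fourier_L1 \<phi> (- \<xi>)"
      unfolding fourier_L1_def by simp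
    finally show "(LINT y|lborel. f x * \<phi> (x - y) * ?e y) = (f x * ?e x) * fourier_L1 \<phi> (- \<xi>)" .
  qed
  also have "\<dots> = fourier_L1 f \<xi> * fourier_L1 \<phi> (- \<xi>)"
    unfolding fourier_L1_def by simp
  finally show ?thesis .
qed

lemma borel_measurable_cnj [measurable]:
  assumes [measurable]: "f \<in> borel_measurable M"
  shows "(\<lambda>x. cnj (f x)) \<in> borel_measurable M"
  by (rule measurable_compose[OF assms]) (intro borel_measurable_continuous_onI continuous_intros)

section \<open>The Fourier transform is bounded in the square norm\<close>

lemma fourier_L1_multiplication_formula:
  assumes f: "integrable lborel f" and h: "integrable lborel h"
  shows "(LINT \<xi>|lborel. fourier_L1 f \<xi> * h \<xi>) = (LINT x|lborel. f x * fourier_L1 h x)"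
proof -
  have [measurable]: "f \<in> borel_measurable borel" "h \<in> borel_measurable borel"
    using f h by auto
  let ?F = "\<lambda>x \<xi>. f x * wave \<xi> x * h \<xi>"
  have "(LINT \<xi>|lborel. fourier_L1 f \<xi> * h \<xi>) = (LINT \<xi>|lborel. LINT x|lborel. ?F x \<xi>)"
    unfolding fourier_L1_def by simp
  also have "\<dots> = (LINT x|lborel. LINT \<xi>|lborel. ?F x \<xi>)"
  proof (rule Fubini_lborel[symmetric])
    have "(\<integral>\<^sup>+x. \<integral>\<^sup>+\<xi>. ennreal (cmod (?F x \<xi>)) \<partial>lborel \<partial>lborel)
       = (\<integral>\<^sup>+x. ennreal (cmod (f x)) * (\<integral>\<^sup>+\<xi>. ennreal (cmod (h \<xi>)) \<partial>lborel) \<partial>lborel)"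
      by (simp add: norm_mult ennreal_mult nn_integral_cmult)
    also have "\<dots> < \<infinity>"
      using f h by (simp add: nn_integral_multc integrable_iff_bounded ennreal_mult_less_top)
    finally show "(\<integral>\<^sup>+x. \<integral>\<^sup>+\<xi>. ennreal (cmod (?F x \<xi>)) \<partial>lborel \<partial>lborel) < \<infinity>" .
  qed measurable
  also have "\<dots> = (LINT x|lborel. f x * fourier_L1 h x)"
    unfolding fourier_L1_def by (simp add: ac_simps inner_commute)
  finally show ?thesis .
qed

text \<open>
  The Gaussian weight makes all integrals converge absolutely. By the multiplication formula and Fubini's theorem the weighted
  integral equals the pairing of \<open>g\<close> with the correlation of its conjugate with the transform \<open>K\<close> of the Gaussian.
  Young's inequality bounds it by the integral of \<open>K\<close>, which is \<open>(2 \<pi>)\<^sup>n\<close> for every \<open>c\<close>.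
\<close>

lemma sqnorm_fourier_gauss_weight:
  fixes g :: "real ^ 'n::finite \<Rightarrow> complex"
  assumes g: "integrable lborel g" and c: "c > 0"
  shows "(\<integral>\<^sup>+\<xi>. ennreal ((cmod (fourier_L1 g \<xi>))\<^sup>2 * exp (- c * (norm \<xi>)\<^sup>2)) \<partial>lborel) \<le> ennreal ((2 * pi) ^ CARD('n)) * sqnorm g"
proof -
  have [measurable]: "g \<in> borel_measurable borel" using g by auto
  define G where "G = fourier_L1 g"
  have [measurable]: "G \<in> borel_measurable borel" by (simp add: G_def)
  define K :: "real ^ 'n \<Rightarrow> complex" where "K = fourier_L1 (gauss c)"
  have K_eq: "K = (\<lambda>x. complex_of_real (sqrt (pi / c) ^ CARD('n)) * gauss (1 / (4 * c)) x)"
    unfolding K_def using c by (auto simp: fourier_L1_gauss)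
  have [measurable]: "K \<in> borel_measurable borel" by (simp add: K_def)
  have K_even: "K (- x) = K x" for x
    by (simp add: K_eq gauss_def)
  have K1: "(\<integral>\<^sup>+x. ennreal (cmod (K x)) \<partial>lborel) = ennreal ((2 * pi) ^ CARD('n))"
  proof -
    have "(\<integral>\<^sup>+x. ennreal (cmod (K x)) \<partial>lborel)
       = (\<integral>\<^sup>+x. ennreal (sqrt (pi / c) ^ CARD('n)) * ennreal (cmod (gauss (1 / (4 * c)) (x :: real ^ 'n))) \<partial>lborel)"
      unfolding K_eq using c by (simp add: norm_mult ennreal_mult norm_power)
    also have "\<dots> = ennreal (sqrt (pi / c) ^ CARD('n)) * ennreal (sqrt (pi / (1 / (4 * c))) ^ CARD('n))"
      using c by (subst nn_integral_cmult) (auto simp: nn_integral_gauss)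
    also have "\<dots> = ennreal ((sqrt (pi / c) * sqrt (pi / (1 / (4 * c)))) ^ CARD('n))"
      using c by (simp add: power_mult_distrib ennreal_mult)
    also have "sqrt (pi / c) * sqrt (pi / (1 / (4 * c))) = sqrt ((2 * pi)\<^sup>2)"
      unfolding real_sqrt_mult[symmetric] using c by (simp add: power2_eq_square)
    also have "\<dots> = 2 * pi" by (rule real_sqrt_unique) auto
    finally show ?thesis .
  qed
  define h where "h \<xi> = cnj (G \<xi>) * gauss c \<xi>" for \<xi>
  have [measurable]: "h \<in> borel_measurable borel" unfolding h_def[abs_def] by measurable
  have Gb: "cmod (G \<xi>) \<le> (LINT x|lborel. cmod (g x))" for \<xi>
    unfolding G_def by (rule fourier_L1_bound)
  have h_int: "integrable lborel h"
  proof (rule Bochner_Integration.integrable_bound)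
    show "integrable lborel (\<lambda>\<xi> :: real ^ 'n. complex_of_real (LINT x|lborel. cmod (g x)) * gauss c \<xi>)"
      using gauss_integrable[OF c] by (rule integrable_mult_right)
    show "AE \<xi> in lborel. norm (h \<xi>) \<le> norm (complex_of_real (LINT x|lborel. cmod (g x)) * gauss c \<xi>)"
      unfolding h_def by (auto simp: norm_mult intro!: mult_right_mono AE_I2 Gb)
  qed measurable
  have h_hat: "fourier_L1 h = correlation (\<lambda>y. cnj (g y)) K"
  proof
    fix x
    let ?F = "\<lambda>y \<xi>. cnj (g y) * exp (\<i> * complex_of_real (\<xi> \<bullet> y)) * gauss c \<xi> * wave x \<xi>"
    have "cnj (G \<xi>) = (LINT y|lborel. cnj (g y * wave \<xi> y))" for \<xi>
      unfolding G_def fourier_L1_def by (rule Bochner_Integration.integral_cnj[symmetric])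
    then have cnjG: "cnj (G \<xi>) = (LINT y|lborel. cnj (g y) * exp (\<i> * complex_of_real (\<xi> \<bullet> y)))" for \<xi>
      by (simp add: exp_cnj)
    have "fourier_L1 h x = (LINT \<xi>|lborel. LINT y|lborel. ?F y \<xi>)"
      unfolding fourier_L1_def h_def cnjG by simp
    also have "\<dots> = (LINT y|lborel. LINT \<xi>|lborel. ?F y \<xi>)"
    proof (rule Fubini_lborel[symmetric])
      have "(\<integral>\<^sup>+y. \<integral>\<^sup>+\<xi>. ennreal (cmod (?F y \<xi>)) \<partial>lborel \<partial>lborel)
         = (\<integral>\<^sup>+y. ennreal (cmod (g y)) * (\<integral>\<^sup>+\<xi>. ennreal (cmod (gauss c (\<xi> :: real ^ 'n))) \<partial>lborel) \<partial>lborel)"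
        by (simp add: norm_mult ennreal_mult nn_integral_cmult)
      also have "\<dots> < \<infinity>"
        using g c by (simp add: nn_integral_multc integrable_iff_bounded ennreal_mult_less_top nn_integral_gauss)
      finally show "(\<integral>\<^sup>+y. \<integral>\<^sup>+\<xi>. ennreal (cmod (?F y \<xi>)) \<partial>lborel \<partial>lborel) < \<infinity>" .
    qed measurable
    also have "\<dots> = (LINT y|lborel. cnj (g y) * K (x - y))"
    proof (rule Bochner_Integration.integral_cong[OF refl])
      fix y
      have "(LINT \<xi>|lborel. ?F y \<xi>) = (LINT \<xi>|lborel. cnj (g y) * (gauss c \<xi> * wave (x - y) \<xi>))"
        by (intro Bochner_Integration.integral_cong refl)
           (simp add: inner_diff_left inner_commute algebra_simps flip: exp_add)
      then show "(LINT \<xi>|lborel. ?F y \<xi>) = cnj (g y) * K (x - y)"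
        unfolding K_def fourier_L1_def by simp
    qed
    also have "\<dots> = correlation (\<lambda>y. cnj (g y)) K x"
      unfolding correlation_def using K_even by (metis minus_diff_eq)
    finally show "fourier_L1 h x = correlation (\<lambda>y. cnj (g y)) K x" .
  qed
  have h_sq: "sqnorm (fourier_L1 h) \<le> (ennreal ((2 * pi) ^ CARD('n)))\<^sup>2 * sqnorm g"
    using sqnorm_correlation_le[of "\<lambda>y. cnj (g y)" K] unfolding h_hat K1[symmetric]
    by (simp add: sqnorm_def)
  define A where "A = (\<integral>\<^sup>+\<xi>. ennreal ((cmod (G \<xi>))\<^sup>2 * exp (- c * (norm \<xi>)\<^sup>2)) \<partial>lborel)"
  define B where "B = (\<integral>\<^sup>+x. ennreal (cmod (g x)) * ennreal (cmod (fourier_L1 h x)) \<partial>lborel)"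
  have Gh: "G \<xi> * h \<xi> = complex_of_real ((cmod (G \<xi>))\<^sup>2 * exp (- c * (norm \<xi>)\<^sup>2))" for \<xi>
    unfolding h_def gauss_def by (simp add: complex_norm_square mult.assoc del: of_real_power)
  have Gh_int: "integrable lborel (\<lambda>\<xi>. G \<xi> * h \<xi>)"
  proof (rule Bochner_Integration.integrable_bound)
    show "integrable lborel (\<lambda>\<xi>. complex_of_real (LINT x|lborel. cmod (g x)) * h \<xi>)"
      using h_int by (rule integrable_mult_right)
    show "AE \<xi> in lborel. norm (G \<xi> * h \<xi>) \<le> norm (complex_of_real (LINT x|lborel. cmod (g x)) * h \<xi>)"
      by (auto simp: norm_mult intro!: mult_right_mono AE_I2 Gb)
  qed measurable
  have "A = ennreal (cmod (LINT \<xi>|lborel. G \<xi> * h \<xi>))"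
  proof -
    have r: "integrable lborel (\<lambda>\<xi>. (cmod (G \<xi>))\<^sup>2 * exp (- c * (norm \<xi>)\<^sup>2))"
      using Gh_int unfolding Gh by (simp only: complex_of_real_integrable_eq)
    have "A = ennreal (LINT \<xi>|lborel. (cmod (G \<xi>))\<^sup>2 * exp (- c * (norm \<xi>)\<^sup>2))"
      unfolding A_def using r by (subst nn_integral_eq_integral) auto
    also have "(LINT \<xi>|lborel. (cmod (G \<xi>))\<^sup>2 * exp (- c * (norm \<xi>)\<^sup>2)) = cmod (LINT \<xi>|lborel. G \<xi> * h \<xi>)"
      unfolding Gh integral_complex_of_real by (simp only: norm_of_real) (simp add: integral_nonneg_AE)
    finally show ?thesis .
  qed
  also have "(LINT \<xi>|lborel. G \<xi> * h \<xi>) = (LINT x|lborel. g x * fourier_L1 h x)"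
    unfolding G_def by (rule fourier_L1_multiplication_formula[OF g h_int])
  also have "ennreal (cmod \<dots>) \<le> B"
    unfolding B_def using cmod_integral_le_nn_integral[of lborel "\<lambda>x. g x * fourier_L1 h x"]
    by (simp add: norm_mult ennreal_mult)
  finally have AB: "A \<le> B" .
  have "B\<^sup>2 \<le> sqnorm g * sqnorm (fourier_L1 h)"
    unfolding B_def sqnorm_def
    using Cauchy_Schwarz_nn_integral[of "\<lambda>x. ennreal (cmod (g x))" lborel "\<lambda>x. ennreal (cmod (fourier_L1 h x))"]
    by (simp add: ennreal_power)
  also have "\<dots> \<le> sqnorm g * ((ennreal ((2 * pi) ^ CARD('n)))\<^sup>2 * sqnorm g)"
    by (intro mult_left_mono h_sq) simp
  finally have "B\<^sup>2 \<le> (ennreal ((2 * pi) ^ CARD('n)) * sqnorm g)\<^sup>2"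
    by (simp add: power2_eq_square ac_simps)
  then have "B \<le> ennreal ((2 * pi) ^ CARD('n)) * sqnorm g"
    by (cases B; cases "ennreal ((2 * pi) ^ CARD('n)) * sqnorm g")
       (auto simp: ennreal_power top_unique intro: power2_le_imp_le)
  then show ?thesis
    using AB unfolding A_def G_def by simp
qed

text \<open>The inequality half of Plancherel's theorem: Fatou's lemma removes the Gaussian weight.\<close>

lemma sqnorm_fourier_L1_le:
  fixes g :: "real ^ 'n::finite \<Rightarrow> complex"
  assumes g: "integrable lborel g"
  shows "sqnorm (fourier_L1 g) \<le> ennreal ((2 * pi) ^ CARD('n)) * sqnorm g"
  unfolding sqnorm_def[of "fourier_L1 g"]
proof (rule nn_integral_limit_le)
  have [measurable]: "g \<in> borel_measurable borel" using g by auto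
  fix \<xi> :: "real ^ 'n"
  have "(\<lambda>k. (cmod (fourier_L1 g \<xi>))\<^sup>2 * exp (- inverse (real (Suc k)) * (norm \<xi>)\<^sup>2)) \<longlonglongrightarrow> (cmod (fourier_L1 g \<xi>))\<^sup>2 * exp (- 0 * (norm \<xi>)\<^sup>2)"
    by (intro tendsto_intros LIMSEQ_inverse_real_of_nat)
  then show "(\<lambda>k. ennreal ((cmod (fourier_L1 g \<xi>))\<^sup>2 * exp (- inverse (real (Suc k)) * (norm \<xi>)\<^sup>2))) \<longlonglongrightarrow> ennreal ((cmod (fourier_L1 g \<xi>))\<^sup>2)"
    by (simp del: of_nat_Suc)
next
  have [measurable]: "g \<in> borel_measurable borel" using g by auto
  fix k
  show "(\<lambda>\<xi>. ennreal ((cmod (fourier_L1 g \<xi>))\<^sup>2 * exp (- inverse (real (Suc k)) * (norm \<xi>)\<^sup>2))) \<in> borel_measurable lborel"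
    by measurable
  show "(\<integral>\<^sup>+\<xi>. ennreal ((cmod (fourier_L1 g \<xi>))\<^sup>2 * exp (- inverse (real (Suc k)) * (norm \<xi>)\<^sup>2)) \<partial>lborel) \<le> ennreal ((2 * pi) ^ CARD('n)) * sqnorm g"
    by (rule sqnorm_fourier_gauss_weight[OF g]) simp
qed

section \<open>Fourier pairs\<close>

text \<open>
  In contrast to \<^const>\<open>has_fourier_L2\<close> the approximating integrable functions are arbitrary. This makes the
  relation stable under correlation, which does not map truncations to truncations.
\<close>

definition fourier_pair :: "(real ^ 'n::finite \<Rightarrow> complex) \<Rightarrow> (real ^ 'n \<Rightarrow> complex) \<Rightarrow> bool" where
  "fourier_pair f g \<longleftrightarrow> f \<in> L2_space \<and> g \<in> borel_measurable borel \<and>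
     (\<exists>F. (\<forall>k::nat. integrable lborel (F k) \<and> F k \<in> L2_space) \<and>
        ((\<lambda>k. sqnorm (\<lambda>x. F k x - f x)) \<longlonglongrightarrow> 0) \<and>
        ((\<lambda>k. sqnorm (\<lambda>\<xi>. fourier_L1 (F k) \<xi> - g \<xi>)) \<longlonglongrightarrow> 0))"

lemma has_fourier_L2_imp_fourier_pair:
  assumes "has_fourier_L2 f g"
  shows "fourier_pair f g"
proof -
  have f: "f \<in> L2_space" and g: "g \<in> L2_space"
    and lim: "((\<lambda>R. sqnorm (\<lambda>\<xi>. fourier_L1 (\<lambda>x. indicator (ball 0 R) x * f x) \<xi> - g \<xi>)) \<longlongrightarrow> 0) at_top"
    using assms by (auto simp: has_fourier_L2_iff)
  note [measurable] = L2_space_measurable[OF f] L2_space_measurable[OF g]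
  let ?F = "\<lambda>k::nat. \<lambda>x. indicator (ball 0 (real k)) x * f x"
  have "(\<lambda>k. sqnorm (\<lambda>x. ?F k x - f x)) \<longlonglongrightarrow> (\<integral>\<^sup>+x. 0 \<partial>(lborel :: (real ^ 'a) measure))"
    unfolding sqnorm_def
  proof (rule nn_integral_dominated_convergence[where w = "\<lambda>x. ennreal ((cmod (f x))\<^sup>2)"])
    show "(\<integral>\<^sup>+x. ennreal ((cmod (f x))\<^sup>2) \<partial>lborel) < \<infinity>"
      using f by (simp add: L2_space_iff sqnorm_def)
    show "AE x in lborel. (\<lambda>k. ennreal ((cmod (?F k x - f x))\<^sup>2)) \<longlonglongrightarrow> 0"
    proof (intro AE_I2 tendsto_eventually)
      fix x :: "real ^ 'a"
      obtain k0 :: nat where "norm x < k0" using reals_Archimedean2 by blast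
      then show "\<forall>\<^sub>F k in sequentially. ennreal ((cmod (?F k x - f x))\<^sup>2) = 0"
        by (intro eventually_sequentiallyI[of k0]) (auto simp: indicator_def)
    qed
  qed (auto simp: indicator_def)
  moreover have "(\<lambda>k. sqnorm (\<lambda>\<xi>. fourier_L1 (?F k) \<xi> - g \<xi>)) \<longlonglongrightarrow> 0"
    using lim by (auto intro: filterlim_compose[OF _ filterlim_real_sequentially])
  moreover have "?F k \<in> L2_space" for k
    by (rule L2_space_bounded_mult[OF f, where B = 1]) (auto simp: indicator_def)
  ultimately show ?thesis
    unfolding fourier_pair_def using f L2_truncation_integrable[OF f] by (auto intro!: exI[of _ ?F])
qed

lemma fourier_pair_linear:
  assumes "fourier_pair f g" "fourier_pair f' g'"
  shows "fourier_pair (\<lambda>x. c * f x + d * f' x) (\<lambda>\<xi>. c * g \<xi> + d * g' \<xi>)"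
proof -
  obtain F F' where f: "f \<in> L2_space" "f' \<in> L2_space"
    and g: "g \<in> borel_measurable borel" "g' \<in> borel_measurable borel"
    and F: "\<And>k::nat. integrable lborel (F k)" "\<And>k. F k \<in> L2_space"
        "(\<lambda>k. sqnorm (\<lambda>x. F k x - f x)) \<longlonglongrightarrow> 0" "(\<lambda>k. sqnorm (\<lambda>\<xi>. fourier_L1 (F k) \<xi> - g \<xi>)) \<longlonglongrightarrow> 0"
    and F': "\<And>k::nat. integrable lborel (F' k)" "\<And>k. F' k \<in> L2_space"
        "(\<lambda>k. sqnorm (\<lambda>x. F' k x - f' x)) \<longlonglongrightarrow> 0" "(\<lambda>k. sqnorm (\<lambda>\<xi>. fourier_L1 (F' k) \<xi> - g' \<xi>)) \<longlonglongrightarrow> 0"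
    using assms unfolding fourier_pair_def by blast
  note [measurable] = f[THEN L2_space_measurable] g F(2)[THEN L2_space_measurable] F'(2)[THEN L2_space_measurable]
  let ?F = "\<lambda>k x. c * F k x + d * F' k x"
  have "(\<lambda>k. sqnorm (\<lambda>x. c * (F k x - f x) + d * (F' k x - f' x))) \<longlonglongrightarrow> 0"
    by (rule tendsto_sqnorm_linear[OF F(3) F'(3)]) measurable
  then have 1: "(\<lambda>k. sqnorm (\<lambda>x. ?F k x - (c * f x + d * f' x))) \<longlonglongrightarrow> 0"
    by (simp add: algebra_simps)
  have "(\<lambda>k. sqnorm (\<lambda>\<xi>. c * (fourier_L1 (F k) \<xi> - g \<xi>) + d * (fourier_L1 (F' k) \<xi> - g' \<xi>))) \<longlonglongrightarrow> 0"
    by (rule tendsto_sqnorm_linear[OF F(4) F'(4)]) measurable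
  then have 2: "(\<lambda>k. sqnorm (\<lambda>\<xi>. fourier_L1 (?F k) \<xi> - (c * g \<xi> + d * g' \<xi>))) \<longlonglongrightarrow> 0"
    by (simp add: algebra_simps fourier_L1_linear F F')
  have 3: "integrable lborel (?F k)" "?F k \<in> L2_space" for k
    using F F' by (auto intro!: L2_space_add L2_space_cmult)
  have 4: "(\<lambda>x. c * f x + d * f' x) \<in> L2_space" "(\<lambda>\<xi>. c * g \<xi> + d * g' \<xi>) \<in> borel_measurable borel"
    using f by (auto intro!: L2_space_add L2_space_cmult)
  show ?thesis
    unfolding fourier_pair_def
    by (intro conjI 4 exI[of _ ?F] allI 3 1 2)
qed

text \<open>The approximating functions tend to zero in the square norm, hence so do their transforms.\<close>

lemma fourier_pair_zero:
  fixes g :: "real ^ 'n::finite \<Rightarrow> complex"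
  assumes "fourier_pair (\<lambda>_. 0) g"
  shows "AE \<xi> in lborel. g \<xi> = 0"
proof -
  obtain F where g: "g \<in> borel_measurable borel"
    and F: "\<And>k::nat. integrable lborel (F k)" "\<And>k. F k \<in> L2_space"
        "(\<lambda>k. sqnorm (F k)) \<longlonglongrightarrow> 0" "(\<lambda>k. sqnorm (\<lambda>\<xi>. fourier_L1 (F k) \<xi> - g \<xi>)) \<longlonglongrightarrow> 0"
    using assms unfolding fourier_pair_def by auto
  note [measurable] = g F(2)[THEN L2_space_measurable]
  have "(\<lambda>k. sqnorm (\<lambda>\<xi>. fourier_L1 (F k) \<xi> - 0)) \<longlonglongrightarrow> 0"
    by (rule tendsto_sqnorm_dominated[OF F(3), where c = "ennreal ((2 * pi) ^ CARD('n))"])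
       (use sqnorm_fourier_L1_le[OF F(1)] in auto)
  then show ?thesis
    by (intro sqnorm_limit_unique[where F = sequentially and f = "\<lambda>k. fourier_L1 (F k)"] F(4)) auto
qed

lemma L2_product_integrable:
  assumes "f \<in> L2_space" "g \<in> L2_space"
  shows "integrable lborel (\<lambda>x. f x * g x)"
proof (rule Bochner_Integration.integrable_bound)
  show "integrable lborel (\<lambda>x. (cmod (f x))\<^sup>2 + (cmod (g x))\<^sup>2)"
    using assms by (auto simp: L2_space_def)
  show "AE x in lborel. norm (f x * g x) \<le> norm ((cmod (f x))\<^sup>2 + (cmod (g x))\<^sup>2)"
  proof (intro AE_I2)
    fix x
    have "0 \<le> (cmod (f x) - cmod (g x))\<^sup>2 + (cmod (f x))\<^sup>2 + (cmod (g x))\<^sup>2" by simp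
    then show "norm (f x * g x) \<le> norm ((cmod (f x))\<^sup>2 + (cmod (g x))\<^sup>2)"
      by (simp add: norm_mult power2_eq_square algebra_simps)
  qed
qed (use assms in measurable)

lemma L2_space_shift: "\<phi> \<in> L2_space \<Longrightarrow> (\<lambda>x. \<phi> (x - y)) \<in> L2_space"
  unfolding L2_space_iff sqnorm_def
  using nn_integral_lborel_shift(1)[of "\<lambda>x. ennreal ((cmod (\<phi> x))\<^sup>2)" y] by auto

lemma fourier_pair_correlation:
  assumes "fourier_pair f g" and \<phi>: "integrable lborel \<phi>" "\<phi> \<in> L2_space"
  shows "fourier_pair (correlation f \<phi>) (\<lambda>\<xi>. fourier_L1 \<phi> (- \<xi>) * g \<xi>)"
proof -
  obtain F where f: "f \<in> L2_space" and g: "g \<in> borel_measurable borel"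
    and F: "\<And>k::nat. integrable lborel (F k)" "\<And>k. F k \<in> L2_space"
        "(\<lambda>k. sqnorm (\<lambda>x. F k x - f x)) \<longlonglongrightarrow> 0" "(\<lambda>k. sqnorm (\<lambda>\<xi>. fourier_L1 (F k) \<xi> - g \<xi>)) \<longlonglongrightarrow> 0"
    using assms unfolding fourier_pair_def by auto
  note [measurable] = g f[THEN L2_space_measurable] F(2)[THEN L2_space_measurable] \<phi>(2)[THEN L2_space_measurable]
  let ?N = "(\<integral>\<^sup>+x. ennreal (cmod (\<phi> x)) \<partial>lborel)\<^sup>2"
  have N: "?N < top"
    using \<phi>(1) by (auto simp: integrable_iff_bounded power2_eq_square ennreal_mult_less_top)
  have L2: "correlation h \<phi> \<in> L2_space" if "h \<in> L2_space" for h
    using sqnorm_correlation_le[of h \<phi>] that N by (auto simp: L2_space_iff ennreal_mult_less_top le_less_trans)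
  have diff: "correlation (F k) \<phi> y - correlation f \<phi> y = correlation (\<lambda>x. F k x - f x) \<phi> y" for k y
    unfolding correlation_def left_diff_distrib
    by (rule Bochner_Integration.integral_diff[symmetric]; rule L2_product_integrable)
       (auto intro: f F L2_space_shift \<phi>)
  have 1: "(\<lambda>k. sqnorm (\<lambda>x. correlation (F k) \<phi> x - correlation f \<phi> x)) \<longlonglongrightarrow> 0"
    unfolding diff
    by (rule tendsto_sqnorm_dominated[OF F(3) N]) (intro always_eventually allI sqnorm_correlation_le; measurable)
  define M where "M = (LINT x|lborel. cmod (\<phi> x))"
  have 2: "(\<lambda>k. sqnorm (\<lambda>\<xi>. fourier_L1 \<phi> (- \<xi>) * (fourier_L1 (F k) \<xi> - g \<xi>))) \<longlonglongrightarrow> 0"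
  proof (rule tendsto_sqnorm_dominated[OF F(4)])
    show "\<forall>\<^sub>F k in sequentially. sqnorm (\<lambda>\<xi>. fourier_L1 \<phi> (- \<xi>) * (fourier_L1 (F k) \<xi> - g \<xi>))
       \<le> ennreal (M\<^sup>2) * sqnorm (\<lambda>\<xi>. fourier_L1 (F k) \<xi> - g \<xi>)"
      unfolding M_def by (intro always_eventually allI sqnorm_mult_bounded fourier_L1_bound) measurable
  qed simp
  have 2: "(\<lambda>k. sqnorm (\<lambda>\<xi>. fourier_L1 (correlation (F k) \<phi>) \<xi> - fourier_L1 \<phi> (- \<xi>) * g \<xi>)) \<longlonglongrightarrow> 0"
    using 2 by (simp add: fourier_L1_correlation[OF F(1) \<phi>(1)] algebra_simps)
  have 3: "(\<lambda>\<xi>. fourier_L1 \<phi> (- \<xi>) * g \<xi>) \<in> borel_measurable borel"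
    by measurable
  show ?thesis
    unfolding fourier_pair_def
    by (intro conjI L2 f 3 exI[of _ "\<lambda>k. correlation (F k) \<phi>"] allI correlation_integrable F \<phi> 1 2)
qed

section \<open>Test functions\<close>

lemma partial_deriv_eq:
  assumes "(f has_derivative f') (at x)"
  shows "partial_deriv i f x = f' (axis i 1)"
  unfolding partial_deriv_def using frechet_derivative_at[OF assms] by simp

lemma differentiable_has_derivative:
  "f differentiable (at x) \<Longrightarrow> (f has_derivative frechet_derivative f (at x)) (at x)"
  by (simp add: frechet_derivative_works)

text \<open>A coinduction principle: it suffices to exhibit a set of differentiable functions that is closed under partial derivatives.\<close>

lemma smooth_coinduct:
  assumes "f \<in> S" and "\<And>f x. f \<in> S \<Longrightarrow> f differentiable (at x)"
    and "\<And>f i. f \<in> S \<Longrightarrow> partial_deriv i f \<in> S"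
  shows "fold partial_deriv is f differentiable_on UNIV"
  using assms(1)
  by (induction "is" arbitrary: f) (auto simp: differentiable_on_def assms(2,3))

lemma test_functionsD:
  assumes "\<phi> \<in> test_functions"
  shows "fold partial_deriv is \<phi> differentiable_on UNIV" "bounded {x. \<phi> x \<noteq> 0}"
proof -
  have "compact (closure {x. \<phi> x \<noteq> 0})"
    using assms unfolding test_functions_def by blast
  then show "bounded {x. \<phi> x \<noteq> 0}"
    by (simp only: compact_closure)
  show "fold partial_deriv is \<phi> differentiable_on UNIV"
    using assms unfolding test_functions_def by blast
qed

lemma test_functions_differentiable: "\<phi> \<in> test_functions \<Longrightarrow> \<phi> differentiable (at x)"
  using test_functionsD(1)[of \<phi> "[]"] by (simp add: differentiable_on_def)

lemma test_functions_continuous: "\<phi> \<in> test_functions \<Longrightarrow> continuous_on UNIV \<phi>"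
  by (intro differentiable_imp_continuous_on)
     (auto simp: differentiable_on_def test_functions_differentiable)

lemma test_functions_measurable [measurable_dest]: "\<phi> \<in> test_functions \<Longrightarrow> \<phi> \<in> borel_measurable borel"
  by (intro borel_measurable_continuous_onI test_functions_continuous)

lemma test_functionsI:
  assumes "\<And>is. fold partial_deriv is \<phi> differentiable_on UNIV" and "bounded {x. \<phi> x \<noteq> 0}"
  shows "\<phi> \<in> test_functions"
  using assms(1) compact_closure[THEN iffD2, OF assms(2)] unfolding test_functions_def by blast

lemma test_functions_partial_deriv:
  assumes "\<phi> \<in> test_functions"
  shows "partial_deriv i \<phi> \<in> test_functions"
proof -
  have "{x. partial_deriv i \<phi> x \<noteq> 0} \<subseteq> closure {x. \<phi> x \<noteq> 0}"
  proof (rule ccontr)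
    assume "\<not> ?thesis"
    then obtain x where x: "partial_deriv i \<phi> x \<noteq> 0" "x \<notin> closure {x. \<phi> x \<noteq> 0}" by auto
    have "(\<phi> has_derivative (\<lambda>_. 0)) (at x)"
    proof (rule has_derivative_transform_within_open)
      show "open (- closure {x. \<phi> x \<noteq> 0})" by auto
      show "((\<lambda>_. 0) has_derivative (\<lambda>_. 0)) (at x)" by simp
      show "0 = \<phi> y" if "y \<in> - closure {x. \<phi> x \<noteq> 0}" for y
        using that closure_subset by (metis (mono_tags, lifting) ComplD mem_Collect_eq subsetD)
    qed (use x in auto)
    then show False using x partial_deriv_eq by metis
  qed
  with bounded_closure[OF test_functionsD(2)[OF assms]]
  have 2: "bounded {x. partial_deriv i \<phi> x \<noteq> 0}"
    by (rule bounded_subset)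
  have 1: "fold partial_deriv is (partial_deriv i \<phi>) differentiable_on UNIV" for "is"
    using test_functionsD(1)[OF assms, of "i # is"] by simp
  show ?thesis by (rule test_functionsI[OF 1 2])
qed

lemma partial_deriv_add:
  assumes "f differentiable (at x)" "g differentiable (at x)"
  shows "partial_deriv i (\<lambda>x. f x + g x) x = partial_deriv i f x + partial_deriv i g x"
  unfolding partial_deriv_def[of i f] partial_deriv_def[of i g]
  using assms[THEN differentiable_has_derivative]
  by (subst partial_deriv_eq[OF has_derivative_add]) auto

lemma test_functions_add:
  assumes "\<phi> \<in> test_functions" "\<psi> \<in> test_functions"
  shows "(\<lambda>x. \<phi> x + \<psi> x) \<in> test_functions"
proof -
  let ?S = "{(\<lambda>x. f x + g x) | f g. f \<in> test_functions \<and> g \<in> test_functions}"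
  have 1: "fold partial_deriv is (\<lambda>x. \<phi> x + \<psi> x) differentiable_on UNIV" for "is"
  proof (rule smooth_coinduct[where S = ?S])
    show "(\<lambda>x. \<phi> x + \<psi> x) \<in> ?S" using assms by blast
  next
    fix h x assume "h \<in> ?S"
    then obtain f g where h: "h = (\<lambda>x. f x + g x)" "f \<in> test_functions" "g \<in> test_functions" by blast
    show "h differentiable (at x)"
      unfolding h(1) by (intro differentiable_add test_functions_differentiable h)
  next
    fix h i assume "h \<in> ?S"
    then obtain f g where h: "h = (\<lambda>x. f x + g x)" "f \<in> test_functions" "g \<in> test_functions" by blast
    then have "partial_deriv i h = (\<lambda>x. partial_deriv i f x + partial_deriv i g x)"
      by (auto simp: partial_deriv_add test_functions_differentiable)
    then show "partial_deriv i h \<in> ?S"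
      using h test_functions_partial_deriv by blast
  qed
  have 2: "bounded {x. \<phi> x + \<psi> x \<noteq> 0}"
  proof -
    have "bounded ({x. \<phi> x \<noteq> 0} \<union> {x. \<psi> x \<noteq> 0})"
      using assms[THEN test_functionsD(2)] by simp
    moreover have "{x. \<phi> x + \<psi> x \<noteq> 0} \<subseteq> {x. \<phi> x \<noteq> 0} \<union> {x. \<psi> x \<noteq> 0}" by auto
    ultimately show ?thesis
      by (rule bounded_subset)
  qed
  show ?thesis by (rule test_functionsI[OF 1 2])
qed

lemma test_functions_zero: "(\<lambda>_ :: real ^ 'n::finite. 0) \<in> test_functions"
proof -
  have 1: "fold partial_deriv is (\<lambda>_. 0) differentiable_on UNIV" for "is" :: "'n list"
  proof (rule smooth_coinduct[where S = "{\<lambda>_. 0}"])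
    fix f :: "real ^ 'n \<Rightarrow> real" and i assume f: "f \<in> {\<lambda>_. 0}"
    show "partial_deriv i f \<in> {\<lambda>_. 0}"
      unfolding singletonD[OF f] by (simp add: fun_eq_iff partial_deriv_eq[OF has_derivative_const])
  qed simp_all
  have 2: "bounded {x :: real ^ 'n. (0 :: real) \<noteq> 0}"
    by simp
  show ?thesis by (rule test_functionsI[OF 1 2])
qed

lemma test_functions_sum:
  "finite A \<Longrightarrow> (\<And>i. i \<in> A \<Longrightarrow> f i \<in> test_functions) \<Longrightarrow> (\<lambda>x. \<Sum>i\<in>A. f i x) \<in> test_functions"
  by (induction A rule: finite_induct) (auto intro: test_functions_zero test_functions_add)

lemma test_functions_laplacian: "\<phi> \<in> test_functions \<Longrightarrow> laplacian \<phi> \<in> test_functions"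
  unfolding laplacian_def[abs_def] by (intro test_functions_sum test_functions_partial_deriv) auto

lemma partial_deriv_shift:
  assumes "\<phi> differentiable (at (x - y))"
  shows "partial_deriv i (\<lambda>x. \<phi> (x - y)) x = partial_deriv i \<phi> (x - y)"
proof -
  have "((\<lambda>x. x - y) has_derivative (\<lambda>h. h)) (at x)"
    by (auto intro!: derivative_eq_intros)
  from has_derivative_compose[OF this differentiable_has_derivative[OF assms]]
  show ?thesis unfolding partial_deriv_def[of i \<phi>] by (rule partial_deriv_eq)
qed

lemma test_functions_shift:
  assumes "\<phi> \<in> test_functions"
  shows "(\<lambda>x. \<phi> (x - y)) \<in> test_functions"
proof -
  let ?S = "{(\<lambda>x. f (x - y)) | f. f \<in> test_functions}"
  have 1: "fold partial_deriv is (\<lambda>x. \<phi> (x - y)) differentiable_on UNIV" for "is"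
  proof (rule smooth_coinduct[where S = ?S])
    show "(\<lambda>x. \<phi> (x - y)) \<in> ?S" using assms by blast
  next
    fix h i assume "h \<in> ?S"
    then obtain f where h: "h = (\<lambda>x. f (x - y))" "f \<in> test_functions" by blast
    then have "partial_deriv i h = (\<lambda>x. partial_deriv i f (x - y))"
      by (auto simp: partial_deriv_shift test_functions_differentiable)
    then show "partial_deriv i h \<in> ?S"
      using h test_functions_partial_deriv by blast
  next
    fix h x assume "h \<in> ?S"
    then obtain f where h: "h = (\<lambda>x. f (x - y))" "f \<in> test_functions" by blast
    show "h differentiable (at x)"
      unfolding h(1) using differentiable_chain_at[of "\<lambda>x. x - y" x f] test_functions_differentiable[OF h(2)]
      by (simp add: o_def)
  qed
  have 2: "bounded {x. \<phi> (x - y) \<noteq> 0}"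
  proof -
    have "bounded ((\<lambda>x. y + x) ` {x. \<phi> x \<noteq> 0})"
      using assms by (intro bounded_translation test_functionsD)
    moreover have "{x. \<phi> (x - y) \<noteq> 0} \<subseteq> (\<lambda>x. y + x) ` {x. \<phi> x \<noteq> 0}"
    proof
      fix x assume "x \<in> {x. \<phi> (x - y) \<noteq> 0}"
      then show "x \<in> (\<lambda>x. y + x) ` {x. \<phi> x \<noteq> 0}"
        by (intro image_eqI[of _ _ "x - y"]) auto
    qed
    ultimately show ?thesis
      by (rule bounded_subset)
  qed
  show ?thesis by (rule test_functionsI[OF 1 2])
qed

lemma laplacian_shift:
  assumes "\<phi> \<in> test_functions"
  shows "laplacian (\<lambda>x. \<phi> (x - y)) = (\<lambda>x. laplacian \<phi> (x - y))"
proof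
  fix x
  have "partial_deriv i (\<lambda>x. \<phi> (x - y)) = (\<lambda>x. partial_deriv i \<phi> (x - y))" for i
    using assms by (auto simp: partial_deriv_shift test_functions_differentiable)
  then show "laplacian (\<lambda>x. \<phi> (x - y)) x = laplacian \<phi> (x - y)"
    unfolding laplacian_def
    using assms by (simp add: partial_deriv_shift test_functions_differentiable test_functions_partial_deriv)
qed

lemma test_functions_bounded:
  assumes "\<phi> \<in> test_functions"
  obtains B R where "B \<ge> 0" "R \<ge> 0" "\<And>x. \<bar>\<phi> x\<bar> \<le> B" "\<And>x. \<phi> x \<noteq> 0 \<Longrightarrow> norm x \<le> R"
proof -
  have K: "compact (closure {x. \<phi> x \<noteq> 0})"
    using test_functionsD(2)[OF assms] by (simp only: compact_closure)
  have "bounded (\<phi> ` closure {x. \<phi> x \<noteq> 0})"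
    using K test_functions_continuous[OF assms]
    by (intro compact_imp_bounded compact_continuous_image) (auto intro: continuous_on_subset)
  then obtain B where B: "\<And>x. x \<in> closure {x. \<phi> x \<noteq> 0} \<Longrightarrow> \<bar>\<phi> x\<bar> \<le> B"
    unfolding bounded_iff by auto
  obtain R where R: "\<And>x. x \<in> closure {x. \<phi> x \<noteq> 0} \<Longrightarrow> norm x \<le> R"
    using compact_imp_bounded[OF K] unfolding bounded_iff by blast
  have sub: "\<phi> x \<noteq> 0 \<Longrightarrow> x \<in> closure {x. \<phi> x \<noteq> 0}" for x
    using that by (intro closure_subset[THEN subsetD]) simp
  show ?thesis
  proof (rule that[of "\<bar>B\<bar>" "\<bar>R\<bar>"])
    fix x
    show "\<bar>\<phi> x\<bar> \<le> \<bar>B\<bar>"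
      using B[OF sub, of x] by (cases "\<phi> x = 0") auto
    show "\<phi> x \<noteq> 0 \<Longrightarrow> norm x \<le> \<bar>R\<bar>"
      using R[OF sub, of x] by auto
  qed auto
qed

lemma integrable_bounded_support:
  fixes f :: "real ^ 'n::finite \<Rightarrow> complex"
  assumes [measurable]: "f \<in> borel_measurable borel" and B: "\<And>x. cmod (f x) \<le> B" and R: "\<And>x. f x \<noteq> 0 \<Longrightarrow> norm x \<le> R"
  shows "integrable lborel f"
proof (rule Bochner_Integration.integrable_bound)
  show "integrable lborel (\<lambda>x :: real ^ 'n. B * indicator (cball 0 R) x :: real)"
    using emeasure_lborel_cball_finite[of 0 R] by (intro integrable_mult_right integrable_real_indicator) auto
  show "AE x in lborel. norm (f x) \<le> norm (B * indicator (cball 0 R) x :: real)"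
  proof (intro AE_I2)
    fix x
    show "norm (f x) \<le> norm (B * indicator (cball 0 R) x :: real)"
      using B[of x] R[of x] by (cases "f x = 0") (auto simp: indicator_def)
  qed
qed auto

lemma test_functions_integrable:
  assumes "\<phi> \<in> test_functions"
  shows "integrable lborel (\<lambda>x. complex_of_real (\<phi> x))" "(\<lambda>x. complex_of_real (\<phi> x)) \<in> L2_space"
proof -
  obtain B R where B: "B \<ge> 0" "\<And>x. \<bar>\<phi> x\<bar> \<le> B" and R: "\<And>x. \<phi> x \<noteq> 0 \<Longrightarrow> norm x \<le> R"
    using test_functions_bounded[OF assms] by metis
  note [measurable] = test_functions_measurable[OF assms]
  show "integrable lborel (\<lambda>x. complex_of_real (\<phi> x))"
    by (rule integrable_bounded_support[of _ B R]) (use B R in auto)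
  have "integrable lborel (\<lambda>x. complex_of_real ((\<phi> x)\<^sup>2))"
  proof (rule integrable_bounded_support[of _ "B\<^sup>2" R])
    show "cmod (complex_of_real ((\<phi> x)\<^sup>2)) \<le> B\<^sup>2" for x
      using power_mono[OF B(2)[of x], of 2] by (simp only: norm_of_real power_abs)
    show "norm x \<le> R" if "complex_of_real ((\<phi> x)\<^sup>2) \<noteq> 0" for x
      using that by (intro R) auto
  qed measurable
  then show "(\<lambda>x. complex_of_real (\<phi> x)) \<in> L2_space"
    unfolding complex_of_real_integrable_eq by (auto simp: L2_space_def)
qed

text \<open>The difference quotients of \<open>\<phi>\<close> in the direction of \<open>axis i 1\<close> converge boundedly and with
  supports in a fixed ball, and a translation multiplies the transform by an exponential.\<close>

lemma fourier_L1_partial_deriv: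
  fixes \<phi> :: "real ^ 'n::finite \<Rightarrow> real"
  assumes \<phi>: "\<phi> \<in> test_functions"
  shows "fourier_L1 (\<lambda>x. complex_of_real (partial_deriv i \<phi> x)) \<xi>
    = \<i> * complex_of_real (\<xi> $ i) * fourier_L1 (\<lambda>x. complex_of_real (\<phi> x)) \<xi>"
proof -
  let ?c = "\<lambda>x. complex_of_real (\<phi> x)" and ?e = "axis i 1 :: real ^ 'n"
  let ?E = "\<lambda>x. wave \<xi> x"
  define h where "h k = inverse (real (Suc k))" for k
  have h: "h k > 0" "h k \<le> 1" for k by (auto simp: h_def field_simps)
  have h0: "h \<longlonglongrightarrow> 0" unfolding h_def by (rule LIMSEQ_inverse_real_of_nat)
  have hat0: "filterlim h (at 0) sequentially"
    using h0 h by (auto simp: filterlim_at intro!: always_eventually) (metis less_irrefl)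
  note [measurable] = test_functions_measurable[OF \<phi>]
    test_functions_measurable[OF test_functions_partial_deriv[OF \<phi>, of i]]
  obtain B where B: "B \<ge> 0" "\<And>x. \<bar>partial_deriv i \<phi> x\<bar> \<le> B"
    using test_functions_bounded[OF test_functions_partial_deriv[OF \<phi>, of i]] by metis
  obtain R where R: "\<And>x. \<phi> x \<noteq> 0 \<Longrightarrow> norm x \<le> R"
    using test_functions_bounded[OF \<phi>] by metis
  define D where "D k x = (\<phi> (x + h k *\<^sub>R ?e) - \<phi> x) / h k" for k x
  have [measurable]: "D k \<in> borel_measurable borel" for k unfolding D_def[abs_def] by measurable
  have line: "((\<lambda>s. \<phi> (x + s *\<^sub>R ?e)) has_real_derivative partial_deriv i \<phi> (x + s *\<^sub>R ?e)) (at s)" for x s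
  proof -
    have "((\<lambda>s. x + s *\<^sub>R ?e) has_derivative (\<lambda>r. r *\<^sub>R ?e)) (at s)"
      by (auto intro!: derivative_eq_intros)
    from has_derivative_compose[OF this differentiable_has_derivative[OF test_functions_differentiable[OF \<phi>]]]
    have "((\<lambda>s. \<phi> (x + s *\<^sub>R ?e)) has_derivative
        (\<lambda>r. frechet_derivative \<phi> (at (x + s *\<^sub>R ?e)) (r *\<^sub>R ?e))) (at s)" .
    moreover have "linear (frechet_derivative \<phi> (at (x + s *\<^sub>R ?e)))"
      by (intro linear_frechet_derivative test_functions_differentiable \<phi>)
    then have "(\<lambda>r. frechet_derivative \<phi> (at (x + s *\<^sub>R ?e)) (r *\<^sub>R ?e)) = (*) (partial_deriv i \<phi> (x + s *\<^sub>R ?e))"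
      by (auto simp: partial_deriv_def linear_cmul mult.commute)
    ultimately show ?thesis
      unfolding has_field_derivative_def by simp
  qed
  have D_bound: "\<bar>D k x\<bar> \<le> B * indicator (cball 0 (R + 1)) x" for k x
  proof (cases "norm x \<le> R + 1")
    case True
    obtain z where "\<phi> (x + h k *\<^sub>R ?e) - \<phi> (x + 0 *\<^sub>R ?e) = (h k - 0) * partial_deriv i \<phi> (x + z *\<^sub>R ?e)"
      using MVT2[of 0 "h k" "\<lambda>s. \<phi> (x + s *\<^sub>R ?e)" "\<lambda>s. partial_deriv i \<phi> (x + s *\<^sub>R ?e)"] h line by blast
    then have "D k x = partial_deriv i \<phi> (x + z *\<^sub>R ?e)"
      unfolding D_def using h[of k] by (simp add: field_simps)
    then show ?thesis using B True by (simp add: indicator_def)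
  next
    case False
    have "norm (h k *\<^sub>R ?e) \<le> 1" using h[of k] by simp
    then have "\<not> norm (x + h k *\<^sub>R ?e) \<le> R" "\<not> norm x \<le> R"
      using False norm_diff_ineq[of x "h k *\<^sub>R ?e"] by linarith+
    then have "\<phi> (x + h k *\<^sub>R ?e) = 0" "\<phi> x = 0" using R by blast+
    then show ?thesis using False by (simp add: D_def)
  qed
  have D_lim: "(\<lambda>k. D k x) \<longlonglongrightarrow> partial_deriv i \<phi> x" for x
  proof -
    have "((\<lambda>r. (\<phi> (x + (0 + r) *\<^sub>R ?e) - \<phi> (x + 0 *\<^sub>R ?e)) / r) \<longlongrightarrow> partial_deriv i \<phi> (x + 0 *\<^sub>R ?e)) (at 0)"
      using line[of x 0] unfolding DERIV_def .
    from filterlim_compose[OF this hat0] show ?thesis by (simp add: D_def)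
  qed
  have lim1: "(\<lambda>k. fourier_L1 (\<lambda>x. complex_of_real (D k x)) \<xi>) \<longlonglongrightarrow> fourier_L1 (\<lambda>x. complex_of_real (partial_deriv i \<phi> x)) \<xi>"
    unfolding fourier_L1_def
  proof (rule integral_dominated_convergence)
    show "integrable lborel (\<lambda>x. B * indicator (cball 0 (R + 1)) x)"
      using emeasure_lborel_cball_finite[of 0 "R + 1"] by (intro integrable_mult_right integrable_real_indicator) auto
    show "AE x in lborel. (\<lambda>k. complex_of_real (D k x) * ?E x) \<longlonglongrightarrow> complex_of_real (partial_deriv i \<phi> x) * ?E x"
      by (intro AE_I2 tendsto_intros D_lim)
    show "AE x in lborel. norm (complex_of_real (D k x) * ?E x) \<le> B * indicator (cball 0 (R + 1)) x" for k
      using D_bound[of k] by (simp add: norm_mult)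
  qed measurable
  have quotient: "fourier_L1 (\<lambda>x. complex_of_real (D k x)) \<xi>
     = (exp (\<i> * complex_of_real (\<xi> $ i * h k)) - 1) / complex_of_real (h k) * fourier_L1 ?c \<xi>" for k
  proof -
    have shift: "fourier_L1 (\<lambda>x. ?c (x + h k *\<^sub>R ?e)) \<xi> = exp (\<i> * complex_of_real (\<xi> $ i * h k)) * fourier_L1 ?c \<xi>"
    proof -
      have "fourier_L1 (\<lambda>x. ?c (x + h k *\<^sub>R ?e)) \<xi>
        = (LINT x|lborel. exp (\<i> * complex_of_real (\<xi> $ i * h k)) * (?c (x + h k *\<^sub>R ?e) * ?E (x + h k *\<^sub>R ?e)))"
        unfolding fourier_L1_def
        by (intro Bochner_Integration.integral_cong refl)
           (simp add: inner_add_right inner_axis algebra_simps flip: exp_add)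
      also have "\<dots> = exp (\<i> * complex_of_real (\<xi> $ i * h k)) * (LINT x|lborel. ?c (x + h k *\<^sub>R ?e) * ?E (x + h k *\<^sub>R ?e))"
        by simp
      also have "(LINT x|lborel. ?c (x + h k *\<^sub>R ?e) * ?E (x + h k *\<^sub>R ?e)) = fourier_L1 ?c \<xi>"
        unfolding fourier_L1_def by (rule integral_lborel_shift[of "\<lambda>x. ?c x * ?E x"]) measurable
      finally show ?thesis .
    qed
    have int: "integrable lborel (\<lambda>x. ?c (x + h k *\<^sub>R ?e))"
      using test_functions_integrable(1)[OF test_functions_shift[OF \<phi>, of "- (h k *\<^sub>R ?e)"]] by simp
    have "(\<lambda>x. complex_of_real (D k x)) = (\<lambda>x. (1 / complex_of_real (h k)) * ?c (x + h k *\<^sub>R ?e) + (- 1 / complex_of_real (h k)) * ?c x)"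
      by (auto simp: D_def diff_divide_distrib)
    then have "fourier_L1 (\<lambda>x. complex_of_real (D k x)) \<xi>
       = 1 / complex_of_real (h k) * (exp (\<i> * complex_of_real (\<xi> $ i * h k)) * fourier_L1 ?c \<xi>)
         + (- 1 / complex_of_real (h k)) * fourier_L1 ?c \<xi>"
      using fourier_L1_linear[OF int test_functions_integrable(1)[OF \<phi>], of "1 / complex_of_real (h k)" "- 1 / complex_of_real (h k)" \<xi>]
      by (simp only: shift)
    then show ?thesis by (simp add: diff_divide_distrib left_diff_distrib)
  qed
  have lim2: "(\<lambda>k. (exp (\<i> * complex_of_real (\<xi> $ i * h k)) - 1) / complex_of_real (h k)) \<longlonglongrightarrow> \<i> * complex_of_real (\<xi> $ i)"
  proof -
    have "((\<lambda>z. exp (\<i> * complex_of_real (\<xi> $ i) * z)) has_field_derivative \<i> * complex_of_real (\<xi> $ i)) (at 0)"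
      by (auto intro!: derivative_eq_intros)
    then have "((\<lambda>z. (exp (\<i> * complex_of_real (\<xi> $ i) * (0 + z)) - exp (\<i> * complex_of_real (\<xi> $ i) * 0)) / z) \<longlongrightarrow> \<i> * complex_of_real (\<xi> $ i)) (at 0)"
      unfolding DERIV_def .
    moreover have "filterlim (\<lambda>k. complex_of_real (h k)) (at 0) sequentially"
      using h0 h by (auto simp: filterlim_at intro!: always_eventually tendsto_eq_intros) (metis less_irrefl)
    ultimately have "(\<lambda>k. (exp (\<i> * complex_of_real (\<xi> $ i) * (0 + complex_of_real (h k))) - exp (\<i> * complex_of_real (\<xi> $ i) * 0)) / complex_of_real (h k)) \<longlonglongrightarrow> \<i> * complex_of_real (\<xi> $ i)"
      by (rule filterlim_compose)
    then show ?thesis by (simp add: mult.assoc)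
  qed
  have "(\<lambda>k. fourier_L1 (\<lambda>x. complex_of_real (D k x)) \<xi>) \<longlonglongrightarrow> \<i> * complex_of_real (\<xi> $ i) * fourier_L1 ?c \<xi>"
    unfolding quotient by (intro tendsto_mult lim2 tendsto_const)
  with lim1 show ?thesis
    using LIMSEQ_unique by blast
qed

lemma fourier_L1_laplacian:
  assumes \<phi>: "\<phi> \<in> test_functions"
  shows "fourier_L1 (\<lambda>x. complex_of_real (laplacian \<phi> x)) \<xi>
    = - complex_of_real ((norm \<xi>)\<^sup>2) * fourier_L1 (\<lambda>x. complex_of_real (\<phi> x)) \<xi>"
proof -
  have "fourier_L1 (\<lambda>x. complex_of_real (laplacian \<phi> x)) \<xi>
     = (\<Sum>i\<in>UNIV. fourier_L1 (\<lambda>x. complex_of_real (partial_deriv i (partial_deriv i \<phi>) x)) \<xi>)"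
    unfolding laplacian_def fourier_L1_def of_real_sum sum_distrib_right
    by (intro Bochner_Integration.integral_sum fourier_L1_integrable test_functions_integrable test_functions_partial_deriv \<phi>)
  also have "\<dots> = (\<Sum>i\<in>UNIV. - complex_of_real ((\<xi> $ i)\<^sup>2) * fourier_L1 (\<lambda>x. complex_of_real (\<phi> x)) \<xi>)"
    using \<phi> by (intro sum.cong refl)
      (simp add: fourier_L1_partial_deriv test_functions_partial_deriv power2_eq_square algebra_simps)
  also have "\<dots> = - complex_of_real (\<Sum>i\<in>UNIV. (\<xi> $ i)\<^sup>2) * fourier_L1 (\<lambda>x. complex_of_real (\<phi> x)) \<xi>"
    by (simp add: sum_distrib_right sum_negf)
  also have "(\<Sum>i\<in>UNIV. (\<xi> $ i)\<^sup>2) = (norm \<xi>)\<^sup>2"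
    unfolding power2_norm_eq_inner by (simp add: inner_vec_def power2_eq_square)
  finally show ?thesis .
qed

section \<open>Bump functions with small support\<close>

text \<open>
  All these functions vanish to infinite order at \<open>0\<close>, and their derivatives are linear combinations of functions of the same kind.
\<close>

definition flat_exp :: "nat \<Rightarrow> real \<Rightarrow> real" where
  "flat_exp j s = (if s > 0 then exp (- 1 / s) / s ^ j else 0)"

text \<open>A quadratic bound is enough for the derivative at \<open>0\<close> to exist and to vanish.\<close>

lemma flat_exp_quadratic:
  obtains C where "\<And>s. \<bar>flat_exp j s\<bar> \<le> C * s\<^sup>2"
proof
  fix s :: real
  show "\<bar>flat_exp j s\<bar> \<le> real (j + 2) ^ (j + 2) * s\<^sup>2"
  proof (cases "s > 0")
    case True
    have "(1 / s / real (j + 2)) ^ (j + 2) \<le> (1 + (1 / s) / real (j + 2)) ^ (j + 2)"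
      using True by (intro power_mono) auto
    also have "\<dots> \<le> exp (1 / s)"
      using True by (intro exp_ge_one_plus_x_over_n_power_n) (auto intro: order_trans[of _ 0])
    finally have "(1 / s / real (j + 2)) ^ (j + 2) \<le> exp (1 / s)" .
    moreover define n where "n = real (j + 2)"
    moreover have "n > 0" by (simp add: n_def)
    ultimately have "1 \<le> exp (1 / s) * (s ^ (j + 2) * n ^ (j + 2))"
      using True by (simp add: power_divide divide_le_eq power_mult_distrib mult_ac del: power_Suc of_nat_add add_2_eq_Suc')
    then have "exp (- (1 / s)) \<le> s ^ (j + 2) * n ^ (j + 2)"
      by (simp add: exp_minus inverse_le_iff_le field_simps del: power_Suc add_2_eq_Suc')
    then have "exp (- (1 / s)) / s ^ j \<le> n ^ (j + 2) * s\<^sup>2"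
      using True by (simp add: power_add divide_le_eq mult_ac del: power_Suc add_2_eq_Suc')
    then show ?thesis using True by (simp add: flat_exp_def n_def)
  qed (simp add: flat_exp_def)
qed

lemma flat_exp_derivative:
  "(flat_exp j has_real_derivative flat_exp (j + 2) s - real j * flat_exp (j + 1) s) (at s)"
proof -
  consider "s > 0" | "s < 0" | "s = 0" by linarith
  then show ?thesis
  proof cases
    case 1
    have "((\<lambda>s. exp (- 1 / s) / s ^ j) has_real_derivative flat_exp (j + 2) s - real j * flat_exp (j + 1) s) (at s)"
    proof (cases j)
      case 0
      then show ?thesis using 1
        by (auto intro!: derivative_eq_intros simp: flat_exp_def power2_eq_square field_simps)
    next
      case (Suc j')
      have "((\<lambda>s. exp (- 1 / s) / s ^ j) has_real_derivative
         (exp (- 1 / s) * (1 / s\<^sup>2) * s ^ j - exp (- 1 / s) * (real j * s ^ (j - 1))) / (s ^ j * s ^ j)) (at s)"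
        using 1 by (auto intro!: derivative_eq_intros simp: power2_eq_square field_simps)
      also have "(exp (- 1 / s) * (1 / s\<^sup>2) * s ^ j - exp (- 1 / s) * (real j * s ^ (j - 1))) / (s ^ j * s ^ j)
         = flat_exp (j + 2) s - real j * flat_exp (j + 1) s"
        using 1 Suc by (simp add: flat_exp_def power2_eq_square field_simps)
      finally show ?thesis .
    qed
    moreover have "\<forall>\<^sub>F x in nhds s. flat_exp j x = exp (- 1 / x) / x ^ j"
      by (rule eventually_mono[OF eventually_nhds_in_open[of "{0<..}" s]]) (use 1 in \<open>auto simp: flat_exp_def\<close>)
    ultimately show ?thesis
      by (subst DERIV_cong_ev[OF refl _ refl]) auto
  next
    case 2
    have "\<forall>\<^sub>F x in nhds s. flat_exp j x = 0"
      by (rule eventually_mono[OF eventually_nhds_in_open[of "{..<0}" s]]) (use 2 in \<open>auto simp: flat_exp_def\<close>)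
    then show ?thesis
      using 2 by (subst DERIV_cong_ev[OF refl _ refl, of _ "\<lambda>_. 0"]) (auto simp: flat_exp_def)
  next
    case 3
    obtain C where C: "\<And>s. \<bar>flat_exp j s\<bar> \<le> C * s\<^sup>2" using flat_exp_quadratic by blast
    have "((\<lambda>r. flat_exp j r / r) \<longlongrightarrow> 0) (at 0)"
    proof (rule Lim_null_comparison)
      show "\<forall>\<^sub>F r in at 0. norm (flat_exp j r / r) \<le> C * \<bar>r\<bar>"
      proof (intro eventually_at_filter[THEN iffD2] always_eventually allI impI)
        fix r :: real assume "r \<noteq> 0"
        then show "norm (flat_exp j r / r) \<le> C * \<bar>r\<bar>"
          using C[of r] by (simp add: power2_eq_square divide_le_eq mult.assoc)
      qed
      show "((\<lambda>r. C * \<bar>r\<bar>) \<longlongrightarrow> 0) (at 0)"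
        by (auto intro!: tendsto_eq_intros)
    qed
    then show ?thesis using 3 by (simp add: DERIV_def flat_exp_def)
  qed
qed

text \<open>
  The algebra generated by the coordinates and the functions \<open>flat_exp j\<close> of \<open>1 - m \<bar>x\<bar>\<^sup>2\<close>. By the chain and the
  product rule it is closed under partial derivatives, whence the bump functions are smooth.
\<close>

inductive_set flat_exp_algebra :: "real \<Rightarrow> (real ^ 'n::finite \<Rightarrow> real) set" for m :: real where
  const: "(\<lambda>_. c) \<in> flat_exp_algebra m"
| coordinate: "(\<lambda>x. x $ i) \<in> flat_exp_algebra m"
| flat: "(\<lambda>x. flat_exp j (1 - m * (x \<bullet> x))) \<in> flat_exp_algebra m"
| add: "f \<in> flat_exp_algebra m \<Longrightarrow> g \<in> flat_exp_algebra m \<Longrightarrow> (\<lambda>x. f x + g x) \<in> flat_exp_algebra m"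
| mult: "f \<in> flat_exp_algebra m \<Longrightarrow> g \<in> flat_exp_algebra m \<Longrightarrow> (\<lambda>x. f x * g x) \<in> flat_exp_algebra m"

lemma flat_exp_algebra_closed:
  fixes f :: "real ^ 'n::finite \<Rightarrow> real"
  assumes "f \<in> flat_exp_algebra m"
  shows "(\<forall>x. f differentiable (at x)) \<and> (\<forall>i. partial_deriv i f \<in> flat_exp_algebra m)"
  using assms
proof induction
  case (const c)
  have "partial_deriv i (\<lambda>_ :: real ^ 'n. c) = (\<lambda>_. 0)" for i
    by (simp add: fun_eq_iff partial_deriv_eq[OF has_derivative_const])
  then show ?case by (simp add: flat_exp_algebra.const)
next
  case (coordinate j)
  have d: "((\<lambda>x :: real ^ 'n. x $ j) has_derivative (\<lambda>x. x $ j)) (at x)" for x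
    by (rule bounded_linear_imp_has_derivative[OF bounded_linear_vec_nth])
  have "partial_deriv i (\<lambda>x :: real ^ 'n. x $ j) = (\<lambda>_. axis i 1 $ j)" for i
    by (auto simp: partial_deriv_eq[OF d])
  then show ?case using d by (auto intro: flat_exp_algebra.const simp: differentiable_def)
next
  case (flat j)
  let ?q = "\<lambda>x :: real ^ 'n. 1 - m * (x \<bullet> x)"
  have q: "(?q has_derivative (\<lambda>h. - (m * (x \<bullet> h + h \<bullet> x)))) (at x)" for x
    by (auto intro!: derivative_eq_intros)
  have d: "((\<lambda>x. flat_exp j (?q x)) has_derivative
     (\<lambda>h. (flat_exp (j + 2) (?q x) - real j * flat_exp (j + 1) (?q x)) * (- (m * (x \<bullet> h + h \<bullet> x))))) (at x)" for x
    by (rule has_derivative_compose[OF q flat_exp_derivative[unfolded has_field_derivative_def]])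
  have pd: "partial_deriv i (\<lambda>x. flat_exp j (?q x))
     = (\<lambda>x. (flat_exp (j + 2) (?q x) + (- real j) * flat_exp (j + 1) (?q x)) * ((- 2 * m) * x $ i))" for i
    by (auto simp: partial_deriv_eq[OF d] inner_axis inner_commute[of "axis _ _"])
  have "(\<lambda>x :: real ^ 'n. (flat_exp (j + 2) (?q x) + (- real j) * flat_exp (j + 1) (?q x)) * ((- 2 * m) * x $ i)) \<in> flat_exp_algebra m" for i
    by (intro flat_exp_algebra.intros)
  then show ?case
    unfolding pd differentiable_def using d by blast
next
  case (add f g)
  then have "partial_deriv i (\<lambda>x. f x + g x) = (\<lambda>x. partial_deriv i f x + partial_deriv i g x)" for i
    by (auto simp: partial_deriv_add)
  then show ?case using add by (auto intro!: flat_exp_algebra.intros differentiable_add)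
next
  case (mult f g)
  have "partial_deriv i (\<lambda>x. f x * g x) = (\<lambda>x. f x * partial_deriv i g x + partial_deriv i f x * g x)" for i
  proof
    fix x
    show "partial_deriv i (\<lambda>x. f x * g x) x = f x * partial_deriv i g x + partial_deriv i f x * g x"
      unfolding partial_deriv_def[of i f] partial_deriv_def[of i g]
      using mult by (subst partial_deriv_eq[OF has_derivative_mult]) (auto intro!: differentiable_has_derivative)
  qed
  then show ?case using mult by (auto intro!: flat_exp_algebra.intros differentiable_mult)
qed

definition bump :: "real \<Rightarrow> real ^ 'n::finite \<Rightarrow> real" where
  "bump m x = flat_exp 0 (1 - m * (x \<bullet> x))"

lemma bump_pos_iff: "m > 0 \<Longrightarrow> bump m x > 0 \<longleftrightarrow> norm x < 1 / sqrt m"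
proof -
  assume m: "m > 0"
  have "norm x < 1 / sqrt m \<longleftrightarrow> (norm x)\<^sup>2 < (1 / sqrt m)\<^sup>2"
    using m abs_le_square_iff[of "1 / sqrt m" "norm x"] by (simp add: not_le[symmetric])
  also have "\<dots> \<longleftrightarrow> m * (x \<bullet> x) < 1"
    using m by (simp add: power2_norm_eq_inner[symmetric] power_divide field_simps)
  finally show ?thesis
    by (simp add: bump_def flat_exp_def)
qed

lemma bump_nonneg: "bump m x \<ge> 0"
  by (simp add: bump_def flat_exp_def)

lemma bump_test_function:
  assumes m: "m > 0"
  shows "(bump m :: real ^ 'n::finite \<Rightarrow> real) \<in> test_functions"
proof -
  have "(bump m :: real ^ 'n \<Rightarrow> real) \<in> flat_exp_algebra m"
    unfolding bump_def[abs_def] by (rule flat_exp_algebra.flat)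
  then have 1: "fold partial_deriv is (bump m :: real ^ 'n \<Rightarrow> real) differentiable_on UNIV" for "is"
    by (rule smooth_coinduct) (auto dest: flat_exp_algebra_closed)
  have 2: "bounded {x :: real ^ 'n. bump m x \<noteq> 0}"
  proof (rule bounded_subset[OF bounded_ball])
    show "{x :: real ^ 'n. bump m x \<noteq> 0} \<subseteq> ball 0 (1 / sqrt m)"
    proof
      fix x :: "real ^ 'n" assume "x \<in> {x. bump m x \<noteq> 0}"
      then have "bump m x > 0" using bump_nonneg[of m x] by simp
      then show "x \<in> ball 0 (1 / sqrt m)" using bump_pos_iff[OF m, of x] by simp
    qed
  qed
  show ?thesis
    by (rule test_functionsI[OF 1 2])
qed

text \<open>Where \<open>bump m\<close> is positive the phase of the exponential is at most \<open>1\<close>, so that its real part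
  is positive there.\<close>

lemma fourier_L1_bump_nonzero:
  fixes \<xi> :: "real ^ 'n::finite"
  assumes m: "m > 0" and \<xi>: "(norm \<xi>)\<^sup>2 \<le> m"
  shows "fourier_L1 (\<lambda>x. complex_of_real (bump m x)) \<xi> \<noteq> 0"
proof
  assume 0: "fourier_L1 (\<lambda>x. complex_of_real (bump m x)) \<xi> = 0"
  let ?f = "\<lambda>x. bump m x * cos (\<xi> \<bullet> x)"
  note int = test_functions_integrable(1)[OF bump_test_function[OF m]]
  have cos_pos: "cos (\<xi> \<bullet> x) > 0" if "bump m x > 0" for x
  proof -
    have "\<bar>\<xi> \<bullet> x\<bar> \<le> norm \<xi> * norm x" by (rule Cauchy_Schwarz_ineq2)
    also have "\<dots> \<le> sqrt m * (1 / sqrt m)"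
      using that bump_pos_iff[OF m, of x] \<xi> m by (intro mult_mono real_le_rsqrt) auto
    also have "\<dots> = 1" using m by simp
    finally show ?thesis
      using pi_gt3 by (intro cos_gt_zero_pi) auto
  qed
  have nonneg: "?f x \<ge> 0" for x
    using bump_nonneg[of m x] cos_pos[of x] by (cases "bump m x = 0") (auto simp: less_le)
  have eq: "Re (complex_of_real (bump m x) * wave \<xi> x) = ?f x" for x
    by (simp add: Re_exp)
  have intf: "integrable lborel ?f"
    using integrable_Re[OF fourier_L1_integrable[OF int, of \<xi>]] unfolding eq .
  have "(LINT x|lborel. ?f x) = Re (fourier_L1 (\<lambda>x. complex_of_real (bump m x)) \<xi>)"
    unfolding fourier_L1_def integral_Re[OF fourier_L1_integrable[OF int], symmetric]
    by (rule Bochner_Integration.integral_cong[OF refl eq[symmetric]])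
  then have "(LINT x|lborel. ?f x) = 0" using 0 by simp
  then have "AE x in lborel. ?f x = 0"
    using integral_nonneg_eq_0_iff_AE[OF intf] nonneg by auto
  then have "AE x :: real ^ 'n in lborel. x \<notin> ball 0 (1 / sqrt m)"
  proof (rule AE_mp, intro AE_I2 impI)
    fix x :: "real ^ 'n" assume "?f x = 0"
    then show "x \<notin> ball 0 (1 / sqrt m)" using cos_pos[of x] bump_pos_iff[OF m, of x] by auto
  qed
  then have "ball (0 :: real ^ 'n) (1 / sqrt m) \<in> null_sets lborel"
    by (subst AE_iff_null_sets) auto
  then have "negligible (ball (0 :: real ^ 'n) (1 / sqrt m))"
    using negligible_iff_null_sets null_sets_completionI by blast
  then show False
    using open_not_negligible[of "ball (0 :: real ^ 'n) (1 / sqrt m)"] m by auto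
qed

section \<open>The equation on the Fourier side\<close>

lemma fourier_pair_add: "fourier_pair f g \<Longrightarrow> fourier_pair f' g' \<Longrightarrow> fourier_pair (\<lambda>x. f x + f' x) (\<lambda>\<xi>. g \<xi> + g' \<xi>)"
  using fourier_pair_linear[of f g f' g' 1 1] by simp

lemma fourier_pair_diff: "fourier_pair f g \<Longrightarrow> fourier_pair f' g' \<Longrightarrow> fourier_pair (\<lambda>x. f x - f' x) (\<lambda>\<xi>. g \<xi> - g' \<xi>)"
  using fourier_pair_linear[of f g f' g' 1 "-1"] by simp

text \<open>
  A translate of a test function is a test function, so the sum of the correlations with \<open>\<phi>\<close> and its Laplacians is zero at
  every point. Its transform is the stated expression times \<open>fourier \<phi> (- \<xi>)\<close>, and countably many bumps suffice to
  divide by this factor at all frequencies.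
\<close>

lemma weak_equation_fourier:
  fixes u v w U V W :: "real ^ 'n::finite \<Rightarrow> complex"
  assumes u: "has_fourier_L2 u U" and v: "has_fourier_L2 v V" and w: "has_fourier_L2 w W"
    and eq: "\<And>\<phi>. \<phi> \<in> test_functions \<Longrightarrow> distr_of w \<phi> - distr_laplacian (distr_of w) \<phi>
           + distr_laplacian (distr_laplacian (distr_of u)) \<phi>
           - distr_laplacian (distr_of u) \<phi> + distr_of v \<phi> = 0"
  shows "AE \<xi> in lborel. complex_of_real (1 + (norm \<xi>)\<^sup>2) * W \<xi> + V \<xi>
       + complex_of_real ((norm \<xi>)\<^sup>2 * (1 + (norm \<xi>)\<^sup>2)) * U \<xi> = 0"
proof -
  let ?X = "\<lambda>\<xi>. complex_of_real (1 + (norm \<xi>)\<^sup>2) * W \<xi> + V \<xi>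
       + complex_of_real ((norm \<xi>)\<^sup>2 * (1 + (norm \<xi>)\<^sup>2)) * U \<xi>"
  have main: "AE \<xi> in lborel. fourier_L1 (\<lambda>x. complex_of_real (\<phi> x)) (- \<xi>) * ?X \<xi> = 0"
    if \<phi>: "\<phi> \<in> test_functions" for \<phi>
  proof -
    let ?c = "\<lambda>\<phi> x. complex_of_real (\<phi> x)"
    let ?L = "laplacian \<phi>" and ?LL = "laplacian (laplacian \<phi>)"
    note T = \<phi> test_functions_laplacian[OF \<phi>] test_functions_laplacian[OF test_functions_laplacian[OF \<phi>]]
    have P: "fourier_pair (correlation f (?c \<psi>)) (\<lambda>\<xi>. fourier_L1 (?c \<psi>) (- \<xi>) * g \<xi>)"
      if "has_fourier_L2 f g" "\<psi> \<in> test_functions" for f g \<psi>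
      by (intro fourier_pair_correlation has_fourier_L2_imp_fourier_pair that test_functions_integrable)
    have "fourier_pair
       (\<lambda>y. correlation w (?c \<phi>) y - correlation w (?c ?L) y + correlation u (?c ?LL) y
          - correlation u (?c ?L) y + correlation v (?c \<phi>) y)
       (\<lambda>\<xi>. fourier_L1 (?c \<phi>) (- \<xi>) * W \<xi> - fourier_L1 (?c ?L) (- \<xi>) * W \<xi> + fourier_L1 (?c ?LL) (- \<xi>) * U \<xi>
          - fourier_L1 (?c ?L) (- \<xi>) * U \<xi> + fourier_L1 (?c \<phi>) (- \<xi>) * V \<xi>)"
      by (intro fourier_pair_add fourier_pair_diff P u v w T)
    moreover have "correlation w (?c \<phi>) y - correlation w (?c ?L) y + correlation u (?c ?LL) y
          - correlation u (?c ?L) y + correlation v (?c \<phi>) y = 0" for y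
      using eq[OF test_functions_shift[OF \<phi>, of y]]
      unfolding distr_laplacian_def laplacian_shift[OF T(1)] laplacian_shift[OF T(2)]
      by (simp add: distr_of_def correlation_def)
    ultimately have "AE \<xi> in lborel. fourier_L1 (?c \<phi>) (- \<xi>) * W \<xi> - fourier_L1 (?c ?L) (- \<xi>) * W \<xi> + fourier_L1 (?c ?LL) (- \<xi>) * U \<xi>
          - fourier_L1 (?c ?L) (- \<xi>) * U \<xi> + fourier_L1 (?c \<phi>) (- \<xi>) * V \<xi> = 0"
      by (intro fourier_pair_zero) simp
    then show ?thesis
      by eventually_elim (simp add: fourier_L1_laplacian T algebra_simps)
  qed
  have "AE \<xi> in lborel. \<forall>k. fourier_L1 (\<lambda>x. complex_of_real (bump (real (Suc k)) x)) (- \<xi>) * ?X \<xi> = 0"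
    unfolding AE_all_countable by (intro allI main bump_test_function) simp
  then show ?thesis
  proof eventually_elim
    case (elim \<xi>)
    obtain k :: nat where "(norm \<xi>)\<^sup>2 < real k" using reals_Archimedean2 by blast
    then have "fourier_L1 (\<lambda>x. complex_of_real (bump (real (Suc k)) x)) (- \<xi>) \<noteq> 0"
      by (intro fourier_L1_bump_nonzero) auto
    with elim show ?case by (metis mult_eq_0_iff)
  qed
qed

section \<open>Differentiation in the square norm\<close>

text \<open>
  The derivative at \<open>t\<close> of a function from \<open>[0, \<infinity>)\<close> to \<open>L\<^sup>2\<close>, where \<open>Y\<close> is its value. Each \<open>X \<tau>\<close> is only determined up to a null set
  that may depend on \<open>\<tau>\<close>, so nothing is said about \<open>\<tau> \<mapsto> X \<tau> \<xi>\<close> for a fixed \<open>\<xi>\<close>.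
\<close>

definition L2_deriv :: "(real \<Rightarrow> real ^ 'n::finite \<Rightarrow> complex) \<Rightarrow> (real ^ 'n \<Rightarrow> complex) \<Rightarrow> real \<Rightarrow> bool" where
  "L2_deriv X Y t \<longleftrightarrow>
     ((\<lambda>\<tau>. sqnorm (\<lambda>\<xi>. (X \<tau> \<xi> - X t \<xi>) / complex_of_real (\<tau> - t) - Y \<xi>)) \<longlongrightarrow> 0) (at t within {0..})"

lemma eventually_at_within_atLeast:
  fixes t :: real
  assumes "\<And>\<tau>. \<tau> \<ge> 0 \<Longrightarrow> \<tau> \<noteq> t \<Longrightarrow> P \<tau>"
  shows "\<forall>\<^sub>F \<tau> in at t within {0..}. P \<tau>"
  unfolding eventually_at_filter using assms by (intro always_eventually) auto

lemma H_has_derivative_imp_L2_deriv: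
  assumes d: "H_has_derivative s u v" and s: "s \<ge> 0" and t: "t \<ge> 0"
  shows "L2_deriv (\<lambda>\<tau>. fourier (u \<tau>)) (fourier (v t)) t"
  unfolding L2_deriv_def
proof (rule tendsto_sandwich[OF _ _ tendsto_const])
  let ?q = "\<lambda>\<tau> x. (u \<tau> x - u t x) / complex_of_real (\<tau> - t) - v t x"
  have lim: "((\<lambda>\<tau>. H_norm s (?q \<tau>)) \<longlongrightarrow> 0) (at t within {0..})"
    and H: "\<And>\<tau>. \<tau> \<ge> 0 \<Longrightarrow> u \<tau> \<in> H_space s" "v t \<in> H_space s"
    using d t unfolding H_has_derivative_def by auto
  have "((\<lambda>\<tau>. ennreal ((H_norm s (?q \<tau>))\<^sup>2)) \<longlongrightarrow> ennreal (0\<^sup>2)) (at t within {0..})"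
    by (intro tendsto_intros lim)
  then show "((\<lambda>\<tau>. ennreal ((H_norm s (?q \<tau>))\<^sup>2)) \<longlongrightarrow> 0) (at t within {0..})" by simp
  show "\<forall>\<^sub>F \<tau> in at t within {0..}. sqnorm (\<lambda>\<xi>. (fourier (u \<tau>) \<xi> - fourier (u t) \<xi>) / complex_of_real (\<tau> - t) - fourier (v t) \<xi>)
      \<le> ennreal ((H_norm s (?q \<tau>))\<^sup>2)"
  proof (rule eventually_at_within_atLeast)
    fix \<tau> :: real assume \<tau>: "\<tau> \<ge> 0"
    define c where "c = 1 / complex_of_real (\<tau> - t)"
    have q: "?q \<tau> = (\<lambda>x. c * (1 * u \<tau> x + (- 1) * u t x) + (- 1) * v t x)"
      by (auto simp: c_def)
    have w: "(\<lambda>x. 1 * u \<tau> x + (- 1) * u t x) \<in> H_space s"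
      by (intro H_space_linear H \<tau> t)
    have "AE \<xi> in lborel. fourier (?q \<tau>) \<xi> = c * fourier (\<lambda>x. 1 * u \<tau> x + (- 1) * u t x) \<xi> + (- 1) * fourier (v t) \<xi>"
      unfolding q by (rule fourier_linear[OF w H(2)])
    moreover have "AE \<xi> in lborel. fourier (\<lambda>x. 1 * u \<tau> x + (- 1) * u t x) \<xi> = 1 * fourier (u \<tau>) \<xi> + (- 1) * fourier (u t) \<xi>"
      by (rule fourier_linear[OF H(1)[OF \<tau>] H(1)[OF t]])
    ultimately have "AE \<xi> in lborel. (fourier (u \<tau>) \<xi> - fourier (u t) \<xi>) / complex_of_real (\<tau> - t) - fourier (v t) \<xi> = fourier (?q \<tau>) \<xi>"
      by eventually_elim (simp add: c_def)
    then have "sqnorm (\<lambda>\<xi>. (fourier (u \<tau>) \<xi> - fourier (u t) \<xi>) / complex_of_real (\<tau> - t) - fourier (v t) \<xi>)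
       = sqnorm (fourier (?q \<tau>))"
      by (rule sqnorm_cong_AE)
    also have "\<dots> \<le> ennreal ((H_norm s (?q \<tau>))\<^sup>2)"
      unfolding q by (intro sqnorm_fourier_le_H_norm H_space_linear[OF w H(2)] s)
    finally show "sqnorm (\<lambda>\<xi>. (fourier (u \<tau>) \<xi> - fourier (u t) \<xi>) / complex_of_real (\<tau> - t) - fourier (v t) \<xi>)
      \<le> ennreal ((H_norm s (?q \<tau>))\<^sup>2)" .
  qed
qed auto

lemma tendsto_sqnorm_bounded_mult:
  assumes f: "((\<lambda>i. sqnorm (f i)) \<longlongrightarrow> 0) F"
    and ev: "\<forall>\<^sub>F i in F. f i \<in> borel_measurable borel \<and> (\<forall>x. cmod (m i x) \<le> B)"
  shows "((\<lambda>i. sqnorm (\<lambda>x. m i x * f i x)) \<longlongrightarrow> 0) F"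
proof (rule tendsto_sqnorm_dominated[OF f, where c = "ennreal (B\<^sup>2)"])
  show "\<forall>\<^sub>F i in F. sqnorm (\<lambda>x. m i x * f i x) \<le> ennreal (B\<^sup>2) * sqnorm (f i)"
    using ev by eventually_elim (auto intro: sqnorm_mult_bounded)
qed simp

lemma tendsto_sqnorm_vanishing_mult:
  assumes f: "f \<in> L2_space" and b: "(b \<longlongrightarrow> 0) F" and ev: "\<forall>\<^sub>F i in F. \<forall>x. cmod (m i x) \<le> b i"
  shows "((\<lambda>i. sqnorm (\<lambda>x. m i x * f x)) \<longlongrightarrow> 0) F"
proof (rule tendsto_sandwich[OF _ _ tendsto_const])
  have "((\<lambda>i. ennreal ((b i)\<^sup>2 * (L2_norm f)\<^sup>2)) \<longlongrightarrow> ennreal (0\<^sup>2 * (L2_norm f)\<^sup>2)) F"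
    by (intro tendsto_intros b)
  then show "((\<lambda>i. ennreal ((b i)\<^sup>2 * (L2_norm f)\<^sup>2)) \<longlongrightarrow> 0) F" by simp
  show "\<forall>\<^sub>F i in F. sqnorm (\<lambda>x. m i x * f x) \<le> ennreal ((b i)\<^sup>2 * (L2_norm f)\<^sup>2)"
    using ev
  proof eventually_elim
    case (elim i)
    then show ?case
      using sqnorm_mult_bounded[of f "m i" "b i"] f by (simp add: L2_space_measurable sqnorm_eq_L2_norm ennreal_mult)
  qed
qed auto

lemma tendsto_sqnorm_add:
  assumes f: "((\<lambda>i. sqnorm (f i)) \<longlongrightarrow> 0) F" and g: "((\<lambda>i. sqnorm (g i)) \<longlongrightarrow> 0) F"
    and ev: "\<forall>\<^sub>F i in F. f i \<in> borel_measurable borel \<and> g i \<in> borel_measurable borel"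
  shows "((\<lambda>i. sqnorm (\<lambda>x. f i x + g i x)) \<longlongrightarrow> 0) F"
proof (rule tendsto_sandwich[OF _ _ tendsto_const])
  show "((\<lambda>i. 2 * sqnorm (f i) + 2 * sqnorm (g i)) \<longlongrightarrow> 0) F"
    using tendsto_add[OF ennreal_tendsto_cmult[OF _ f, of 2] ennreal_tendsto_cmult[OF _ g, of 2]] by simp
  show "\<forall>\<^sub>F i in F. sqnorm (\<lambda>x. f i x + g i x) \<le> 2 * sqnorm (f i) + 2 * sqnorm (g i)"
    using ev by eventually_elim (auto intro: sqnorm_add_le)
qed auto

lemma L2_deriv_add:
  assumes "L2_deriv X X' t" "L2_deriv Y Y' t"
    and [measurable]: "\<And>\<tau>. \<tau> \<ge> 0 \<Longrightarrow> X \<tau> \<in> borel_measurable borel" "\<And>\<tau>. \<tau> \<ge> 0 \<Longrightarrow> Y \<tau> \<in> borel_measurable borel"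
      "X' \<in> borel_measurable borel" "Y' \<in> borel_measurable borel" and t: "t \<ge> 0"
  shows "L2_deriv (\<lambda>\<tau> \<xi>. X \<tau> \<xi> + Y \<tau> \<xi>) (\<lambda>\<xi>. X' \<xi> + Y' \<xi>) t"
proof -
  have [measurable]: "X t \<in> borel_measurable borel" "Y t \<in> borel_measurable borel" using t by auto
  have "((\<lambda>\<tau>. sqnorm (\<lambda>\<xi>. ((X \<tau> \<xi> - X t \<xi>) / complex_of_real (\<tau> - t) - X' \<xi>) + ((Y \<tau> \<xi> - Y t \<xi>) / complex_of_real (\<tau> - t) - Y' \<xi>)))
     \<longlongrightarrow> 0) (at t within {0..})"
  proof (rule tendsto_sqnorm_add)
    show "\<forall>\<^sub>F \<tau> in at t within {0..}. (\<lambda>\<xi>. (X \<tau> \<xi> - X t \<xi>) / complex_of_real (\<tau> - t) - X' \<xi>) \<in> borel_measurable borel \<and>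
       (\<lambda>\<xi>. (Y \<tau> \<xi> - Y t \<xi>) / complex_of_real (\<tau> - t) - Y' \<xi>) \<in> borel_measurable borel"
      by (rule eventually_at_within_atLeast) (intro conjI; measurable)
  qed (use assms(1,2) in \<open>auto simp: L2_deriv_def\<close>)
  then show ?thesis
    unfolding L2_deriv_def by (simp add: diff_divide_distrib add_divide_distrib algebra_simps)
qed

lemma L2_deriv_bounded_mult:
  assumes "L2_deriv X X' t" and m: "\<And>\<xi>. cmod (m \<xi>) \<le> B"
    and [measurable]: "\<And>\<tau>. \<tau> \<ge> 0 \<Longrightarrow> X \<tau> \<in> borel_measurable borel" "X' \<in> borel_measurable borel" and t: "t \<ge> 0"
  shows "L2_deriv (\<lambda>\<tau> \<xi>. m \<xi> * X \<tau> \<xi>) (\<lambda>\<xi>. m \<xi> * X' \<xi>) t"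
proof -
  have [measurable]: "X t \<in> borel_measurable borel" using t by auto
  have "((\<lambda>\<tau>. sqnorm (\<lambda>\<xi>. m \<xi> * ((X \<tau> \<xi> - X t \<xi>) / complex_of_real (\<tau> - t) - X' \<xi>))) \<longlongrightarrow> 0) (at t within {0..})"
  proof (rule tendsto_sqnorm_bounded_mult[where B = B])
    show "\<forall>\<^sub>F \<tau> in at t within {0..}. (\<lambda>\<xi>. (X \<tau> \<xi> - X t \<xi>) / complex_of_real (\<tau> - t) - X' \<xi>) \<in> borel_measurable borel \<and> (\<forall>x. cmod (m x) \<le> B)"
      by (rule eventually_at_within_atLeast) (intro conjI allI m; measurable)
  qed (use assms(1) in \<open>auto simp: L2_deriv_def\<close>)
  then show ?thesis
    unfolding L2_deriv_def by (simp add: right_diff_distrib)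
qed

lemma exp_taylor_bounds:
  fixes w :: complex
  shows "cmod (exp w - 1) \<le> exp (cmod w) * cmod w" "cmod (exp w - 1 - w) \<le> exp (cmod w) * (cmod w)\<^sup>2"
proof -
  have e: "exp \<bar>Re w\<bar> \<le> exp (cmod w)" by (simp add: abs_Re_le_cmod)
  have "cmod (exp w - 1) \<le> exp \<bar>Re w\<bar> * cmod w"
    using Taylor_exp[of w 0] by simp
  also have "\<dots> \<le> exp (cmod w) * cmod w" by (intro mult_right_mono e) auto
  finally show "cmod (exp w - 1) \<le> exp (cmod w) * cmod w" .
  have "cmod (exp w - 1 - w) \<le> exp \<bar>Re w\<bar> * (cmod w)\<^sup>2"
    using Taylor_exp[of w 1] by (simp add: power2_eq_square diff_diff_eq)
  also have "\<dots> \<le> exp (cmod w) * (cmod w)\<^sup>2" by (intro mult_right_mono e) auto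
  finally show "cmod (exp w - 1 - w) \<le> exp (cmod w) * (cmod w)\<^sup>2" .
qed

lemma cmod_exp_le: "cmod (exp w) \<le> exp (cmod w)"
  using complex_Re_le_cmod[of w] by simp

text \<open>The product rule for the integrating factor \<open>exp (- t \<mu>)\<close>, which is a bounded multiplier.\<close>

lemma L2_deriv_integrating_factor:
  fixes X :: "real \<Rightarrow> real ^ 'n::finite \<Rightarrow> complex"
  assumes X: "L2_deriv X Y t" and \<mu>: "\<And>\<xi>. cmod (\<mu> \<xi>) \<le> M" and [measurable]: "\<mu> \<in> borel_measurable borel"
    and L2: "\<And>\<tau>. \<tau> \<ge> 0 \<Longrightarrow> X \<tau> \<in> L2_space" "Y \<in> L2_space" and t: "t \<ge> 0"
  shows "L2_deriv (\<lambda>\<tau> \<xi>. exp (- complex_of_real \<tau> * \<mu> \<xi>) * X \<tau> \<xi>)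
     (\<lambda>\<xi>. exp (- complex_of_real t * \<mu> \<xi>) * (Y \<xi> - \<mu> \<xi> * X t \<xi>)) t"
proof -
  have [measurable]: "\<tau> \<ge> 0 \<Longrightarrow> X \<tau> \<in> borel_measurable borel" "Y \<in> borel_measurable borel" for \<tau>
    using L2 by auto
  note [measurable] = L2(1)[OF t, THEN L2_space_measurable]
  have M: "M \<ge> 0" using \<mu>[of 0] norm_ge_zero[of "\<mu> 0"] by linarith
  let ?e = "\<lambda>\<tau> \<xi>. exp (- complex_of_real \<tau> * \<mu> \<xi>)"
  let ?q = "\<lambda>\<tau> \<xi>. (X \<tau> \<xi> - X t \<xi>) / complex_of_real (\<tau> - t) - Y \<xi>"
  let ?r = "\<lambda>\<tau> \<xi>. (?e \<tau> \<xi> - ?e t \<xi>) / complex_of_real (\<tau> - t) + \<mu> \<xi> * ?e t \<xi>"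
  define B where "B = exp (t * M) * exp M"
  let ?F = "at t within {0..}"
  have near: "\<forall>\<^sub>F \<tau> in ?F. \<tau> \<ge> 0 \<and> \<tau> \<noteq> t \<and> \<bar>\<tau> - t\<bar> \<le> 1"
    unfolding eventually_at by (intro exI[of _ 1]) (auto simp: dist_real_def)
  have e0: "cmod (?e s \<xi>) \<le> exp (\<bar>s\<bar> * M)" for s \<xi>
  proof -
    have "cmod (?e s \<xi>) \<le> exp (cmod (- complex_of_real s * \<mu> \<xi>))" by (rule cmod_exp_le)
    also have "\<dots> \<le> exp (\<bar>s\<bar> * M)" using \<mu> by (simp add: norm_mult mult_left_mono)
    finally show ?thesis .
  qed
  have step: "cmod (?e \<tau> \<xi>) \<le> B" "cmod (?e \<tau> \<xi> - ?e t \<xi>) \<le> B * M * \<bar>\<tau> - t\<bar>" "cmod (?r \<tau> \<xi>) \<le> B * M\<^sup>2 * \<bar>\<tau> - t\<bar>"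
    if "\<tau> \<ge> 0 \<and> \<tau> \<noteq> t \<and> \<bar>\<tau> - t\<bar> \<le> 1" for \<tau> \<xi>
  proof -
    define d where "d = \<tau> - t"
    have d: "d \<noteq> 0" "\<bar>d\<bar> \<le> 1" using that by (auto simp: d_def)
    define w where "w = - complex_of_real d * \<mu> \<xi>"
    have ew: "?e \<tau> \<xi> = ?e t \<xi> * exp w"
      by (simp add: w_def d_def algebra_simps flip: exp_add)
    have wM: "cmod w \<le> M * \<bar>d\<bar>" using mult_left_mono[OF \<mu>, of "\<bar>d\<bar>" \<xi>] by (simp add: w_def norm_mult mult.commute)
    also have "\<dots> \<le> M" using d M by (simp add: mult_left_le)
    finally have wM1: "exp (cmod w) \<le> exp M" by simp
    have et: "cmod (?e t \<xi>) \<le> exp (t * M)" using e0[of t \<xi>] t by simp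
    show "cmod (?e \<tau> \<xi>) \<le> B"
      unfolding ew norm_mult B_def
      by (intro mult_mono et order_trans[OF cmod_exp_le wM1]) auto
    have "cmod (exp w - 1) \<le> exp M * (M * \<bar>d\<bar>)"
      using exp_taylor_bounds(1)[of w] wM wM1 mult_mono[OF wM1 wM] by simp
    then have "cmod (?e t \<xi>) * cmod (exp w - 1) \<le> exp (t * M) * (exp M * (M * \<bar>d\<bar>))"
      by (intro mult_mono et) auto
    moreover have "?e \<tau> \<xi> - ?e t \<xi> = ?e t \<xi> * (exp w - 1)"
      unfolding ew by (simp add: algebra_simps)
    ultimately show "cmod (?e \<tau> \<xi> - ?e t \<xi>) \<le> B * M * \<bar>\<tau> - t\<bar>"
      unfolding B_def d_def[symmetric] by (simp only: norm_mult mult.assoc)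
    have "cmod (exp w - 1 - w) \<le> exp M * (M * \<bar>d\<bar>)\<^sup>2"
      using exp_taylor_bounds(2)[of w] mult_mono[OF wM1 power_mono[OF wM, of 2]] by simp
    then have "cmod (?e t \<xi>) * cmod (exp w - 1 - w) \<le> exp (t * M) * (exp M * (M * \<bar>d\<bar>)\<^sup>2)"
      by (intro mult_mono et) auto
    also have "\<dots> = (B * M\<^sup>2 * \<bar>d\<bar>) * \<bar>d\<bar>"
      unfolding B_def by (simp only: power_mult_distrib power2_eq_square[of "\<bar>d\<bar>"] ac_simps)
    finally have le: "cmod (?e t \<xi>) * cmod (exp w - 1 - w) \<le> (B * M\<^sup>2 * \<bar>d\<bar>) * \<bar>d\<bar>" .
    have "?r \<tau> \<xi> * complex_of_real d = ?e t \<xi> * (exp w - 1 - w)"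
      unfolding ew d_def[symmetric] using d by (simp add: w_def field_simps)
    then have "cmod (?r \<tau> \<xi>) * \<bar>d\<bar> = cmod (?e t \<xi>) * cmod (exp w - 1 - w)"
      by (metis norm_mult norm_of_real)
    with le have "cmod (?r \<tau> \<xi>) * \<bar>d\<bar> \<le> (B * M\<^sup>2 * \<bar>d\<bar>) * \<bar>d\<bar>"
      by (simp only:)
    then show "cmod (?r \<tau> \<xi>) \<le> B * M\<^sup>2 * \<bar>\<tau> - t\<bar>"
      unfolding d_def[symmetric] using d by (simp add: mult_le_cancel_right)
  qed
  have lim0: "((\<lambda>\<tau>. C * \<bar>\<tau> - t\<bar>) \<longlongrightarrow> 0) ?F" for C :: real
    by (auto intro!: tendsto_eq_intros)
  have 1: "((\<lambda>\<tau>. sqnorm (\<lambda>\<xi>. ?e \<tau> \<xi> * ?q \<tau> \<xi>)) \<longlongrightarrow> 0) ?F"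
  proof (rule tendsto_sqnorm_bounded_mult[where B = B])
    show "((\<lambda>\<tau>. sqnorm (?q \<tau>)) \<longlongrightarrow> 0) ?F" using X by (simp add: L2_deriv_def)
    show "\<forall>\<^sub>F \<tau> in ?F. ?q \<tau> \<in> borel_measurable borel \<and> (\<forall>x. cmod (?e \<tau> x) \<le> B)"
      using near by eventually_elim (use step in auto)
  qed
  have 2: "((\<lambda>\<tau>. sqnorm (\<lambda>\<xi>. (?e \<tau> \<xi> - ?e t \<xi>) * Y \<xi>)) \<longlongrightarrow> 0) ?F"
    by (rule tendsto_sqnorm_vanishing_mult[OF L2(2) lim0[of "B * M"]])
       (use near in \<open>eventually_elim, use step in auto\<close>)
  have 3: "((\<lambda>\<tau>. sqnorm (\<lambda>\<xi>. ?r \<tau> \<xi> * X t \<xi>)) \<longlongrightarrow> 0) ?F"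
    by (rule tendsto_sqnorm_vanishing_mult[OF L2(1)[OF t] lim0[of "B * M\<^sup>2"]])
       (use near in \<open>eventually_elim, use step in auto\<close>)
  \<comment> \<open>The sum of the three terms is the difference quotient of the product minus its limit.\<close>
  have "((\<lambda>\<tau>. sqnorm (\<lambda>\<xi>. ?e \<tau> \<xi> * ?q \<tau> \<xi> + ((?e \<tau> \<xi> - ?e t \<xi>) * Y \<xi> + ?r \<tau> \<xi> * X t \<xi>))) \<longlongrightarrow> 0) ?F"
  proof (intro tendsto_sqnorm_add 1 2 3 eventually_at_within_atLeast)
    fix \<tau> :: real assume "\<tau> \<ge> 0"
    then show "(\<lambda>\<xi>. ?e \<tau> \<xi> * ?q \<tau> \<xi>) \<in> borel_measurable borel \<and> (\<lambda>\<xi>. (?e \<tau> \<xi> - ?e t \<xi>) * Y \<xi> + ?r \<tau> \<xi> * X t \<xi>) \<in> borel_measurable borel"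
      by (intro conjI; measurable)
  next
    show "(\<lambda>\<xi>. (?e \<tau> \<xi> - ?e t \<xi>) * Y \<xi>) \<in> borel_measurable borel \<and> (\<lambda>\<xi>. ?r \<tau> \<xi> * X t \<xi>) \<in> borel_measurable borel" for \<tau>
      by (intro conjI; measurable)
  qed
  then show ?thesis
    unfolding L2_deriv_def by (simp add: diff_divide_distrib algebra_simps)
qed

lemma L2_norm_cmult: "L2_norm (\<lambda>x. c * f x) = cmod c * L2_norm f"
  unfolding L2_norm_def by (simp add: norm_mult power_mult_distrib real_sqrt_mult)

lemma L2_norm_zero_iff:
  assumes "f \<in> L2_space"
  shows "L2_norm f = 0 \<longleftrightarrow> (AE x in lborel. f x = 0)"
  using sqnorm_eq_0_iff[of f] sqnorm_eq_L2_norm[OF assms] L2_space_measurable[OF assms] by simp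

lemma L2_deriv_increment:
  assumes Z: "L2_deriv Z D t" and L2: "\<And>\<tau>. \<tau> \<ge> 0 \<Longrightarrow> Z \<tau> \<in> L2_space" "D \<in> L2_space" and t: "t \<ge> 0"
  shows "((\<lambda>\<tau>. L2_norm (\<lambda>\<xi>. Z \<tau> \<xi> - Z t \<xi>)) \<longlongrightarrow> 0) (at t within {0..})"
    and "L2_norm D = 0 \<Longrightarrow> ((\<lambda>\<tau>. L2_norm (\<lambda>\<xi>. Z \<tau> \<xi> - Z t \<xi>) / \<bar>\<tau> - t\<bar>) \<longlongrightarrow> 0) (at t within {0..})"
proof -
  let ?F = "at t within {0..}"
  let ?q = "\<lambda>\<tau> \<xi>. (Z \<tau> \<xi> - Z t \<xi>) / complex_of_real (\<tau> - t) - D \<xi>"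
  have qL2: "?q \<tau> \<in> L2_space" if "\<tau> \<ge> 0" for \<tau>
    using L2_space_diff[OF L2_space_cmult[OF L2_space_diff[OF L2(1)[OF that] L2(1)[OF t]], of "1 / complex_of_real (\<tau> - t)"] L2(2)]
    by simp
  have "((\<lambda>\<tau>. ennreal ((L2_norm (?q \<tau>))\<^sup>2)) \<longlongrightarrow> 0) ?F"
  proof (rule Lim_transform_eventually)
    show "((\<lambda>\<tau>. sqnorm (?q \<tau>)) \<longlongrightarrow> 0) ?F" using Z by (simp add: L2_deriv_def)
    show "\<forall>\<^sub>F \<tau> in ?F. sqnorm (?q \<tau>) = ennreal ((L2_norm (?q \<tau>))\<^sup>2)"
      by (rule eventually_at_within_atLeast) (intro sqnorm_eq_L2_norm qL2)
  qed
  then have "((\<lambda>\<tau>. (L2_norm (?q \<tau>))\<^sup>2) \<longlongrightarrow> 0) ?F"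
    using tendsto_ennreal_iff[where x = 0 and F = ?F and f = "\<lambda>\<tau>. (L2_norm (?q \<tau>))\<^sup>2"] by simp
  from tendsto_real_sqrt[OF this] have q0: "((\<lambda>\<tau>. L2_norm (?q \<tau>)) \<longlongrightarrow> 0) ?F"
    by simp
  have bound: "L2_norm (\<lambda>\<xi>. Z \<tau> \<xi> - Z t \<xi>) \<le> \<bar>\<tau> - t\<bar> * (L2_norm (?q \<tau>) + L2_norm D)" if "\<tau> \<ge> 0" "\<tau> \<noteq> t" for \<tau>
  proof -
    have "(\<lambda>\<xi>. Z \<tau> \<xi> - Z t \<xi>) = (\<lambda>\<xi>. complex_of_real (\<tau> - t) * (?q \<tau> \<xi> + D \<xi>))"
      using that by (auto simp: field_simps)
    then have "L2_norm (\<lambda>\<xi>. Z \<tau> \<xi> - Z t \<xi>) = \<bar>\<tau> - t\<bar> * L2_norm (\<lambda>\<xi>. ?q \<tau> \<xi> + D \<xi>)"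
      using L2_norm_cmult[of "complex_of_real (\<tau> - t)"] by (simp only: norm_of_real)
    also have "\<dots> \<le> \<bar>\<tau> - t\<bar> * (L2_norm (?q \<tau>) + L2_norm D)"
      by (intro mult_left_mono L2_norm_triangle qL2 L2 that) auto
    finally show ?thesis .
  qed
  show "((\<lambda>\<tau>. L2_norm (\<lambda>\<xi>. Z \<tau> \<xi> - Z t \<xi>)) \<longlongrightarrow> 0) ?F"
  proof (rule Lim_null_comparison)
    show "\<forall>\<^sub>F \<tau> in ?F. norm (L2_norm (\<lambda>\<xi>. Z \<tau> \<xi> - Z t \<xi>)) \<le> \<bar>\<tau> - t\<bar> * (L2_norm (?q \<tau>) + L2_norm D)"
      by (rule eventually_at_within_atLeast) (subst real_norm_def, subst abs_of_nonneg, rule L2_norm_nonneg, rule bound)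
    show "((\<lambda>\<tau>. \<bar>\<tau> - t\<bar> * (L2_norm (?q \<tau>) + L2_norm D)) \<longlongrightarrow> 0) ?F"
      by (rule tendsto_eq_intros q0 refl | simp)+
  qed
  assume D: "L2_norm D = 0"
  show "((\<lambda>\<tau>. L2_norm (\<lambda>\<xi>. Z \<tau> \<xi> - Z t \<xi>) / \<bar>\<tau> - t\<bar>) \<longlongrightarrow> 0) ?F"
  proof (rule Lim_null_comparison[OF _ q0])
    show "\<forall>\<^sub>F \<tau> in ?F. norm (L2_norm (\<lambda>\<xi>. Z \<tau> \<xi> - Z t \<xi>) / \<bar>\<tau> - t\<bar>) \<le> L2_norm (?q \<tau>)"
    proof (rule eventually_at_within_atLeast)
      fix \<tau> :: real assume \<tau>: "\<tau> \<ge> 0" "\<tau> \<noteq> t"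
      show "norm (L2_norm (\<lambda>\<xi>. Z \<tau> \<xi> - Z t \<xi>) / \<bar>\<tau> - t\<bar>) \<le> L2_norm (?q \<tau>)"
        using bound[OF \<tau>] \<tau> D by (simp add: divide_le_eq mult.commute)
    qed
  qed
qed

text \<open>
  The distance \<open>\<zeta>\<close> to \<open>Z 0\<close> is a real function of time, and by the reverse triangle inequality its increments are bounded by
  those of \<open>Z\<close>. Hence it has derivative \<open>0\<close> for positive times; at time \<open>0\<close>, where \<open>D 0\<close> is arbitrary, it is continuous.
\<close>

lemma L2_deriv_zero_constant:
  assumes Z: "\<And>t. t \<ge> 0 \<Longrightarrow> L2_deriv Z (D t) t" and L2: "\<And>\<tau>. \<tau> \<ge> 0 \<Longrightarrow> Z \<tau> \<in> L2_space" "\<And>\<tau>. \<tau> \<ge> 0 \<Longrightarrow> D \<tau> \<in> L2_space"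
    and D0: "\<And>t. t > 0 \<Longrightarrow> AE \<xi> in lborel. D t \<xi> = 0" and T: "T \<ge> 0"
  shows "AE \<xi> in lborel. Z T \<xi> = Z 0 \<xi>"
proof -
  define \<zeta> where "\<zeta> t = L2_norm (\<lambda>\<xi>. Z t \<xi> - Z 0 \<xi>)" for t
  have inc: "\<bar>\<zeta> \<tau> - \<zeta> t\<bar> \<le> L2_norm (\<lambda>\<xi>. Z \<tau> \<xi> - Z t \<xi>)" if "\<tau> \<ge> 0" "t \<ge> 0" for \<tau> t
    using L2_norm_reverse_triangle[of "\<lambda>\<xi>. Z \<tau> \<xi> - Z 0 \<xi>" "\<lambda>\<xi>. Z t \<xi> - Z 0 \<xi>"] L2(1) that
    by (simp add: \<zeta>_def L2_space_diff)
  have cont: "(\<zeta> \<longlongrightarrow> \<zeta> t) (at t within {0..})" if t: "t \<ge> 0" for t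
  proof (rule LIM_zero_cancel)
    show "((\<lambda>\<tau>. \<zeta> \<tau> - \<zeta> t) \<longlongrightarrow> 0) (at t within {0..})"
    proof (rule Lim_null_comparison[OF _ L2_deriv_increment(1)[OF Z[OF t] L2(1) L2(2)[OF t] t]])
      show "\<forall>\<^sub>F \<tau> in at t within {0..}. norm (\<zeta> \<tau> - \<zeta> t) \<le> L2_norm (\<lambda>\<xi>. Z \<tau> \<xi> - Z t \<xi>)"
        by (rule eventually_at_within_atLeast) (use inc t in auto)
    qed
  qed
  have "\<zeta> T = \<zeta> 0"
  proof (cases "T = 0")
    case False
    then have "0 < T" using T by simp
    then show ?thesis
    proof (rule DERIV_isconst2)
      show "continuous_on {0..T} \<zeta>"
        unfolding continuous_on_def using cont by (auto intro!: tendsto_within_subset[OF cont])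
      fix t assume t: "0 < t" "t < T"
      have at: "at t within {0..} = at t"
        using t by (intro at_within_open_subset[of _ "{0<..}"]) auto
      have "L2_norm (D t) = 0"
        using L2(2)[of t] D0[of t] t by (subst L2_norm_zero_iff) auto
      from L2_deriv_increment(2)[OF Z[of t] L2(1) L2(2)[of t] _ this] t
      have "((\<lambda>\<tau>. L2_norm (\<lambda>\<xi>. Z \<tau> \<xi> - Z t \<xi>) / \<bar>\<tau> - t\<bar>) \<longlongrightarrow> 0) (at t within {0..})" by simp
      then have "((\<lambda>\<tau>. (\<zeta> \<tau> - \<zeta> t) / (\<tau> - t)) \<longlongrightarrow> 0) (at t within {0..})"
      proof (rule Lim_null_comparison[rotated])
        show "\<forall>\<^sub>F \<tau> in at t within {0..}. norm ((\<zeta> \<tau> - \<zeta> t) / (\<tau> - t)) \<le> L2_norm (\<lambda>\<xi>. Z \<tau> \<xi> - Z t \<xi>) / \<bar>\<tau> - t\<bar>"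
          by (rule eventually_at_within_atLeast) (use inc t in \<open>auto intro: divide_right_mono\<close>)
      qed
      then show "(\<zeta> has_real_derivative 0) (at t)"
        unfolding at by (simp add: has_field_derivative_iff)
    qed (use T in auto)
  qed simp
  then have "L2_norm (\<lambda>\<xi>. Z T \<xi> - Z 0 \<xi>) = 0"
    by (simp add: \<zeta>_def L2_norm_def)
  then have "AE \<xi> in lborel. Z T \<xi> - Z 0 \<xi> = 0"
    using L2(1) T by (subst (asm) L2_norm_zero_iff) (auto intro: L2_space_diff)
  then show ?thesis by eventually_elim simp
qed

lemma L2_linear_ode_unique:
  assumes X: "\<And>t. t \<ge> 0 \<Longrightarrow> L2_deriv X (Y t) t" and L2: "\<And>\<tau>. \<tau> \<ge> 0 \<Longrightarrow> X \<tau> \<in> L2_space" "\<And>\<tau>. \<tau> \<ge> 0 \<Longrightarrow> Y \<tau> \<in> L2_space"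
    and \<mu>: "\<And>\<xi>. cmod (\<mu> \<xi>) \<le> M" and [measurable]: "\<mu> \<in> borel_measurable borel"
    and eq: "\<And>t. t > 0 \<Longrightarrow> AE \<xi> in lborel. Y t \<xi> = \<mu> \<xi> * X t \<xi>" and T: "T \<ge> 0"
  shows "AE \<xi> in lborel. X T \<xi> = exp (complex_of_real T * \<mu> \<xi>) * X 0 \<xi>"
proof -
  let ?e = "\<lambda>\<tau> \<xi>. exp (- complex_of_real \<tau> * \<mu> \<xi>)"
  have e: "cmod (?e t \<xi>) \<le> exp (\<bar>t\<bar> * M)" for t \<xi>
  proof -
    have "cmod (?e t \<xi>) \<le> exp (cmod (- complex_of_real t * \<mu> \<xi>))" by (rule cmod_exp_le)
    also have "\<dots> \<le> exp (\<bar>t\<bar> * M)" using \<mu> by (simp add: norm_mult mult_left_mono)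
    finally show ?thesis .
  qed
  have L2e: "(\<lambda>\<xi>. ?e t \<xi> * h \<xi>) \<in> L2_space" if "h \<in> L2_space" for h t
    by (rule L2_space_bounded_mult[OF that _ e]) measurable
  have "AE \<xi> in lborel. ?e T \<xi> * X T \<xi> = ?e 0 \<xi> * X 0 \<xi>"
  proof (rule L2_deriv_zero_constant[where D = "\<lambda>t \<xi>. ?e t \<xi> * (Y t \<xi> - \<mu> \<xi> * X t \<xi>)", OF _ _ _ _ T])
    fix t :: real assume t: "t \<ge> 0"
    show "L2_deriv (\<lambda>t \<xi>. ?e t \<xi> * X t \<xi>) (\<lambda>\<xi>. ?e t \<xi> * (Y t \<xi> - \<mu> \<xi> * X t \<xi>)) t"
      by (rule L2_deriv_integrating_factor[OF X[OF t] \<mu>]) (use L2 t in auto)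
    show "(\<lambda>\<xi>. ?e t \<xi> * X t \<xi>) \<in> L2_space"
      by (intro L2e L2 t)
    show "(\<lambda>\<xi>. ?e t \<xi> * (Y t \<xi> - \<mu> \<xi> * X t \<xi>)) \<in> L2_space"
      by (intro L2e L2_space_diff L2 t L2_space_bounded_mult[OF _ _ \<mu>]) measurable
  next
    fix t :: real assume "t > 0"
    from eq[OF this] show "AE \<xi> in lborel. ?e t \<xi> * (Y t \<xi> - \<mu> \<xi> * X t \<xi>) = 0"
      by eventually_elim simp
  qed
  then show ?thesis
    by eventually_elim (simp add: exp_minus field_simps)
qed

section \<open>The solution formula\<close>

text \<open>
  The roots of \<open>(1 + a) \<kappa>\<^sup>2 + \<kappa> + a (1 + a) = 0\<close>, one for each of the signs \<open>\<sigma> = 1\<close> and \<open>\<sigma> = - 1\<close>.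
\<close>

definition char_root :: "real \<Rightarrow> real \<Rightarrow> complex" where
  "char_root \<sigma> a = (complex_of_real (- 1 / (1 + a)) + complex_of_real \<sigma> * csqrt (complex_of_real (1 / (1 + a)\<^sup>2 - 4 * a))) / 2"

lemma char_root_sum: "char_root 1 a + char_root (- 1) a = - complex_of_real (1 / (1 + a))"
proof -
  have half_sum: "(q + 1 * s) / 2 + (q + (- 1) * s) / 2 = q" for q s :: complex
    by (simp add: field_simps)
  have "char_root 1 a + char_root (- 1) a = complex_of_real (- 1 / (1 + a))"
    unfolding char_root_def of_real_1 of_real_minus half_sum by (rule refl)
  then show ?thesis by simp
qed

lemma char_root_diff: "char_root 1 a - char_root (- 1) a = csqrt (complex_of_real (1 / (1 + a)\<^sup>2 - 4 * a))"
  unfolding char_root_def diff_divide_distrib[symmetric] by simp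

lemma char_root_prod: "char_root 1 a * char_root (- 1) a = complex_of_real a"
proof -
  define s where "s = csqrt (complex_of_real (1 / (1 + a)\<^sup>2 - 4 * a))"
  define q where "q = complex_of_real (- 1 / (1 + a))"
  have s: "s\<^sup>2 = complex_of_real (1 / (1 + a)\<^sup>2 - 4 * a)" unfolding s_def by simp
  have "char_root 1 a * char_root (- 1) a = (q + s) / 2 * ((q - s) / 2)"
    unfolding char_root_def s_def[symmetric] q_def[symmetric] by simp
  also have "\<dots> = (q\<^sup>2 - s\<^sup>2) / 4" by (simp add: power2_eq_square field_simps)
  also have "q\<^sup>2 = complex_of_real (1 / (1 + a)\<^sup>2)" by (simp add: q_def power_divide)
  finally show ?thesis unfolding s by simp
qed

lemma csqrt_of_real_measurable [measurable]:
  "(\<lambda>x. csqrt (complex_of_real x)) \<in> borel_measurable borel"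
proof -
  have "(\<lambda>x. csqrt (complex_of_real x)) = (\<lambda>x. if x \<ge> 0 then complex_of_real (sqrt x) else \<i> * complex_of_real (sqrt \<bar>x\<bar>))"
    by (auto simp: csqrt_of_real_nonneg csqrt_of_real_nonpos)
  then show ?thesis by simp
qed

lemma char_root_measurable [measurable]: "char_root \<sigma> \<in> borel_measurable borel"
  unfolding char_root_def[abs_def] by measurable

lemma cmod_char_root_le:
  assumes "a \<ge> 0" "\<bar>\<sigma>\<bar> \<le> 1"
  shows "cmod (char_root \<sigma> a) \<le> 2 + 2 * a"
proof -
  define z where "z = complex_of_real (1 / (1 + a)\<^sup>2 - 4 * a)"
  have q: "1 / (1 + a) \<le> 1" "1 / (1 + a)\<^sup>2 \<le> 1" using assms(1) by (auto simp: divide_le_eq_1 power2_eq_square algebra_simps)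
  have z: "cmod z \<le> 1 + 4 * a"
    unfolding z_def norm_of_real
  proof (rule abs_leI)
    have "0 \<le> 1 / (1 + a)\<^sup>2" by simp
    then show "1 / (1 + a)\<^sup>2 - 4 * a \<le> 1 + 4 * a" "- (1 / (1 + a)\<^sup>2 - 4 * a) \<le> 1 + 4 * a"
      using assms(1) q(2) by linarith+
  qed
  have "(cmod (csqrt z))\<^sup>2 = cmod z"
    by (simp flip: norm_power)
  moreover have "0 \<le> (cmod (csqrt z) - 1/2)\<^sup>2" by simp
  ultimately have "cmod (csqrt z) \<le> cmod z + 1"
    by (simp add: power2_eq_square algebra_simps)
  then have s: "cmod (csqrt z) \<le> 2 + 4 * a" using z by simp
  have "cmod (complex_of_real (- 1 / (1 + a)) + complex_of_real \<sigma> * csqrt z) \<le> 1 + 1 * (2 + 4 * a)"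
  proof (rule norm_triangle_le, rule add_mono)
    show "cmod (complex_of_real (- 1 / (1 + a))) \<le> 1"
      unfolding norm_of_real using assms(1) q(1) by simp
    show "cmod (complex_of_real \<sigma> * csqrt z) \<le> 1 * (2 + 4 * a)"
      unfolding norm_mult norm_of_real using assms s by (intro mult_mono) auto
  qed
  then show ?thesis
    unfolding char_root_def z_def[symmetric] by (simp add: norm_divide)
qed

text \<open>
  By the relations between roots and coefficients, \<open>W - \<kappa>' V = \<kappa> (V - \<kappa>' U)\<close>. The roots are bounded functions of
  the frequency on balls only, which is why everything is multiplied with the indicator of a ball.
\<close>

lemma char_root_component:
  fixes U V W :: "real \<Rightarrow> real ^ 'n::finite \<Rightarrow> complex" and \<kappa> \<kappa>' :: "real ^ 'n \<Rightarrow> complex"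
  assumes U: "\<And>t. t \<ge> 0 \<Longrightarrow> L2_deriv U (V t) t" and V: "\<And>t. t \<ge> 0 \<Longrightarrow> L2_deriv V (W t) t"
    and L2: "\<And>t. t \<ge> 0 \<Longrightarrow> U t \<in> L2_space" "\<And>t. t \<ge> 0 \<Longrightarrow> V t \<in> L2_space" "\<And>t. t \<ge> 0 \<Longrightarrow> W t \<in> L2_space"
    and eq: "\<And>t. t > 0 \<Longrightarrow> AE \<xi> in lborel. W t \<xi> = (\<kappa> \<xi> + \<kappa>' \<xi>) * V t \<xi> - \<kappa> \<xi> * \<kappa>' \<xi> * U t \<xi>"
    and [measurable]: "\<kappa> \<in> borel_measurable borel" "\<kappa>' \<in> borel_measurable borel"
    and bound: "\<And>\<xi>. cmod (\<kappa> \<xi>) \<le> 2 + 2 * (norm \<xi>)\<^sup>2" "\<And>\<xi>. cmod (\<kappa>' \<xi>) \<le> 2 + 2 * (norm \<xi>)\<^sup>2"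
    and T: "T \<ge> 0"
  shows "AE \<xi> in lborel. V T \<xi> - \<kappa>' \<xi> * U T \<xi> = exp (complex_of_real T * \<kappa> \<xi>) * (V 0 \<xi> - \<kappa>' \<xi> * U 0 \<xi>)"
proof -
  have "AE \<xi> in lborel. indicator (ball 0 R) \<xi> * (V T \<xi> - \<kappa>' \<xi> * U T \<xi>)
     = exp (complex_of_real T * (indicator (ball 0 R) \<xi> * \<kappa> \<xi>)) * (indicator (ball 0 R) \<xi> * (V 0 \<xi> - \<kappa>' \<xi> * U 0 \<xi>))" for R
  proof -
    let ?i = "\<lambda>\<xi>. indicator (ball 0 R) \<xi> :: complex"
    let ?B = "2 + 2 * R\<^sup>2"
    have R: "(norm \<xi>)\<^sup>2 \<le> R\<^sup>2" if "norm \<xi> < R" for \<xi> :: "real ^ 'n"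
      using that by (intro power_mono) auto
    have b: "cmod (?i \<xi> * \<kappa> \<xi>) \<le> ?B" "cmod (- ?i \<xi> * \<kappa>' \<xi>) \<le> ?B" "cmod (?i \<xi>) \<le> 1" for \<xi>
      using bound[of \<xi>] R[of \<xi>] by (auto simp: indicator_def norm_mult)
    have "AE \<xi> in lborel. ?i \<xi> * V T \<xi> + (- ?i \<xi> * \<kappa>' \<xi>) * U T \<xi>
       = exp (complex_of_real T * (?i \<xi> * \<kappa> \<xi>)) * (?i \<xi> * V 0 \<xi> + (- ?i \<xi> * \<kappa>' \<xi>) * U 0 \<xi>)"
    proof (rule L2_linear_ode_unique[where Y = "\<lambda>t \<xi>. ?i \<xi> * W t \<xi> + (- ?i \<xi> * \<kappa>' \<xi>) * V t \<xi>" and M = ?B, OF _ _ _ _ _ _ T])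
      fix t :: real assume t: "t \<ge> 0"
      note m = L2(1)[THEN L2_space_measurable] L2(2)[THEN L2_space_measurable] L2(3)[THEN L2_space_measurable]
      have m': "(\<lambda>\<xi>. ?i \<xi> * V \<tau> \<xi>) \<in> borel_measurable borel" "(\<lambda>\<xi>. (- ?i \<xi> * \<kappa>' \<xi>) * U \<tau> \<xi>) \<in> borel_measurable borel"
        "(\<lambda>\<xi>. ?i \<xi> * W \<tau> \<xi>) \<in> borel_measurable borel" "(\<lambda>\<xi>. (- ?i \<xi> * \<kappa>' \<xi>) * V \<tau> \<xi>) \<in> borel_measurable borel"
        if "\<tau> \<ge> 0" for \<tau>
        using m[OF that] by measurable
      show "L2_deriv (\<lambda>t \<xi>. ?i \<xi> * V t \<xi> + (- ?i \<xi> * \<kappa>' \<xi>) * U t \<xi>) (\<lambda>\<xi>. ?i \<xi> * W t \<xi> + (- ?i \<xi> * \<kappa>' \<xi>) * V t \<xi>) t"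
        by (intro L2_deriv_add L2_deriv_bounded_mult[OF V[OF t] b(3)] L2_deriv_bounded_mult[OF U[OF t] b(2)] m m' t)
      show "(\<lambda>\<xi>. ?i \<xi> * V t \<xi> + (- ?i \<xi> * \<kappa>' \<xi>) * U t \<xi>) \<in> L2_space"
           "(\<lambda>\<xi>. ?i \<xi> * W t \<xi> + (- ?i \<xi> * \<kappa>' \<xi>) * V t \<xi>) \<in> L2_space"
        by (intro L2_space_add L2_space_bounded_mult[OF _ _ b(3)] L2_space_bounded_mult[OF _ _ b(2)] L2 t; measurable)+
    next
      fix t :: real assume "t > 0"
      from eq[OF this] show "AE \<xi> in lborel. ?i \<xi> * W t \<xi> + (- ?i \<xi> * \<kappa>' \<xi>) * V t \<xi>
        = (?i \<xi> * \<kappa> \<xi>) * (?i \<xi> * V t \<xi> + (- ?i \<xi> * \<kappa>' \<xi>) * U t \<xi>)"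
        by eventually_elim (auto simp: indicator_def algebra_simps)
    qed (use b in auto)
    then show ?thesis
      by eventually_elim (simp add: algebra_simps)
  qed
  then have "AE \<xi> in lborel. \<forall>k::nat. indicator (ball 0 (real k)) \<xi> * (V T \<xi> - \<kappa>' \<xi> * U T \<xi>)
     = exp (complex_of_real T * (indicator (ball 0 (real k)) \<xi> * \<kappa> \<xi>)) * (indicator (ball 0 (real k)) \<xi> * (V 0 \<xi> - \<kappa>' \<xi> * U 0 \<xi>))"
    unfolding AE_all_countable by blast
  then show ?thesis
  proof eventually_elim
    case (elim \<xi>)
    obtain k :: nat where "norm \<xi> < real k" using reals_Archimedean2 by blast
    with elim[rule_format, of k] show ?case by simp
  qed
qed

text \<open>
  This says that \<open>y\<close> is the value at time \<open>t\<close> of the solution of \<open>(1 + a) y'' + y' + a (1 + a) y = 0\<close> with the initial data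
  \<open>x0\<close> and \<open>x1\<close>, as long as the roots are distinct. Without a division it remains true, but says nothing, at a double root.
\<close>

definition solves_mode :: "real \<Rightarrow> real \<Rightarrow> complex \<Rightarrow> complex \<Rightarrow> complex \<Rightarrow> bool" where
  "solves_mode a t x0 x1 y \<longleftrightarrow>
     (char_root 1 a - char_root (- 1) a) * y =
       exp (complex_of_real t * char_root 1 a) * (x1 - char_root (- 1) a * x0)
       - exp (complex_of_real t * char_root (- 1) a) * (x1 - char_root 1 a * x0)"

lemma X2_solution_fourier_formula:
  fixes u\<^sub>0 u\<^sub>1 :: "real ^ 'n::finite \<Rightarrow> complex"
  assumes sol: "X2_solution u\<^sub>0 u\<^sub>1 u" and u0: "u\<^sub>0 \<in> borel_measurable borel" and u1: "u\<^sub>1 \<in> borel_measurable borel" and T: "T \<ge> 0"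
  shows "has_fourier_L2 (u T) (fourier (u T))"
    and "AE \<xi> in lborel. solves_mode ((norm \<xi>)\<^sup>2) T (fourier u\<^sub>0 \<xi>) (fourier u\<^sub>1 \<xi>) (fourier (u T) \<xi>)"
proof -
  obtain v w where u: "H_has_derivative 2 u v" and v: "H_has_derivative 1 v w"
    and pde: "\<And>t \<phi>. t > 0 \<Longrightarrow> \<phi> \<in> test_functions \<Longrightarrow>
           distr_of (w t) \<phi> - distr_laplacian (distr_of (w t)) \<phi>
           + distr_laplacian (distr_laplacian (distr_of (u t))) \<phi>
           - distr_laplacian (distr_of (u t)) \<phi> + distr_of (v t) \<phi> = 0"
    and init: "AE x in lborel. u 0 x = u\<^sub>0 x" "AE x in lborel. v 0 x = u\<^sub>1 x"
    using sol unfolding X2_solution_def by blast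
  have H: "u t \<in> H_space 2" "v t \<in> H_space 2" "v t \<in> H_space 1" "w t \<in> H_space 1" if "t \<ge> 0" for t
    using u v that unfolding H_has_derivative_def by auto
  have F: "has_fourier_L2 (u t) (fourier (u t))" "has_fourier_L2 (v t) (fourier (v t))" "has_fourier_L2 (w t) (fourier (w t))" if "t \<ge> 0" for t
    using H[OF that] by (auto intro: H_space_has_fourier)
  then show "has_fourier_L2 (u T) (fourier (u T))" using T by blast
  have L2: "fourier (u t) \<in> L2_space" "fourier (v t) \<in> L2_space" "fourier (w t) \<in> L2_space" if "t \<ge> 0" for t
    using F[OF that] by (auto simp: has_fourier_L2_iff)
  have ode: "AE \<xi> in lborel. complex_of_real (1 + (norm \<xi>)\<^sup>2) * fourier (w t) \<xi> + fourier (v t) \<xi>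
       + complex_of_real ((norm \<xi>)\<^sup>2 * (1 + (norm \<xi>)\<^sup>2)) * fourier (u t) \<xi> = 0" if "t > 0" for t
    by (rule weak_equation_fourier[OF F pde[OF that]]) (use that in auto)
  let ?\<kappa> = "\<lambda>\<sigma> (\<xi> :: real ^ 'n). char_root \<sigma> ((norm \<xi>)\<^sup>2)"
  have ode': "AE \<xi> in lborel. fourier (w t) \<xi> = (?\<kappa> 1 \<xi> + ?\<kappa> (- 1) \<xi>) * fourier (v t) \<xi> - (?\<kappa> 1 \<xi> * ?\<kappa> (- 1) \<xi>) * fourier (u t) \<xi>" if "t > 0" for t
    using ode[OF that]
  proof eventually_elim
    case (elim \<xi>)
    define a where "a = complex_of_real ((norm \<xi>)\<^sup>2)"
    have a: "1 + a \<noteq> 0"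
    proof -
      have "1 + a = complex_of_real (1 + (norm \<xi>)\<^sup>2)" by (simp add: a_def)
      moreover have "1 + (norm \<xi>)\<^sup>2 > 0" by (simp add: add_pos_nonneg)
      ultimately show ?thesis by (metis less_irrefl of_real_eq_0_iff)
    qed
    have "(1 + a) * fourier (w t) \<xi> + fourier (v t) \<xi> + a * (1 + a) * fourier (u t) \<xi> = 0"
      using elim unfolding a_def by (simp only: of_real_add of_real_mult of_real_1)
    then have "fourier (v t) \<xi> = - (1 + a) * (fourier (w t) \<xi> + a * fourier (u t) \<xi>)"
      by algebra
    moreover have cancel: "- (1 / b) * (- b * x) = x" if "b \<noteq> 0" for b x :: complex
      using that by simp
    ultimately have "fourier (w t) \<xi> = - (1 / (1 + a)) * fourier (v t) \<xi> - a * fourier (u t) \<xi>"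
      using cancel[OF a, of "fourier (w t) \<xi> + a * fourier (u t) \<xi>"] by (simp only: add_diff_cancel_right')
    then show ?case
      unfolding char_root_sum char_root_prod a_def by simp
  qed
  have bound: "cmod (?\<kappa> \<sigma> \<xi>) \<le> 2 + 2 * (norm \<xi>)\<^sup>2" if "\<bar>\<sigma>\<bar> \<le> 1" for \<sigma> \<xi>
    by (rule cmod_char_root_le) (use that in auto)
  note D = H_has_derivative_imp_L2_deriv[OF u, simplified] H_has_derivative_imp_L2_deriv[OF v, simplified]
  have 1: "AE \<xi> in lborel. fourier (v T) \<xi> - ?\<kappa> (- 1) \<xi> * fourier (u T) \<xi>
     = exp (complex_of_real T * ?\<kappa> 1 \<xi>) * (fourier (v 0) \<xi> - ?\<kappa> (- 1) \<xi> * fourier (u 0) \<xi>)"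
    by (rule char_root_component[where W = "\<lambda>t. fourier (w t)", OF D L2 ode' _ _ _ _ T]) (use bound in auto)
  have 2: "AE \<xi> in lborel. fourier (v T) \<xi> - ?\<kappa> 1 \<xi> * fourier (u T) \<xi>
     = exp (complex_of_real T * ?\<kappa> (- 1) \<xi>) * (fourier (v 0) \<xi> - ?\<kappa> 1 \<xi> * fourier (u 0) \<xi>)"
    by (rule char_root_component[where W = "\<lambda>t. fourier (w t)", OF D L2 _ _ _ _ _ T])
       (use bound ode' in \<open>auto simp: ac_simps\<close>)
  have 3: "AE \<xi> in lborel. fourier u\<^sub>0 \<xi> = fourier (u 0) \<xi>" "AE \<xi> in lborel. fourier u\<^sub>1 \<xi> = fourier (v 0) \<xi>"
    by (rule fourier_eqI(2)[OF has_fourier_L2_cong_AE[OF F(1)[OF order_refl] init(1) u0]],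
        rule fourier_eqI(2)[OF has_fourier_L2_cong_AE[OF F(2)[OF order_refl] init(2) u1]])
  show "AE \<xi> in lborel. solves_mode ((norm \<xi>)\<^sup>2) T (fourier u\<^sub>0 \<xi>) (fourier u\<^sub>1 \<xi>) (fourier (u T) \<xi>)"
    using 1 2 3
  proof eventually_elim
    case (elim \<xi>)
    have "(?\<kappa> 1 \<xi> - ?\<kappa> (- 1) \<xi>) * fourier (u T) \<xi>
      = (fourier (v T) \<xi> - ?\<kappa> (- 1) \<xi> * fourier (u T) \<xi>) - (fourier (v T) \<xi> - ?\<kappa> 1 \<xi> * fourier (u T) \<xi>)"
      by algebra
    then show ?case
      unfolding elim solves_mode_def .
  qed
qed

section \<open>Pointwise bounds at low frequencies\<close>

lemma mult_exp_half_le: "x * exp (- x / 2) \<le> (1::real)" if "x \<ge> 0"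
proof -
  have "x \<le> (1 + x / 4)\<^sup>2"
    using zero_le_power2[of "1 - x / 4"] by (simp add: power2_eq_square algebra_simps)
  also have "\<dots> \<le> (exp (x / 4))\<^sup>2"
    using that exp_ge_add_one_self[of "x / 4"] by (intro power_mono) auto
  also have "\<dots> = exp (x / 2)"
    by (simp flip: exp_double)
  finally have "x \<le> exp (x / 2)" .
  then show ?thesis by (simp add: exp_minus field_simps)
qed

text \<open>
  For \<open>a \<le> 1 / 8\<close> the discriminant is bounded away from zero. The coefficients \<open>A1\<close> and \<open>A0\<close> of \<open>x1\<close> and \<open>x0\<close> in \<open>y\<close> are both
  compared with \<open>E = exp (- t a)\<close>: the larger root \<open>lp\<close> satisfies \<open>0 \<le> - (lp + a) \<le> 8 a\<^sup>2\<close>, the smaller root \<open>lm\<close> is below \<open>- 1 / 2\<close>, and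
  the remaining factors are \<open>1 + O(a)\<close>.
\<close>

lemma low_frequency_bound:
  fixes a t L :: real and y x0 x1 p0 p1 :: complex
  defines "\<kappa> \<equiv> char_root 1 a" and "\<kappa>' \<equiv> char_root (- 1) a"
  assumes a: "0 \<le> a" "a \<le> 1/8" and t: "t \<ge> 0"
    and sol: "solves_mode a t x0 x1 y"
    and x: "cmod x0 \<le> L" "cmod x1 \<le> L" and p: "cmod (x0 - p0) \<le> sqrt a * L" "cmod (x1 - p1) \<le> sqrt a * L"
  shows "cmod (y - (p1 + p0) * complex_of_real (exp (- t * a))) \<le> 42 * L * (sqrt a * exp (- t * a / 2) + exp (- t / 2))"
proof -
  have y: "(\<kappa> - \<kappa>') * y = exp (complex_of_real t * \<kappa>) * (x1 - \<kappa>' * x0) - exp (complex_of_real t * \<kappa>') * (x1 - \<kappa> * x0)"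
    using sol unfolding solves_mode_def \<kappa>_def \<kappa>'_def .
  have L: "L \<ge> 0" using x(1) norm_ge_zero[of x0] by linarith
  define b where "b = 4 * a * (1 + a)\<^sup>2"
  have b_a: "b \<le> 6 * a"
  proof -
    have "(1 + a)\<^sup>2 \<le> (9/8)\<^sup>2" using a by (intro power_mono) auto
    then have "(4 * a) * (1 + a)\<^sup>2 \<le> (4 * a) * (3/2)" using a by (intro mult_left_mono) (auto simp: power2_eq_square)
    then show ?thesis by (simp add: b_def)
  qed
  have b: "0 \<le> b" "b \<le> 16/25"
  proof -
    show "0 \<le> b" using a by (simp add: b_def)
    have "(4 * a) * (1 + a)\<^sup>2 \<le> (4 * (1/8)) * (9/8)\<^sup>2" using a by (intro mult_mono power_mono) auto
    then show "b \<le> 16/25" by (simp add: b_def power2_eq_square)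
  qed
  \<comment> \<open>The square root of the discriminant is \<open>r / (1 + a)\<close>.\<close>
  define r where "r = sqrt (1 - b)"
  have r2: "r\<^sup>2 = 1 - b" unfolding r_def using b by simp
  have r: "3/5 \<le> r" "r \<le> 1"
    unfolding r_def using b real_le_rsqrt[of "3/5" "1 - b"] by (simp_all add: power2_eq_square)
  have r_b: "1 - r \<le> b"
  proof -
    have "(1 - r) * 1 \<le> (1 - r) * (1 + r)" using r by (intro mult_left_mono) auto
    also have "\<dots> = b" using r2 by (simp add: power2_eq_square algebra_simps)
    finally show ?thesis by simp
  qed
  define c where "c = 1 + a"
  have c: "c > 0" "1 \<le> c" "c \<le> 9/8" using a by (auto simp: c_def)
  define lp lm where "lp = - (1 - r) / (2 * c)" and "lm = - (1 + r) / (2 * c)"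
  have disc: "1 / (1 + a)\<^sup>2 - 4 * a = (r / (1 + a))\<^sup>2"
    unfolding power_divide r2 b_def using a by (simp add: field_simps)
  have sq: "csqrt (complex_of_real (1 / (1 + a)\<^sup>2 - 4 * a)) = complex_of_real (r / (1 + a))"
    unfolding disc using r a by (subst csqrt_of_real_nonneg) (auto simp: real_sqrt_abs)
  have \<kappa>: "\<kappa> = complex_of_real lp" "\<kappa>' = complex_of_real lm"
  proof -
    have root: "char_root \<sigma> a = complex_of_real ((- 1 / (1 + a) + \<sigma> * (r / (1 + a))) / 2)" for \<sigma>
      unfolding char_root_def sq by simp
    have "(- 1 / c + 1 * (r / c)) / 2 = lp" "(- 1 / c + (- 1) * (r / c)) / 2 = lm"
      unfolding lp_def lm_def using c(1) by (simp_all add: field_simps)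
    then show "\<kappa> = complex_of_real lp" "\<kappa>' = complex_of_real lm"
      unfolding \<kappa>_def \<kappa>'_def root c_def[symmetric] by (simp_all only:)
  qed
  define A1 where "A1 = c / r * (exp (t * lp) - exp (t * lm))"
  define A0 where "A0 = (1 + r) / (2 * r) * exp (t * lp) - (1 - r) / (2 * r) * exp (t * lm)"
  have y_eq: "y = complex_of_real A1 * x1 + complex_of_real A0 * x0"
  proof -
    have d: "lp - lm = r / c"
      unfolding lp_def lm_def using c(1) by (simp add: field_simps)
    have "complex_of_real (lp - lm) * y
       = complex_of_real (exp (t * lp) - exp (t * lm)) * x1 + complex_of_real (lp * exp (t * lm) - lm * exp (t * lp)) * x0"
    proof -
      have ex: "exp (complex_of_real t * complex_of_real c) = complex_of_real (exp (t * c))" for c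
        by (simp add: exp_of_real flip: of_real_mult)
      show ?thesis
        using y unfolding \<kappa> ex by (simp add: algebra_simps)
    qed
    then have "y = complex_of_real (1 / (lp - lm)) * (complex_of_real (exp (t * lp) - exp (t * lm)) * x1 + complex_of_real (lp * exp (t * lm) - lm * exp (t * lp)) * x0)"
    proof -
      have solve: "y = complex_of_real (1 / \<delta>) * z" if "complex_of_real \<delta> * y = z" "\<delta> \<noteq> 0" for \<delta> z
        using that by auto
      have "lp - lm \<noteq> 0" using d r c by simp
      then show "y = complex_of_real (1 / (lp - lm)) * (complex_of_real (exp (t * lp) - exp (t * lm)) * x1 + complex_of_real (lp * exp (t * lm) - lm * exp (t * lp)) * x0)"
        by (rule solve[rotated]) fact
    qed
    also have "\<dots> = complex_of_real (1 / (lp - lm) * (exp (t * lp) - exp (t * lm))) * x1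
        + complex_of_real (1 / (lp - lm) * (lp * exp (t * lm) - lm * exp (t * lp))) * x0"
      by (simp only: of_real_mult distrib_left mult.assoc)
    also have "1 / (lp - lm) * (exp (t * lp) - exp (t * lm)) = A1"
      unfolding d A1_def by simp
    also have "1 / (lp - lm) * (lp * exp (t * lm) - lm * exp (t * lp)) = A0"
      unfolding d A0_def lp_def lm_def using r c by (simp add: field_simps)
    finally show ?thesis .
  qed
  define E where "E = exp (- t * a)"
  have E: "E \<le> exp (- t * a / 2)" unfolding E_def using t a by simp
  have lp_eq: "(1 + r) * lp = - 2 * a * c"
  proof -
    have "(1 + r) * lp = - (1 - r\<^sup>2) / (2 * c)"
      unfolding lp_def using c(1) by (simp add: power2_eq_square field_simps)
    also have "\<dots> = - 2 * a * c"
      unfolding r2 b_def c_def[symmetric] using c(1) by (simp add: power2_eq_square field_simps)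
    finally show ?thesis .
  qed
  have lp_le: "lp \<le> - a"
  proof -
    have "(1 + r) * lp \<le> (1 + r) * (- a)"
      unfolding lp_eq using mult_left_mono[of "1 + r" "2 * c" a] r c a by (simp add: algebra_simps)
    then show ?thesis by (rule mult_left_le_imp_le) (use r in simp)
  qed
  have lp_ge: "- (lp + a) \<le> 8 * a\<^sup>2"
  proof -
    have "(1 + r) * (- (lp + a)) = a * ((1 - r) + 2 * a)"
      using lp_eq by (simp add: algebra_simps c_def)
    also have "\<dots> \<le> a * (8 * a)"
      using r_b b_a a by (intro mult_left_mono) auto
    finally have "(1 + r) * (- (lp + a)) \<le> 8 * a\<^sup>2" by (simp add: power2_eq_square)
    moreover have "1 * (- (lp + a)) \<le> (1 + r) * (- (lp + a))"
      using lp_le r by (intro mult_right_mono) auto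
    ultimately show ?thesis by simp
  qed
  have e1: "exp (t * lp) \<le> E"
    unfolding E_def using mult_left_mono[OF lp_le t] by simp
  have e1': "exp (t * lp) \<le> exp (- t * a / 2)"
    using e1 E by (rule order_trans)
  have e2: "E - exp (t * lp) \<le> 8 * a * exp (- t * a / 2)"
  proof -
    have "E - exp (t * lp) = E * (1 - exp (t * (lp + a)))"
      unfolding E_def by (simp add: algebra_simps flip: exp_add)
    also have "\<dots> \<le> E * (t * (8 * a\<^sup>2))"
    proof (intro mult_left_mono)
      have "1 - exp (t * (lp + a)) \<le> t * (- (lp + a))"
        using exp_ge_add_one_self[of "t * (lp + a)"] unfolding mult_minus_right by linarith
      also have "\<dots> \<le> t * (8 * a\<^sup>2)" using lp_ge t by (intro mult_left_mono)
      finally show "1 - exp (t * (lp + a)) \<le> t * (8 * a\<^sup>2)" .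
    qed (simp add: E_def)
    also have "\<dots> = (8 * a * exp (- t * a / 2)) * ((t * a) * exp (- (t * a) / 2))"
      unfolding E_def by (simp add: power2_eq_square flip: exp_add)
    also have "\<dots> \<le> (8 * a * exp (- t * a / 2)) * 1"
      using mult_exp_half_le[of "t * a"] t a by (intro mult_left_mono) auto
    finally show ?thesis by simp
  qed
  have e3: "exp (t * lm) \<le> exp (- t / 2)"
  proof -
    have "lm \<le> - (1/2)"
      unfolding lm_def using r c by (simp add: field_simps)
    then show ?thesis using mult_left_mono[OF _ t, of lm "- (1/2)"] by simp
  qed
  have d_r: "(1 - r) / (2 * r) \<le> 5 * a" "(1 - r) / (2 * r) \<le> 1" "0 \<le> (1 - r) / (2 * r)"
  proof -
    have "a * (3/5) \<le> a * r" using r a by (intro mult_left_mono) auto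
    then show "(1 - r) / (2 * r) \<le> 5 * a"
      using r r_b b_a by (simp add: divide_le_eq)
    show "(1 - r) / (2 * r) \<le> 1" "0 \<le> (1 - r) / (2 * r)" using r by (auto simp: divide_le_eq)
  qed
  have A1_bound: "\<bar>A1 - E\<bar> \<le> 20 * a * exp (- t * a / 2) + 2 * exp (- t / 2)"
  proof -
    define k where "k = c / r"
    have k: "0 \<le> k - 1" "k - 1 \<le> 12 * a" "k \<le> 2"
    proof -
      have "a * (3/5) \<le> a * r" using r a by (intro mult_left_mono) auto
      then show "k - 1 \<le> 12 * a"
        using r r_b b_a a unfolding k_def c_def by (simp add: field_simps)
      show "0 \<le> k - 1" "k \<le> 2" using r c unfolding k_def by (auto simp: field_simps)
    qed
    have "A1 - E = (k - 1) * exp (t * lp) - (E - exp (t * lp)) - k * exp (t * lm)"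
      unfolding A1_def k_def[symmetric] by (simp add: algebra_simps)
    moreover have "(k - 1) * exp (t * lp) \<le> 12 * a * exp (- t * a / 2)"
      using k e1' a by (intro mult_mono) auto
    moreover have "k * exp (t * lm) \<le> 2 * exp (- t / 2)"
      using k e3 by (intro mult_mono) auto
    moreover have "0 \<le> (k - 1) * exp (t * lp)" "0 \<le> E - exp (t * lp)" "0 \<le> k * exp (t * lm)"
      using k e1 by (auto intro: mult_nonneg_nonneg)
    moreover have "0 \<le> a * exp (- t * a / 2)" using a by simp
    ultimately show ?thesis using e2 by (intro abs_leI) linarith+
  qed
  have A0_bound: "\<bar>A0 - E\<bar> \<le> 20 * a * exp (- t * a / 2) + 2 * exp (- t / 2)"
  proof -
    define k where "k = (1 - r) / (2 * r)"
    have k: "0 \<le> k" "k \<le> 5 * a" "k \<le> 1" using d_r unfolding k_def by auto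
    have "(1 + r) / (2 * r) = k + 1" using r unfolding k_def by (simp add: field_simps)
    then have "A0 - E = k * exp (t * lp) - (E - exp (t * lp)) - k * exp (t * lm)"
      unfolding A0_def k_def[symmetric] by (simp add: algebra_simps)
    moreover have "k * exp (t * lp) \<le> 5 * a * exp (- t * a / 2)"
      using k e1' a by (intro mult_mono) auto
    moreover have "k * exp (t * lm) \<le> 1 * exp (- t / 2)"
      using k e3 by (intro mult_mono) auto
    moreover have "0 \<le> k * exp (t * lp)" "0 \<le> E - exp (t * lp)" "0 \<le> k * exp (t * lm)"
      using k e1 by (auto intro: mult_nonneg_nonneg)
    moreover have "0 \<le> a * exp (- t * a / 2)" "0 \<le> exp (- t / 2)" using a by simp_all
    ultimately show ?thesis using e2 by (intro abs_leI) linarith+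
  qed
  define S where "S = sqrt a * exp (- t * a / 2)"
  have a_sqrt: "a \<le> sqrt a"
  proof -
    have "sqrt a * sqrt a \<le> sqrt a * 1" using a by (intro mult_left_mono) auto
    then show ?thesis using a by simp
  qed
  then have aS: "a * exp (- t * a / 2) \<le> S"
    unfolding S_def by (intro mult_right_mono) auto
  have ES: "E * sqrt a \<le> S" unfolding S_def using E a by (subst mult.commute) (intro mult_left_mono, auto)
  have "y - (p1 + p0) * complex_of_real E
     = complex_of_real (A1 - E) * x1 + complex_of_real (A0 - E) * x0 + complex_of_real E * ((x1 - p1) + (x0 - p0))"
    unfolding y_eq by (simp add: algebra_simps)
  then have "cmod (y - (p1 + p0) * complex_of_real E)
     \<le> cmod (complex_of_real (A1 - E) * x1) + cmod (complex_of_real (A0 - E) * x0) + cmod (complex_of_real E * ((x1 - p1) + (x0 - p0)))"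
    using norm_triangle_ineq[of "complex_of_real (A1 - E) * x1 + complex_of_real (A0 - E) * x0"]
      norm_triangle_ineq[of "complex_of_real (A1 - E) * x1" "complex_of_real (A0 - E) * x0"] by (smt (verit))
  also have "\<dots> \<le> (20 * S + 2 * exp (- t / 2)) * L + (20 * S + 2 * exp (- t / 2)) * L + 2 * S * L"
  proof (intro add_mono)
    show "cmod (complex_of_real (A1 - E) * x1) \<le> (20 * S + 2 * exp (- t / 2)) * L"
      unfolding norm_mult norm_of_real using A1_bound aS x L by (intro mult_mono) (auto simp: mult.assoc)
    show "cmod (complex_of_real (A0 - E) * x0) \<le> (20 * S + 2 * exp (- t / 2)) * L"
      unfolding norm_mult norm_of_real using A0_bound aS x L by (intro mult_mono) (auto simp: mult.assoc)
    have "cmod ((x1 - p1) + (x0 - p0)) \<le> 2 * (sqrt a * L)"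
      using norm_triangle_ineq[of "x1 - p1" "x0 - p0"] p by linarith
    then have "E * cmod ((x1 - p1) + (x0 - p0)) \<le> E * (2 * (sqrt a * L))"
      by (intro mult_left_mono) (auto simp: E_def)
    also have "\<dots> = 2 * (E * sqrt a) * L" by simp
    also have "\<dots> \<le> 2 * S * L" using ES L by (intro mult_right_mono mult_left_mono) auto
    finally show "cmod (complex_of_real E * ((x1 - p1) + (x0 - p0))) \<le> 2 * S * L"
      unfolding norm_mult norm_of_real by (simp add: E_def)
  qed
  also have "\<dots> \<le> 42 * L * (S + exp (- t / 2))"
    using L by (simp add: algebra_simps)
  finally show ?thesis unfolding E_def S_def .
qed

section \<open>Pointwise bounds at high frequencies\<close>

text \<open>The mean value inequality on a half plane on which the exponential function is bounded.\<close>

lemma cmod_exp_diff_le: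
  assumes "Re z \<le> M" "Re w \<le> M"
  shows "cmod (exp z - exp w) \<le> exp M * cmod (z - w)"
proof (rule field_differentiable_bound)
  show "convex {z. Re z \<le> M}" by (rule convex_halfspace_Re_le)
  show "(exp has_field_derivative exp x) (at x within {z. Re z \<le> M})" for x
    by (rule DERIV_subset[OF DERIV_exp]) simp
qed (use assms in auto)

lemma char_root_high_frequency:
  fixes a :: real
  assumes a: "a \<ge> 1/8" and \<sigma>: "\<sigma> = 1 \<or> \<sigma> = - 1"
  shows "Re (char_root \<sigma> a) \<le> - (1 / (1 + a)) / 8"
    and "a \<le> 1 \<Longrightarrow> cmod (char_root \<sigma> a) \<le> 1"
    and "a \<ge> 1 \<Longrightarrow> Re (char_root \<sigma> a) \<le> - (1 / (1 + a)) / 2"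
    and "a \<ge> 1 \<Longrightarrow> cmod (char_root \<sigma> a) = sqrt a"
proof -
  define q where "q = 1 / (1 + a)"
  have q: "0 < q" "q \<le> 1" using a by (auto simp: q_def)
  have q2: "q\<^sup>2 \<le> 1" using q by (simp add: power_le_one)
  define D where "D = q\<^sup>2 - 4 * a"
  have root: "char_root \<sigma> a = (complex_of_real (- q) + complex_of_real \<sigma> * csqrt (complex_of_real D)) / 2"
    unfolding char_root_def D_def q_def by (simp add: power_divide)
  have *: "Re (char_root \<sigma> a) \<le> - q / 8 \<and> (a \<le> 1 \<longrightarrow> cmod (char_root \<sigma> a) \<le> 1) \<and> (a \<ge> 1 \<longrightarrow> Re (char_root \<sigma> a) \<le> - q / 2 \<and> cmod (char_root \<sigma> a) = sqrt a)"
  proof (cases "D \<ge> 0")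
    case True
    define s where "s = sqrt D"
    have "s\<^sup>2 = D" using True by (simp add: s_def)
    also have "D \<le> (3/4 * q)\<^sup>2"
    proof -
      have "(3/4 * q)\<^sup>2 = 9/16 * q\<^sup>2" by (simp add: power2_eq_square)
      then show ?thesis using a q2 unfolding D_def by linarith
    qed
    finally have s: "s \<le> 3/4 * q"
      by (rule power2_le_imp_le) (use q in simp)
    have s0: "s \<ge> 0" using True by (simp add: s_def)
    have "csqrt (complex_of_real D) = complex_of_real s"
      unfolding s_def using True by (subst csqrt_of_real_nonneg) auto
    then have "char_root \<sigma> a = (complex_of_real (- q) + complex_of_real \<sigma> * complex_of_real s) / 2"
      unfolding root by (simp only:)
    also have "\<dots> = complex_of_real ((- q + \<sigma> * s) / 2)" by simp
    finally have eq: "char_root \<sigma> a = complex_of_real ((- q + \<sigma> * s) / 2)" .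
    have "a < 1" using True a q2 unfolding D_def by simp
    moreover have "\<bar>(- q + \<sigma> * s) / 2\<bar> \<le> 1" "(- q + \<sigma> * s) / 2 \<le> - q / 8" using \<sigma> s s0 q by auto
    ultimately show ?thesis unfolding eq norm_of_real Re_complex_of_real by linarith
  next
    case False
    define s where "s = sqrt (- D)"
    have s2: "s\<^sup>2 = 4 * a - q\<^sup>2" using False by (simp add: s_def D_def)
    have "csqrt (complex_of_real D) = \<i> * complex_of_real s"
      unfolding s_def using False by (subst csqrt_of_real_nonpos) auto
    then have "char_root \<sigma> a = (complex_of_real (- q) + complex_of_real \<sigma> * (\<i> * complex_of_real s)) / 2"
      unfolding root by (simp only:)
    also have "\<dots> = Complex (- q / 2) (\<sigma> * s / 2)" by (simp add: complex_eq_iff)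
    finally have eq: "char_root \<sigma> a = Complex (- q / 2) (\<sigma> * s / 2)" .
    have \<sigma>2: "\<sigma>\<^sup>2 = 1" using \<sigma> by auto
    have "cmod (char_root \<sigma> a) = sqrt ((q\<^sup>2 + \<sigma>\<^sup>2 * s\<^sup>2) / 4)"
      unfolding eq complex_norm by (simp add: power_divide power_mult_distrib add_divide_distrib)
    also have "\<dots> = sqrt a" unfolding s2 \<sigma>2 by simp
    finally show ?thesis using q a by (simp add: eq)
  qed
  then show "Re (char_root \<sigma> a) \<le> - (1 / (1 + a)) / 8" "a \<le> 1 \<Longrightarrow> cmod (char_root \<sigma> a) \<le> 1"
    "a \<ge> 1 \<Longrightarrow> Re (char_root \<sigma> a) \<le> - (1 / (1 + a)) / 2" "a \<ge> 1 \<Longrightarrow> cmod (char_root \<sigma> a) = sqrt a"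
    unfolding q_def by auto
qed

text \<open>
  Here \<open>y = B x1 + A x0\<close>, where \<open>B\<close> is the difference quotient of the exponential between the two roots. For \<open>a \<le> 1\<close> the roots may be
  arbitrarily close to each other; the mean value inequality then costs a factor \<open>t\<close>, which half of the exponential decay absorbs since
  \<open>1 + a\<close> is bounded. For \<open>a \<ge> 1\<close> the distance of the roots is at least \<open>sqrt a\<close>, which is the gain of one derivative for \<open>x1\<close>.
\<close>

lemma high_frequency_bound:
  fixes a t :: real and y x0 x1 :: complex
  defines "\<kappa> \<equiv> char_root 1 a" and "\<kappa>' \<equiv> char_root (- 1) a"
  assumes a: "a \<ge> 1/8" and t: "t \<ge> 0" and ne: "\<kappa> \<noteq> \<kappa>'"
    and sol: "solves_mode a t x0 x1 y"
  shows "cmod y \<le> 64 * exp (- (t / (1 + a)) / 16) * (cmod x1 / sqrt (1 + a) + cmod x0)"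
proof -
  have y: "(\<kappa> - \<kappa>') * y = exp (complex_of_real t * \<kappa>) * (x1 - \<kappa>' * x0) - exp (complex_of_real t * \<kappa>') * (x1 - \<kappa> * x0)"
    using sol unfolding solves_mode_def \<kappa>_def \<kappa>'_def .
  define x where "x = t / (1 + a)"
  have x: "x \<ge> 0" using t a by (simp add: x_def)
  define B where "B = (exp (complex_of_real t * \<kappa>) - exp (complex_of_real t * \<kappa>')) / (\<kappa> - \<kappa>')"
  define A where "A = exp (complex_of_real t * \<kappa>') - \<kappa>' * B"
  have B_eq: "(\<kappa> - \<kappa>') * B = exp (complex_of_real t * \<kappa>) - exp (complex_of_real t * \<kappa>')"
    using ne by (simp add: B_def)
  have "(\<kappa> - \<kappa>') * y = (\<kappa> - \<kappa>') * (B * x1 + A * x0)"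
    using y B_eq unfolding A_def by algebra
  then have y_eq: "y = B * x1 + A * x0" using ne by simp
  have Re: "Re (complex_of_real t * \<kappa>) \<le> - x * c" "Re (complex_of_real t * \<kappa>') \<le> - x * c"
    if "Re \<kappa> \<le> - (1 / (1 + a)) * c" "Re \<kappa>' \<le> - (1 / (1 + a)) * c" for c
    using mult_left_mono[OF that(1) t] mult_left_mono[OF that(2) t] by (simp_all add: x_def)
  have exp_mono: "exp (- x * c) \<le> exp (- x / 16)" if "c \<ge> 1/16" for c
    using mult_left_mono[OF that x] by simp
  have AB: "cmod B * sqrt (1 + a) \<le> 64 * exp (- x / 16) \<and> cmod A \<le> 64 * exp (- x / 16)"
  proof (cases "a \<le> 1")
    case True
    have R: "Re (complex_of_real t * \<kappa>) \<le> - x * (1/8)" "Re (complex_of_real t * \<kappa>') \<le> - x * (1/8)"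
      by (rule Re; use char_root_high_frequency(1)[OF a] in \<open>simp add: \<kappa>_def \<kappa>'_def\<close>)+
    have "cmod (exp (complex_of_real t * \<kappa>) - exp (complex_of_real t * \<kappa>')) \<le> exp (- x * (1/8)) * cmod (complex_of_real t * \<kappa> - complex_of_real t * \<kappa>')"
      by (rule cmod_exp_diff_le[OF R])
    also have "cmod (complex_of_real t * \<kappa> - complex_of_real t * \<kappa>') = t * cmod (\<kappa> - \<kappa>')"
      using t by (simp add: norm_mult flip: right_diff_distrib)
    finally have "cmod B \<le> exp (- x * (1/8)) * t"
      unfolding B_def norm_divide using ne by (simp add: divide_le_eq mult.assoc)
    also have "\<dots> \<le> exp (- x * (1/8)) * (32 * exp (x / 16))"
    proof (intro mult_left_mono)
      have "t * (1 + a) \<le> t * 2" using True t by (intro mult_left_mono) auto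
      then have "t \<le> 2 * x" using a by (simp add: x_def field_simps)
      also have "\<dots> \<le> 32 * exp (x / 16)" using exp_ge_add_one_self[of "x / 16"] by linarith
      finally show "t \<le> 32 * exp (x / 16)" .
    qed simp
    also have "\<dots> = 32 * exp (- x / 16)" by (simp flip: exp_add)
    finally have B: "cmod B \<le> 32 * exp (- x / 16)" .
    have "sqrt (1 + a) \<le> 2" using True a by (intro real_le_lsqrt) auto
    then have B': "cmod B * sqrt (1 + a) \<le> (32 * exp (- x / 16)) * 2" using a by (intro mult_mono B) auto
    have "cmod A \<le> cmod (exp (complex_of_real t * \<kappa>')) + cmod \<kappa>' * cmod B"
      unfolding A_def norm_mult[symmetric] by (rule norm_triangle_ineq4)
    also have "\<dots> \<le> exp (- x / 16) + 1 * (32 * exp (- x / 16))"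
    proof (intro add_mono mult_mono B)
      show "cmod (exp (complex_of_real t * \<kappa>')) \<le> exp (- x / 16)"
        using R(2) exp_mono[of "1/8"] by (simp only: norm_exp_eq_Re) (auto intro: order_trans)
      show "cmod \<kappa>' \<le> 1" unfolding \<kappa>'_def using char_root_high_frequency(2)[OF a _ True] by simp
    qed auto
    finally show ?thesis using B' exp_gt_zero[of "- x / 16"] by linarith
  next
    case False
    then have a1: "a \<ge> 1" by simp
    have R: "Re (complex_of_real t * \<kappa>) \<le> - x * (1/2)" "Re (complex_of_real t * \<kappa>') \<le> - x * (1/2)"
      by (rule Re; use char_root_high_frequency(3)[OF a _ a1] in \<open>simp add: \<kappa>_def \<kappa>'_def\<close>)+
    have e: "cmod (exp (complex_of_real t * \<kappa>)) \<le> exp (- x / 16)" "cmod (exp (complex_of_real t * \<kappa>')) \<le> exp (- x / 16)"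
      using R exp_mono[of "1/2"] by (simp_all only: norm_exp_eq_Re) (auto intro: order_trans)
    have "(cmod (\<kappa> - \<kappa>'))\<^sup>2 = \<bar>1 / (1 + a)\<^sup>2 - 4 * a\<bar>"
      unfolding \<kappa>_def \<kappa>'_def char_root_diff norm_power[symmetric] power2_csqrt by (rule norm_of_real)
    moreover have "1 / (1 + a)\<^sup>2 \<le> 1" using a by (simp add: divide_le_eq_1 one_le_power)
    ultimately have "a \<le> (cmod (\<kappa> - \<kappa>'))\<^sup>2"
      using a1 abs_ge_minus_self[of "1 / (1 + a)\<^sup>2 - 4 * a"] by linarith
    then have "(sqrt a)\<^sup>2 \<le> (cmod (\<kappa> - \<kappa>'))\<^sup>2" using a1 by simp
    then have d: "sqrt a \<le> cmod (\<kappa> - \<kappa>')" by (rule power2_le_imp_le) simp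
    have "cmod B * sqrt a \<le> cmod B * cmod (\<kappa> - \<kappa>')" by (intro mult_left_mono d) simp
    also have "\<dots> = cmod (exp (complex_of_real t * \<kappa>) - exp (complex_of_real t * \<kappa>'))"
      unfolding B_eq[symmetric] norm_mult by simp
    also have "\<dots> \<le> 2 * exp (- x / 16)"
      using norm_triangle_ineq4[of "exp (complex_of_real t * \<kappa>)" "exp (complex_of_real t * \<kappa>')"] e by linarith
    finally have B: "cmod B * sqrt a \<le> 2 * exp (- x / 16)" .
    have "sqrt (1 + a) \<le> sqrt (4 * a)" using a1 by (intro real_sqrt_le_mono) simp
    also have "\<dots> = 2 * sqrt a" by (simp add: real_sqrt_mult)
    finally have "cmod B * sqrt (1 + a) \<le> cmod B * (2 * sqrt a)" by (intro mult_left_mono) auto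
    then have B': "cmod B * sqrt (1 + a) \<le> 4 * exp (- x / 16)" using B by simp
    have "cmod A \<le> cmod (exp (complex_of_real t * \<kappa>')) + cmod \<kappa>' * cmod B"
      unfolding A_def norm_mult[symmetric] by (rule norm_triangle_ineq4)
    also have "cmod \<kappa>' * cmod B = cmod B * sqrt a"
      unfolding \<kappa>'_def using char_root_high_frequency(4)[OF a _ a1] by simp
    finally show ?thesis using B B' e exp_gt_zero[of "- x / 16"] by linarith
  qed
  have "cmod y \<le> cmod B * cmod x1 + cmod A * cmod x0"
    unfolding y_eq norm_mult[symmetric] by (rule norm_triangle_ineq)
  also have "cmod B * cmod x1 = (cmod B * sqrt (1 + a)) * (cmod x1 / sqrt (1 + a))"
    using a by simp
  also have "\<dots> + cmod A * cmod x0 \<le> (64 * exp (- x / 16)) * (cmod x1 / sqrt (1 + a)) + (64 * exp (- x / 16)) * cmod x0"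
    using AB a by (intro add_mono mult_right_mono) auto
  also have "\<dots> = 64 * exp (- x / 16) * (cmod x1 / sqrt (1 + a) + cmod x0)"
    by (simp add: algebra_simps)
  finally show ?thesis by (simp add: x_def)
qed

section \<open>The combined pointwise bound\<close>

text \<open>
  The maximum of \<open>x powr s * exp (- x / 8)\<close> over \<open>x > 0\<close> is this number times \<open>exp (- s)\<close>.
\<close>

definition decay_const :: "real \<Rightarrow> real" where
  "decay_const s = exp (s * ln (8 * s))"

lemma exp_decay_le_powr:
  fixes s x :: real
  assumes s: "s > 0" and x: "x > 0"
  shows "exp (- x / 8) \<le> decay_const s * x powr (- s)"
proof -
  have "ln (x / (8 * s)) \<le> x / (8 * s) - 1"
    using assms by (intro ln_le_minus_one) simp
  then have "s * ln (x / (8 * s)) \<le> s * (x / (8 * s) - 1)"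
    using s by (intro mult_left_mono) auto
  then have "- x / 8 \<le> s * ln (8 * s) + - s * ln x"
    using assms by (simp add: ln_div algebra_simps)
  then have "exp (- x / 8) \<le> exp (s * ln (8 * s) + - s * ln x)" by simp
  also have "\<dots> = decay_const s * x powr (- s)"
    unfolding exp_add powr_def decay_const_def using x by simp
  finally show ?thesis .
qed

definition pointwise_const :: "real \<Rightarrow> real" where
  "pointwise_const l = 4000 + 16384 * decay_const (l + 1)"

lemma pointwise_const_pos: "pointwise_const l > 0"
  unfolding pointwise_const_def decay_const_def by (simp add: add_pos_pos)

text \<open>
  The bounds at low and at high frequencies, each weakened to the sum of both right-hand sides so that one inequality can be
  integrated over all frequencies. The factor \<open>exp (- t / 8) * exp (- a)\<close> collects what decays exponentially in time: it dominates
  \<open>exp (- t)\<close> for \<open>a \<le> 1 / 8\<close> and \<open>exp (- 2 t a)\<close> for \<open>a \<ge> 1 / 8\<close>.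
\<close>

lemma pointwise_square_bound:
  fixes l a t L :: real and x0 x1 p0 p1 y :: complex
  assumes l: "l \<ge> 0" and a: "a \<ge> 0" and t: "t \<ge> 1" and ne: "char_root 1 a \<noteq> char_root (- 1) a"
    and y: "solves_mode a t x0 x1 y"
    and x: "cmod x0 \<le> L" "cmod x1 \<le> L" "cmod p0 \<le> L" "cmod p1 \<le> L"
    and p: "cmod (x0 - p0) \<le> sqrt a * L" "cmod (x1 - p1) \<le> sqrt a * L"
  shows "(cmod (y - (p1 + p0) * complex_of_real (exp (- t * a))))\<^sup>2 \<le>
        pointwise_const l * (L\<^sup>2 * (a * exp (- t * a) + exp (- t / 8) * exp (- a))
          + t powr (- (l + 1)) * ((1 + a) powr l * (cmod x1)\<^sup>2 + (1 + a) powr (l + 1) * (cmod x0)\<^sup>2))"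
proof -
  define C where "C = decay_const (l + 1)"
  have C: "C > 0" "\<And>x. x > 0 \<Longrightarrow> exp (- x / 8) \<le> C * x powr (- (l + 1))"
    unfolding C_def using exp_decay_le_powr[of "l + 1"] l by (simp_all add: decay_const_def)
  define P where "P = L\<^sup>2 * (a * exp (- t * a) + exp (- t / 8) * exp (- a))"
  define Q where "Q = t powr (- (l + 1)) * ((1 + a) powr l * (cmod x1)\<^sup>2 + (1 + a) powr (l + 1) * (cmod x0)\<^sup>2)"
  have PQ: "P \<ge> 0" "Q \<ge> 0" using a by (auto simp: P_def Q_def intro!: mult_nonneg_nonneg add_nonneg_nonneg)
  let ?d = "cmod (y - (p1 + p0) * complex_of_real (exp (- t * a)))"
  have "?d\<^sup>2 \<le> 4000 * P + 16384 * C * Q"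
  proof (cases "a \<le> 1/8")
    case True
    have "?d \<le> 42 * L * (sqrt a * exp (- t * a / 2) + exp (- t / 2))"
      by (rule low_frequency_bound[OF a True _ y x(1,2) p]) (use t in simp)
    then have "?d\<^sup>2 \<le> (42 * L * (sqrt a * exp (- t * a / 2) + exp (- t / 2)))\<^sup>2"
      by (intro power_mono) auto
    also have "\<dots> = 1764 * L\<^sup>2 * (sqrt a * exp (- t * a / 2) + exp (- t / 2))\<^sup>2"
      by (simp add: power_mult_distrib)
    also have "\<dots> \<le> 1764 * L\<^sup>2 * (2 * (a * exp (- t * a)) + 2 * exp (- t))"
    proof (intro mult_left_mono)
      have "(u + v)\<^sup>2 \<le> 2 * u\<^sup>2 + 2 * v\<^sup>2" for u v :: real
        using sum_squares_ge_zero[of "u - v" 0] by (simp add: power2_eq_square algebra_simps)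
      from this[of "sqrt a * exp (- t * a / 2)" "exp (- t / 2)"]
      show "(sqrt a * exp (- t * a / 2) + exp (- t / 2))\<^sup>2 \<le> 2 * (a * exp (- t * a)) + 2 * exp (- t)"
        using a by (simp add: power_mult_distrib exp_double[symmetric])
    qed simp
    also have "\<dots> \<le> 1764 * L\<^sup>2 * (2 * (a * exp (- t * a)) + 2 * (exp (- t / 8) * exp (- a)))"
      using True t a by (intro mult_left_mono add_mono) (auto simp flip: exp_add)
    also have "\<dots> = 3528 * P" by (simp add: P_def algebra_simps)
    also have "\<dots> \<le> 4000 * P + 16384 * C * Q" using PQ C(1) by (simp add: add_increasing2)
    finally show ?thesis .
  next
    case False
    then have a8: "a \<ge> 1/8" by simp
    have L: "L \<ge> 0" using x(1) norm_ge_zero[of x0] by linarith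
    define X where "X = t / (1 + a)"
    have X: "X > 0" using t a by (simp add: X_def)
    have "cmod y \<le> 64 * exp (- X / 16) * (cmod x1 / sqrt (1 + a) + cmod x0)"
      using high_frequency_bound[OF a8 _ ne y] t by (simp add: X_def)
    then have "(cmod y)\<^sup>2 \<le> (64 * exp (- X / 16) * (cmod x1 / sqrt (1 + a) + cmod x0))\<^sup>2"
      by (intro power_mono) auto
    also have "\<dots> = 4096 * exp (- X / 8) * (cmod x1 / sqrt (1 + a) + cmod x0)\<^sup>2"
      by (simp add: power_mult_distrib exp_double[symmetric])
    also have "\<dots> \<le> 4096 * (C * X powr (- (l + 1))) * (2 * ((cmod x1)\<^sup>2 / (1 + a)) + 2 * (cmod x0)\<^sup>2)"
    proof (intro mult_mono mult_left_mono C(2) X)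
      have "(u + v)\<^sup>2 \<le> 2 * u\<^sup>2 + 2 * v\<^sup>2" for u v :: real
        using sum_squares_ge_zero[of "u - v" 0] by (simp add: power2_eq_square algebra_simps)
      from this[of "cmod x1 / sqrt (1 + a)" "cmod x0"]
      show "(cmod x1 / sqrt (1 + a) + cmod x0)\<^sup>2 \<le> 2 * ((cmod x1)\<^sup>2 / (1 + a)) + 2 * (cmod x0)\<^sup>2"
        using a by (simp add: power_divide)
    qed (use C(1) in auto)
    also have "X powr (- (l + 1)) = t powr (- (l + 1)) * (1 + a) powr (l + 1)"
    proof -
      have "X powr (- (l + 1)) = t powr (- (l + 1)) / (1 + a) powr (- (l + 1))"
        unfolding X_def by (rule powr_divide)
      also have "(1 + a) powr (- (l + 1)) = 1 / (1 + a) powr (l + 1)"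
        by (rule powr_minus_divide)
      finally show ?thesis by simp
    qed
    also have "4096 * (C * (t powr (- (l + 1)) * (1 + a) powr (l + 1))) * (2 * ((cmod x1)\<^sup>2 / (1 + a)) + 2 * (cmod x0)\<^sup>2)
       = 8192 * C * Q"
      unfolding Q_def using a by (simp add: powr_add field_simps)
    finally have y2: "(cmod y)\<^sup>2 \<le> 8192 * C * Q" .
    let ?p = "- (p1 + p0) * complex_of_real (exp (- t * a))"
    have "cmod ?p \<le> 2 * L * exp (- t * a)"
      unfolding norm_mult norm_minus_cancel using norm_triangle_ineq[of p1 p0] x L by (intro mult_mono) auto
    then have "(cmod ?p)\<^sup>2 \<le> (2 * L * exp (- t * a))\<^sup>2" by (intro power_mono) auto
    also have "\<dots> = 4 * (L\<^sup>2 * exp (- 2 * t * a))" by (simp add: power_mult_distrib exp_double[symmetric])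
    also have "\<dots> \<le> 4 * (L\<^sup>2 * (a * exp (- t * a) + exp (- t / 8) * exp (- a)))"
    proof (intro mult_left_mono)
      have "t * (1/8) \<le> t * a" "1 * a \<le> t * a" using a8 t by (intro mult_left_mono mult_right_mono; simp)+
      then have "exp (- 2 * t * a) \<le> exp (- t / 8) * exp (- a)"
        by (simp flip: exp_add)
      then show "exp (- 2 * t * a) \<le> a * exp (- t * a) + exp (- t / 8) * exp (- a)"
        using a by (simp add: add_increasing)
    qed auto
    finally have p2: "(cmod ?p)\<^sup>2 \<le> 4 * P" by (simp add: P_def)
    have "?d\<^sup>2 \<le> 2 * (cmod y)\<^sup>2 + 2 * (cmod ?p)\<^sup>2"
      using cmod_add_square_le[of y ?p] by (simp only: mult_minus_left add_uminus_conv_diff)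
    also have "\<dots> \<le> 4000 * P + 16384 * C * Q"
      using y2 p2 PQ by simp
    finally show ?thesis .
  qed
  also have "\<dots> \<le> (4000 + 16384 * C) * (P + Q)"
    using PQ C(1) by (simp add: algebra_simps)
  finally show ?thesis unfolding P_def Q_def C_def pointwise_const_def .
qed

section \<open>Integration over the frequencies\<close>

lemma L11_norm_nonneg: "L11_norm f \<ge> 0"
  unfolding L11_norm_def by (intro integral_nonneg_AE) auto

lemma H_norm_nonneg: "H_norm s f \<ge> 0"
  unfolding H_norm_def by (intro real_sqrt_ge_zero integral_nonneg_AE) auto

lemma data_norm_nonneg: "data_norm l u\<^sub>0 u\<^sub>1 \<ge> 0"
  unfolding data_norm_def by (intro add_nonneg_nonneg H_norm_nonneg L11_norm_nonneg)

lemma L11_norm_ge: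
  assumes "f \<in> L11_space"
  shows "(LINT x|lborel. cmod (f x)) \<le> L11_norm f"
  unfolding L11_norm_def
  using assms by (intro integral_mono) (auto simp: L11_space_def mult_le_cancel_right1)

lemma cmod_total_mass_le:
  assumes "f \<in> L11_space"
  shows "cmod (total_mass f) \<le> L11_norm f"
  unfolding total_mass_def using order_trans[OF integral_norm_bound L11_norm_ge[OF assms]] .

text \<open>The bound \<open>\<bar>exp (- \<i> \<theta>) - 1\<bar> \<le> \<bar>\<theta>\<bar>\<close> produces the weight \<open>\<bar>x\<bar>\<close> of the first moment.\<close>

lemma fourier_L1_diff_total_mass:
  assumes "f \<in> L11_space"
  shows "cmod (fourier_L1 f \<xi> - total_mass f) \<le> norm \<xi> * L11_norm f"
proof -
  have int: "integrable lborel f" and int': "integrable lborel (\<lambda>x. (1 + norm x) * cmod (f x))"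
    using assms by (auto simp: L11_space_def)
  have "fourier_L1 f \<xi> - total_mass f = (LINT x|lborel. f x * wave \<xi> x - f x)"
    unfolding fourier_L1_def total_mass_def
    by (rule Bochner_Integration.integral_diff[symmetric, OF fourier_L1_integrable[OF int] int])
  also have "cmod \<dots> \<le> (LINT x|lborel. norm \<xi> * ((1 + norm x) * cmod (f x)))"
  proof (rule order_trans[OF integral_norm_bound], rule integral_mono)
    show "integrable lborel (\<lambda>x. cmod (f x * wave \<xi> x - f x))"
      by (intro integrable_norm Bochner_Integration.integrable_diff fourier_L1_integrable int)
    show "integrable lborel (\<lambda>x. norm \<xi> * ((1 + norm x) * cmod (f x)))"
      using int' by (rule integrable_mult_right)
    fix x
    have "cmod (wave \<xi> x - exp 0) \<le> exp 0 * cmod (- \<i> * complex_of_real (\<xi> \<bullet> x) - 0)"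
      by (rule cmod_exp_diff_le) auto
    also have "\<dots> = \<bar>\<xi> \<bullet> x\<bar>" by (simp add: norm_mult)
    also have "\<dots> \<le> norm \<xi> * norm x" by (rule Cauchy_Schwarz_ineq2)
    also have "\<dots> \<le> norm \<xi> * (1 + norm x)" by (intro mult_left_mono) auto
    finally have "cmod (f x) * cmod (wave \<xi> x - 1) \<le> cmod (f x) * (norm \<xi> * (1 + norm x))"
      by (intro mult_left_mono) auto
    moreover have "f x * wave \<xi> x - f x = f x * (wave \<xi> x - 1)"
      by (simp add: right_diff_distrib)
    ultimately show "cmod (f x * wave \<xi> x - f x) \<le> norm \<xi> * ((1 + norm x) * cmod (f x))"
      by (simp only: norm_mult mult_ac)
  qed
  also have "\<dots> = norm \<xi> * L11_norm f"
    unfolding L11_norm_def by simp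
  finally show ?thesis .
qed

text \<open>
  The roots coincide if and only if \<open>4 a (1 + a)\<^sup>2 = 1\<close>. The left-hand side increases with \<open>a\<close>, so the exceptional
  frequencies lie on a single sphere.
\<close>

lemma AE_char_roots_distinct:
  "AE \<xi> :: real ^ 'n::finite in lborel. char_root 1 ((norm \<xi>)\<^sup>2) \<noteq> char_root (- 1) ((norm \<xi>)\<^sup>2)"
proof -
  let ?E = "{\<xi> :: real ^ 'n. char_root 1 ((norm \<xi>)\<^sup>2) = char_root (- 1) ((norm \<xi>)\<^sup>2)}"
  have mono: "4 * a * (1 + a)\<^sup>2 < 4 * b * (1 + b)\<^sup>2" if "0 \<le> a" "a < b" for a b :: real
  proof -
    have "4 * a * (1 + a)\<^sup>2 \<le> 4 * a * (1 + b)\<^sup>2"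
      using that by (intro mult_left_mono power_mono) auto
    also have "\<dots> < 4 * b * (1 + b)\<^sup>2"
      using that by (intro mult_strict_right_mono) auto
    finally show ?thesis .
  qed
  have eq: "4 * (norm \<xi>)\<^sup>2 * (1 + (norm \<xi>)\<^sup>2)\<^sup>2 = 1" if "\<xi> \<in> ?E" for \<xi>
  proof -
    have "csqrt (complex_of_real (1 / (1 + (norm \<xi>)\<^sup>2)\<^sup>2 - 4 * (norm \<xi>)\<^sup>2)) = 0"
      using that unfolding char_root_diff[symmetric] by simp
    then have "1 / (1 + (norm \<xi>)\<^sup>2)\<^sup>2 = 4 * (norm \<xi>)\<^sup>2"
      unfolding csqrt_eq_0 of_real_eq_0_iff by simp
    moreover have "(1 + (norm \<xi>)\<^sup>2)\<^sup>2 > 0" by (intro zero_less_power add_pos_nonneg) auto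
    ultimately show ?thesis by (metis nonzero_eq_divide_eq less_irrefl)
  qed
  obtain \<rho> where "?E \<subseteq> sphere 0 \<rho>"
  proof (cases "?E = {}")
    case True
    then show ?thesis by (intro that[of 0]) (simp only: True empty_subsetI)
  next
    case False
    then obtain \<xi>0 where \<xi>0: "\<xi>0 \<in> ?E" by blast
    have "norm \<xi> = norm \<xi>0" if "\<xi> \<in> ?E" for \<xi>
    proof -
      have "(norm \<xi>)\<^sup>2 = (norm \<xi>0)\<^sup>2"
        using eq[OF that] eq[OF \<xi>0] mono[of "(norm \<xi>)\<^sup>2" "(norm \<xi>0)\<^sup>2"] mono[of "(norm \<xi>0)\<^sup>2" "(norm \<xi>)\<^sup>2"]
        by (metis less_irrefl linorder_neqE_linordered_idom zero_le_power2)
      then show ?thesis by (rule power2_eq_imp_eq) auto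
    qed
    then show ?thesis by (intro that[of "norm \<xi>0"]) auto
  qed
  moreover have "sphere 0 \<rho> \<in> null_sets (lborel :: (real ^ 'n) measure)"
    using negligible_sphere[of 0 \<rho>]
    by (auto simp: null_sets_completion_iff negligible_iff_null_sets negligible_convex_frontier)
  ultimately show ?thesis
    by (intro AE_I'[of "sphere 0 \<rho>"]) auto
qed

text \<open>Since \<open>s exp (- s / 2) \<le> 1\<close> for \<open>s = t \<bar>\<xi>\<bar>\<^sup>2\<close>, the integrand is at most \<open>exp (- t \<bar>\<xi>\<bar>\<^sup>2 / 2) / t\<close>.\<close>

lemma nn_integral_square_gauss_le:
  fixes t :: real
  assumes t: "t \<ge> 1"
  shows "(\<integral>\<^sup>+\<xi>. ennreal ((norm (\<xi> :: real ^ 'n::finite))\<^sup>2 * exp (- t * (norm \<xi>)\<^sup>2)) \<partial>lborel)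
     \<le> ennreal (sqrt (2 * pi) ^ CARD('n) * t powr (- (real CARD('n) + 2) / 2))"
proof -
  have "(\<integral>\<^sup>+\<xi>. ennreal ((norm (\<xi> :: real ^ 'n))\<^sup>2 * exp (- t * (norm \<xi>)\<^sup>2)) \<partial>lborel)
     \<le> (\<integral>\<^sup>+\<xi>. ennreal (1 / t) * ennreal (cmod (gauss (t / 2) (\<xi> :: real ^ 'n))) \<partial>lborel)"
  proof (intro nn_integral_mono)
    fix \<xi> :: "real ^ 'n"
    have "t * (norm \<xi>)\<^sup>2 * exp (- (t * (norm \<xi>)\<^sup>2) / 2) \<le> 1"
      using t by (intro mult_exp_half_le) auto
    then have "t * (norm \<xi>)\<^sup>2 * exp (- (t * (norm \<xi>)\<^sup>2) / 2) * exp (- (t * (norm \<xi>)\<^sup>2) / 2) \<le> 1 * exp (- (t * (norm \<xi>)\<^sup>2) / 2)"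
      by (rule mult_right_mono) simp
    then have "(norm \<xi>)\<^sup>2 * exp (- t * (norm \<xi>)\<^sup>2) \<le> 1 / t * exp (- (t / 2) * (norm \<xi>)\<^sup>2)"
      using t by (simp add: field_simps flip: exp_add)
    then have "ennreal ((norm \<xi>)\<^sup>2 * exp (- t * (norm \<xi>)\<^sup>2)) \<le> ennreal (1 / t * cmod (gauss (t / 2) \<xi>))"
      by (intro ennreal_leI) (simp add: gauss_def)
    also have "\<dots> = ennreal (1 / t) * ennreal (cmod (gauss (t / 2) \<xi>))"
      using t by (intro ennreal_mult) auto
    finally show "ennreal ((norm \<xi>)\<^sup>2 * exp (- t * (norm \<xi>)\<^sup>2)) \<le> \<dots>" .
  qed
  also have "\<dots> = ennreal (1 / t * sqrt (pi / (t / 2)) ^ CARD('n))"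
    using t by (subst nn_integral_cmult, measurable, subst nn_integral_gauss, simp) (rule ennreal_mult[symmetric], auto)
  also have "1 / t * sqrt (pi / (t / 2)) ^ CARD('n) = sqrt (2 * pi) ^ CARD('n) * t powr (- (real CARD('n) + 2) / 2)"
  proof -
    have "sqrt (pi / (t / 2)) ^ CARD('n) = sqrt (2 * pi) ^ CARD('n) * (1 / sqrt t) ^ CARD('n)"
      unfolding power_mult_distrib[symmetric] real_sqrt_divide[symmetric] by (simp add: real_sqrt_divide mult.commute)
    also have "(1 / sqrt t) ^ CARD('n) = t powr (- real CARD('n) / 2)"
    proof -
      have "1 / sqrt t = t powr (- (1/2))"
        using t by (simp only: powr_minus_divide powr_half_sqrt)
      moreover have "(t powr (- (1/2))) ^ CARD('n) = (t powr (- (1/2))) powr real CARD('n)"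
        using t by (intro powr_realpow[symmetric]) simp
      ultimately show ?thesis by (simp add: powr_powr)
    qed
    finally have 1: "sqrt (pi / (t / 2)) ^ CARD('n) = sqrt (2 * pi) ^ CARD('n) * t powr (- real CARD('n) / 2)" .
    have 2: "1 / t = t powr (- 1)"
      using t by (simp add: powr_minus divide_inverse)
    have "t powr (- 1) * t powr (- real CARD('n) / 2) = t powr (- (real CARD('n) + 2) / 2)"
    proof -
      have "- 1 + - real CARD('n) / 2 = - (real CARD('n) + 2) / 2" by simp
      then show ?thesis by (simp only: powr_add[symmetric])
    qed
    then show ?thesis
      unfolding 1 2 by (simp only: mult.left_commute[of "t powr (- 1)"])
  qed
  finally show ?thesis .
qed

definition profile_error ::
    "(real ^ 'n::finite \<Rightarrow> complex) \<Rightarrow> (real ^ 'n \<Rightarrow> complex) \<Rightarrow> (real \<Rightarrow> real ^ 'n \<Rightarrow> complex) \<Rightarrow> real \<Rightarrow> real ^ 'n \<Rightarrow> complex" where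
  "profile_error u\<^sub>0 u\<^sub>1 u t =
     (\<lambda>\<xi>. fourier (u t) \<xi> - (total_mass u\<^sub>1 + total_mass u\<^sub>0) * complex_of_real (exp (- t * (norm \<xi>)\<^sup>2)))"

definition error_const :: "nat \<Rightarrow> real \<Rightarrow> real" where
  "error_const n l = pointwise_const l *
     (sqrt (2 * pi) ^ n + decay_const ((real n + 2) / 2) * sqrt pi ^ n + 1)"

lemma error_const_pos: "error_const n l > 0"
  unfolding error_const_def decay_const_def
  by (intro mult_pos_pos add_pos_pos pointwise_const_pos) auto

lemma sqnorm_profile_error:
  fixes u\<^sub>0 u\<^sub>1 :: "real ^ 'n::finite \<Rightarrow> complex" and l t :: real
  assumes l: "l \<ge> 0" and u0: "u\<^sub>0 \<in> H_space (l + 1) \<inter> L11_space" and u1: "u\<^sub>1 \<in> H_space l \<inter> L11_space"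
    and sol: "X2_solution u\<^sub>0 u\<^sub>1 u" and t: "t \<ge> 1"
  shows "sqnorm (profile_error u\<^sub>0 u\<^sub>1 u t) \<le>
    ennreal (error_const CARD('n) l * (data_norm l u\<^sub>0 u\<^sub>1)\<^sup>2 * (t powr (- (real CARD('n) + 2) / 2) + t powr (- (l + 1))))"
proof -
  define K where "K = pointwise_const l"
  define C' where "C' = decay_const ((real CARD('n) + 2) / 2)"
  define G where "G = sqrt (2 * pi) ^ CARD('n) + C' * sqrt pi ^ CARD('n)"
  have K: "K > 0" unfolding K_def by (rule pointwise_const_pos)
  have C': "C' > 0" by (simp add: C'_def decay_const_def)
  then have G: "G > 0" unfolding G_def by (intro add_pos_pos mult_pos_pos) auto
  define L where "L = L11_norm u\<^sub>1 + L11_norm u\<^sub>0"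
  have F0: "has_fourier_L2 u\<^sub>0 (fourier u\<^sub>0)" and F1: "has_fourier_L2 u\<^sub>1 (fourier u\<^sub>1)"
    using u0 u1 by (auto intro: H_space_has_fourier)
  have L1: "L11_norm u\<^sub>0 \<le> L" "L11_norm u\<^sub>1 \<le> L" and L: "L \<ge> 0"
    unfolding L_def using L11_norm_nonneg[of u\<^sub>0] L11_norm_nonneg[of u\<^sub>1] by auto
  have m: "u\<^sub>0 \<in> borel_measurable borel" "u\<^sub>1 \<in> borel_measurable borel"
    using F0 F1 by (auto simp: has_fourier_L2_iff L2_space_iff)
  have [measurable]: "fourier u\<^sub>0 \<in> borel_measurable borel" "fourier u\<^sub>1 \<in> borel_measurable borel"
    using F0 F1 by (auto simp: has_fourier_L2_iff L2_space_iff)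
  have t0: "0 \<le> t" using t by simp
  have int: "integrable lborel u\<^sub>0" "integrable lborel u\<^sub>1"
    using u0 u1 by (auto simp: L11_space_def)
  let ?D = "\<lambda>\<xi>. fourier (u t) \<xi> - (total_mass u\<^sub>1 + total_mass u\<^sub>0) * complex_of_real (exp (- t * (norm \<xi>)\<^sup>2))"
  let ?w0 = "\<lambda>\<xi>. (1 + (norm \<xi>)\<^sup>2) powr (l + 1) * (cmod (fourier u\<^sub>0 \<xi>))\<^sup>2"
  let ?w1 = "\<lambda>\<xi>. (1 + (norm \<xi>)\<^sup>2) powr l * (cmod (fourier u\<^sub>1 \<xi>))\<^sup>2"
  let ?g = "\<lambda>\<xi> :: real ^ 'n. (norm \<xi>)\<^sup>2 * exp (- t * (norm \<xi>)\<^sup>2)"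
  let ?T = "t powr (- (l + 1))" and ?S = "t powr (- (real CARD('n) + 2) / 2)"
  have "AE \<xi> in lborel. ennreal ((cmod (?D \<xi>))\<^sup>2) \<le>
      ennreal (K * L\<^sup>2) * ennreal (?g \<xi>) + ennreal (K * L\<^sup>2 * exp (- t / 8)) * ennreal (cmod (gauss 1 \<xi>))
      + ennreal (K * ?T) * ennreal (?w1 \<xi>) + ennreal (K * ?T) * ennreal (?w0 \<xi>)"
    using AE_char_roots_distinct X2_solution_fourier_formula(2)[OF sol m t0]
      has_fourier_L2_eq_fourier_L1[OF F0 int(1)] has_fourier_L2_eq_fourier_L1[OF F1 int(2)]
  proof eventually_elim
    fix \<xi> :: "real ^ 'n"
    assume ne: "char_root 1 ((norm \<xi>)\<^sup>2) \<noteq> char_root (- 1) ((norm \<xi>)\<^sup>2)"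
      and form: "solves_mode ((norm \<xi>)\<^sup>2) t (fourier u\<^sub>0 \<xi>) (fourier u\<^sub>1 \<xi>) (fourier (u t) \<xi>)"
      and e: "fourier u\<^sub>0 \<xi> = fourier_L1 u\<^sub>0 \<xi>" "fourier u\<^sub>1 \<xi> = fourier_L1 u\<^sub>1 \<xi>"
    have 1: "cmod (fourier u\<^sub>0 \<xi>) \<le> L" "cmod (fourier u\<^sub>1 \<xi>) \<le> L"
      unfolding e using order_trans[OF fourier_L1_bound L11_norm_ge] u0 u1 L1 by (meson IntD2 order_trans)+
    have 2: "cmod (total_mass u\<^sub>0) \<le> L" "cmod (total_mass u\<^sub>1) \<le> L"
      using cmod_total_mass_le u0 u1 L1 by (meson IntD2 order_trans)+
    have 3: "cmod (fourier u\<^sub>0 \<xi> - total_mass u\<^sub>0) \<le> sqrt ((norm \<xi>)\<^sup>2) * L"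
      using order_trans[OF fourier_L1_diff_total_mass[of u\<^sub>0 \<xi>] mult_left_mono[OF L1(1) norm_ge_zero]] u0 e by simp
    have 4: "cmod (fourier u\<^sub>1 \<xi> - total_mass u\<^sub>1) \<le> sqrt ((norm \<xi>)\<^sup>2) * L"
      using order_trans[OF fourier_L1_diff_total_mass[of u\<^sub>1 \<xi>] mult_left_mono[OF L1(2) norm_ge_zero]] u1 e by simp
    have "ennreal ((cmod (?D \<xi>))\<^sup>2) \<le> ennreal (K * (L\<^sup>2 * (?g \<xi> + exp (- t / 8) * exp (- (norm \<xi>)\<^sup>2)) + ?T * (?w1 \<xi> + ?w0 \<xi>)))"
      by (rule ennreal_leI, unfold K_def, rule pointwise_square_bound[OF l _ t ne form 1 2 3 4]) simp
    also have "K * (L\<^sup>2 * (?g \<xi> + exp (- t / 8) * exp (- (norm \<xi>)\<^sup>2)) + ?T * (?w1 \<xi> + ?w0 \<xi>))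
       = K * L\<^sup>2 * ?g \<xi> + K * L\<^sup>2 * exp (- t / 8) * cmod (gauss 1 \<xi>) + K * ?T * ?w1 \<xi> + K * ?T * ?w0 \<xi>"
      by (simp add: gauss_def algebra_simps)
    also have "ennreal \<dots> = ennreal (K * L\<^sup>2) * ennreal (?g \<xi>) + ennreal (K * L\<^sup>2 * exp (- t / 8)) * ennreal (cmod (gauss 1 \<xi>))
      + ennreal (K * ?T) * ennreal (?w1 \<xi>) + ennreal (K * ?T) * ennreal (?w0 \<xi>)"
      using K by (simp only: ennreal_plus[symmetric] ennreal_mult[symmetric] mult_nonneg_nonneg add_nonneg_nonneg
          less_imp_le zero_le_power2 exp_ge_zero norm_ge_zero powr_ge_zero)
    finally show "ennreal ((cmod (?D \<xi>))\<^sup>2) \<le> \<dots>" .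
  qed
  then have "sqnorm ?D \<le> (\<integral>\<^sup>+\<xi>. ennreal (K * L\<^sup>2) * ennreal (?g \<xi>) + ennreal (K * L\<^sup>2 * exp (- t / 8)) * ennreal (cmod (gauss 1 \<xi>))
      + ennreal (K * ?T) * ennreal (?w1 \<xi>) + ennreal (K * ?T) * ennreal (?w0 \<xi>) \<partial>lborel)"
    unfolding sqnorm_def by (rule nn_integral_mono_AE)
  also have "\<dots> = ennreal (K * L\<^sup>2) * (\<integral>\<^sup>+\<xi>. ennreal (?g \<xi>) \<partial>lborel)
      + ennreal (K * L\<^sup>2 * exp (- t / 8)) * (\<integral>\<^sup>+\<xi>. ennreal (cmod (gauss 1 (\<xi> :: real ^ 'n))) \<partial>lborel)
      + ennreal (K * ?T) * (\<integral>\<^sup>+\<xi>. ennreal (?w1 \<xi>) \<partial>lborel) + ennreal (K * ?T) * (\<integral>\<^sup>+\<xi>. ennreal (?w0 \<xi>) \<partial>lborel)"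
    by (simp add: nn_integral_add nn_integral_cmult)
  also have "\<dots> \<le> ennreal (K * L\<^sup>2) * ennreal (sqrt (2 * pi) ^ CARD('n) * ?S)
      + ennreal (K * L\<^sup>2 * exp (- t / 8)) * ennreal (sqrt pi ^ CARD('n))
      + ennreal (K * ?T) * ennreal ((H_norm l u\<^sub>1)\<^sup>2) + ennreal (K * ?T) * ennreal ((H_norm (l + 1) u\<^sub>0)\<^sup>2)"
  proof (intro add_mono mult_left_mono)
    show "(\<integral>\<^sup>+\<xi>. ennreal (?g \<xi>) \<partial>lborel) \<le> ennreal (sqrt (2 * pi) ^ CARD('n) * ?S)"
      by (rule nn_integral_square_gauss_le[OF t])
    show "(\<integral>\<^sup>+\<xi>. ennreal (cmod (gauss 1 (\<xi> :: real ^ 'n))) \<partial>lborel) \<le> ennreal (sqrt pi ^ CARD('n))"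
      by (simp add: nn_integral_gauss)
    show "(\<integral>\<^sup>+\<xi>. ennreal (?w1 \<xi>) \<partial>lborel) \<le> ennreal ((H_norm l u\<^sub>1)\<^sup>2)"
      using u1 by (simp add: nn_integral_H_norm)
    show "(\<integral>\<^sup>+\<xi>. ennreal (?w0 \<xi>) \<partial>lborel) \<le> ennreal ((H_norm (l + 1) u\<^sub>0)\<^sup>2)"
      using u0 by (simp add: nn_integral_H_norm)
  qed auto
  also have "\<dots> = ennreal (K * L\<^sup>2 * (sqrt (2 * pi) ^ CARD('n) * ?S) + K * L\<^sup>2 * exp (- t / 8) * sqrt pi ^ CARD('n)
      + K * ?T * (H_norm l u\<^sub>1)\<^sup>2 + K * ?T * (H_norm (l + 1) u\<^sub>0)\<^sup>2)"
    using K by (simp add: ennreal_plus[symmetric] ennreal_mult[symmetric] del: ennreal_plus)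
  also have "\<dots> \<le> ennreal (K * (G + 1) * (data_norm l u\<^sub>0 u\<^sub>1)\<^sup>2 * (?S + ?T))"
  proof (rule ennreal_leI)
    define I where "I = data_norm l u\<^sub>0 u\<^sub>1"
    define h1 h0 where "h1 = H_norm l u\<^sub>1" and "h0 = H_norm (l + 1) u\<^sub>0"
    have h: "h1 \<ge> 0" "h0 \<ge> 0" by (auto simp: h1_def h0_def H_norm_nonneg)
    have I: "I = h1 + h0 + L" by (simp add: I_def data_norm_def h1_def h0_def L_def)
    have LI: "L\<^sup>2 \<le> I\<^sup>2" unfolding I using L h by (intro power_mono) auto
    have hI: "h1\<^sup>2 + h0\<^sup>2 \<le> I\<^sup>2"
    proof -
      have "h1\<^sup>2 + h0\<^sup>2 \<le> (h1 + h0)\<^sup>2" using h by (simp add: power2_sum)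
      also have "\<dots> \<le> I\<^sup>2" unfolding I using L h by (intro power_mono) auto
      finally show ?thesis .
    qed
    have "exp (- t / 8) \<le> C' * ?S"
      using exp_decay_le_powr[of "(real CARD('n) + 2) / 2" t] t unfolding C'_def minus_divide_left by simp
    then have "exp (- t / 8) * sqrt pi ^ CARD('n) \<le> C' * ?S * sqrt pi ^ CARD('n)"
      by (intro mult_right_mono) auto
    then have "sqrt (2 * pi) ^ CARD('n) * ?S + exp (- t / 8) * sqrt pi ^ CARD('n) \<le> G * ?S"
      unfolding G_def by (simp add: algebra_simps)
    then have "L\<^sup>2 * (sqrt (2 * pi) ^ CARD('n) * ?S + exp (- t / 8) * sqrt pi ^ CARD('n)) \<le> I\<^sup>2 * (G * ?S)"
      using LI by (intro mult_mono) auto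
    moreover have "?T * (h1\<^sup>2 + h0\<^sup>2) \<le> ?T * I\<^sup>2" using hI by (intro mult_left_mono) auto
    ultimately have "L\<^sup>2 * (sqrt (2 * pi) ^ CARD('n) * ?S + exp (- t / 8) * sqrt pi ^ CARD('n)) + ?T * (h1\<^sup>2 + h0\<^sup>2)
        \<le> I\<^sup>2 * (G * ?S) + ?T * I\<^sup>2"
      by (rule add_mono)
    also have "\<dots> \<le> (G + 1) * I\<^sup>2 * (?S + ?T)"
      using G by (simp add: algebra_simps)
    finally have "K * (L\<^sup>2 * (sqrt (2 * pi) ^ CARD('n) * ?S + exp (- t / 8) * sqrt pi ^ CARD('n)) + ?T * (h1\<^sup>2 + h0\<^sup>2))
        \<le> K * ((G + 1) * I\<^sup>2 * (?S + ?T))"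
      using K by (intro mult_left_mono) auto
    then show "K * L\<^sup>2 * (sqrt (2 * pi) ^ CARD('n) * ?S) + K * L\<^sup>2 * exp (- t / 8) * sqrt pi ^ CARD('n)
      + K * ?T * (H_norm l u\<^sub>1)\<^sup>2 + K * ?T * (H_norm (l + 1) u\<^sub>0)\<^sup>2 \<le> K * (G + 1) * (data_norm l u\<^sub>0 u\<^sub>1)\<^sup>2 * (?S + ?T)"
      unfolding I_def[symmetric] h1_def[symmetric] h0_def[symmetric]
      by (simp only: distrib_left distrib_right mult.assoc add.assoc mult_1_left)
  qed
  finally show ?thesis
    unfolding profile_error_def error_const_def K_def[symmetric] C'_def[symmetric] G_def .
qed

lemma profile_error_in_L2_space:
  fixes u\<^sub>0 u\<^sub>1 :: "real ^ 'n::finite \<Rightarrow> complex" and t :: real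
  assumes "X2_solution u\<^sub>0 u\<^sub>1 u" and t: "t \<ge> 1"
  shows "profile_error u\<^sub>0 u\<^sub>1 u t \<in> L2_space"
proof -
  obtain v where "H_has_derivative 2 u v" using assms(1) unfolding X2_solution_def by blast
  then have "u t \<in> H_space 2" using t unfolding H_has_derivative_def by auto
  then have u: "fourier (u t) \<in> L2_space"
    using H_space_has_fourier has_fourier_L2_iff by blast
  have "sqnorm (gauss t :: real ^ 'n \<Rightarrow> complex) \<le> (\<integral>\<^sup>+x. ennreal (cmod (gauss t (x :: real ^ 'n))) \<partial>lborel)"
    unfolding sqnorm_def
    by (intro nn_integral_mono ennreal_leI) (use t in \<open>auto simp: gauss_def power2_eq_square intro!: mult_left_le_one_le\<close>)
  also have "\<dots> < \<infinity>" using t by (simp add: nn_integral_gauss)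
  finally have g: "gauss t \<in> (L2_space :: (real ^ 'n \<Rightarrow> complex) set)"
    by (simp add: L2_space_iff)
  show ?thesis
    using L2_space_diff[OF u L2_space_cmult[OF g, of "total_mass u\<^sub>1 + total_mass u\<^sub>0"]]
    by (simp add: gauss_def profile_error_def)
qed

lemma L2_norm_profile_error:
  fixes u\<^sub>0 u\<^sub>1 :: "real ^ 'n::finite \<Rightarrow> complex" and l t :: real
  assumes l: "l \<ge> 0" and u0: "u\<^sub>0 \<in> H_space (l + 1) \<inter> L11_space" and u1: "u\<^sub>1 \<in> H_space l \<inter> L11_space"
    and sol: "X2_solution u\<^sub>0 u\<^sub>1 u" and t: "t \<ge> 1"
  shows "L2_norm (profile_error u\<^sub>0 u\<^sub>1 u t) \<le>
    sqrt (error_const CARD('n) l) * data_norm l u\<^sub>0 u\<^sub>1 * (t powr (- (real CARD('n) + 2) / 4) + t powr (- (l + 1) / 2))"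
proof -
  let ?D = "profile_error u\<^sub>0 u\<^sub>1 u t"
  define C where "C = error_const CARD('n) l"
  have C: "C > 0" unfolding C_def by (rule error_const_pos)
  define I where "I = data_norm l u\<^sub>0 u\<^sub>1"
  have I: "I \<ge> 0" unfolding I_def by (rule data_norm_nonneg)
  define p q where "p = t powr (- (real CARD('n) + 2) / 4)" and "q = t powr (- (l + 1) / 2)"
  have pq: "p \<ge> 0" "q \<ge> 0" by (auto simp: p_def q_def)
  have sq_pq: "t powr (- (real CARD('n) + 2) / 2) = p\<^sup>2" "t powr (- (l + 1)) = q\<^sup>2"
    unfolding p_def q_def power2_eq_square powr_add[symmetric] by (simp_all add: add_divide_distrib)
  have "ennreal ((L2_norm ?D)\<^sup>2) \<le> ennreal (C * I\<^sup>2 * (p\<^sup>2 + q\<^sup>2))"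
    using sqnorm_profile_error[OF l u0 u1 sol t] sqnorm_eq_L2_norm[OF profile_error_in_L2_space[OF sol t]]
    unfolding I_def[symmetric] C_def[symmetric] sq_pq by simp
  then have "(L2_norm ?D)\<^sup>2 \<le> C * I\<^sup>2 * (p\<^sup>2 + q\<^sup>2)"
    using C by (subst (asm) ennreal_le_iff) auto
  also have "\<dots> \<le> C * I\<^sup>2 * (p + q)\<^sup>2"
    using C pq by (intro mult_left_mono) (auto simp: power2_sum)
  also have "\<dots> = (sqrt C * I * (p + q))\<^sup>2"
    using C by (simp add: power_mult_distrib)
  finally have "L2_norm ?D \<le> sqrt C * I * (p + q)"
    by (rule power2_le_imp_le) (use C I pq in \<open>auto intro!: mult_nonneg_nonneg\<close>)
  then show ?thesis unfolding C_def I_def p_def q_def .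
qed

section \<open>The decay of the distance to the heat profile\<close>

theorem theorem3p2:
  fixes l :: real and n :: nat
  assumes "n = CARD('n::finite)"
  shows "\<exists>C>0. \<forall>u\<^sub>0 u\<^sub>1 :: real ^ 'n \<Rightarrow> complex. \<forall>u :: real \<Rightarrow> real ^ 'n \<Rightarrow> complex.
    u\<^sub>0 \<in> H_space (l + 1) \<inter> L11_space \<longrightarrow> u\<^sub>1 \<in> H_space l \<inter> L11_space \<longrightarrow> X2_solution u\<^sub>0 u\<^sub>1 u \<longrightarrow>
    (\<forall>t\<ge>1.
      let D = (\<lambda>\<xi>. fourier (u t) \<xi> -
                (total_mass u\<^sub>1 + total_mass u\<^sub>0) * complex_of_real (exp (- t * (norm \<xi>)\<^sup>2)))
      in D \<in> L2_space \<and>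
         (n = 4 \<and> l = 2 \<or> n = 5 \<and> 2 \<le> l \<and> l \<le> 5/2 \<or>
          n \<ge> 6 \<and> real n / 2 - 1 < l \<and> l \<le> real n / 2
          \<longrightarrow> L2_norm D \<le> C * data_norm l u\<^sub>0 u\<^sub>1 * t powr (- (l + 1) / 2)) \<and>
         (n \<ge> 4 \<and> real n / 2 < l \<or> n \<in> {1, 2, 3} \<and> 2 \<le> l
          \<longrightarrow> L2_norm D \<le> C * data_norm l u\<^sub>0 u\<^sub>1 * t powr (- (real n + 2) / 4)))"
proof (cases "l \<ge> 0")
  case False
  \<comment> \<open>Both ranges of exponents force \<open>l \<ge> 0\<close>, so only square integrability is left.\<close>
  show ?thesis
    unfolding Let_def
    by (intro exI[of _ 1] conjI allI impI profile_error_in_L2_space[unfolded profile_error_def];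
        (assumption | use False in auto))
next
  case True
  define C where "C = sqrt (error_const n l)"
  have C: "C > 0" unfolding C_def using error_const_pos by simp
  show ?thesis
  proof (intro exI[of _ "2 * C"] conjI allI impI)
    fix u\<^sub>0 u\<^sub>1 :: "real ^ 'n \<Rightarrow> complex" and u and t :: real
    assume u: "u\<^sub>0 \<in> H_space (l + 1) \<inter> L11_space" "u\<^sub>1 \<in> H_space l \<inter> L11_space" "X2_solution u\<^sub>0 u\<^sub>1 u" and t: "1 \<le> t"
    define D where "D = profile_error u\<^sub>0 u\<^sub>1 u t"
    define I where "I = data_norm l u\<^sub>0 u\<^sub>1"
    define p q where "p = t powr (- (real n + 2) / 4)" and "q = t powr (- (l + 1) / 2)"
    have I: "I \<ge> 0" unfolding I_def by (rule data_norm_nonneg)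
    have DL: "L2_norm D \<le> C * I * (p + q)"
      unfolding D_def I_def p_def q_def C_def assms by (rule L2_norm_profile_error[OF True u t])
    have "D \<in> L2_space" unfolding D_def by (rule profile_error_in_L2_space[OF u(3) t])
    moreover have "L2_norm D \<le> 2 * C * I * q" if "l \<le> real n / 2"
    proof -
      have "p \<le> q" unfolding p_def q_def using t that by (intro powr_mono) auto
      then have "C * I * (p + q) \<le> C * I * (2 * q)" using C I by (intro mult_left_mono) auto
      then show ?thesis using DL by simp
    qed
    moreover have "L2_norm D \<le> 2 * C * I * p" if "real n / 2 \<le> l"
    proof -
      have "q \<le> p" unfolding p_def q_def using t that by (intro powr_mono) auto
      then have "C * I * (p + q) \<le> C * I * (2 * p)" using C I by (intro mult_left_mono) auto
      then show ?thesis using DL by simp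
    qed
    ultimately show "let D = (\<lambda>\<xi>. fourier (u t) \<xi> - (total_mass u\<^sub>1 + total_mass u\<^sub>0) * complex_of_real (exp (- t * (norm \<xi>)\<^sup>2)))
      in D \<in> L2_space \<and>
         (n = 4 \<and> l = 2 \<or> n = 5 \<and> 2 \<le> l \<and> l \<le> 5/2 \<or>
          n \<ge> 6 \<and> real n / 2 - 1 < l \<and> l \<le> real n / 2
          \<longrightarrow> L2_norm D \<le> 2 * C * data_norm l u\<^sub>0 u\<^sub>1 * t powr (- (l + 1) / 2)) \<and>
         (n \<ge> 4 \<and> real n / 2 < l \<or> n \<in> {1, 2, 3} \<and> 2 \<le> l
          \<longrightarrow> L2_norm D \<le> 2 * C * data_norm l u\<^sub>0 u\<^sub>1 * t powr (- (real n + 2) / 4))"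
      unfolding Let_def profile_error_def[symmetric] D_def[symmetric] I_def[symmetric] p_def[symmetric] q_def[symmetric]
      by (intro conjI impI) (auto simp: field_simps)
  qed (use C in simp)
qed

end
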